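(* Let $\mathbb K$ be a definably complete structure expanding an ordered field. The following are equivalent: 1. every definable discrete closed subset of $\mathbb K$ is pseudo-finite; 2. for every $n\in\mathbb N$, every definable discrete closed subset of $\mathbb K^n$ is pseudo-finite; 3. every definable discrete subset of $\mathbb K$ is pseudo-finite; 4. for every $n\in\mathbb N$, every definable discrete subset of $\mathbb K^n$ is pseudo-finite; 5. every definable nowhere dense subset of $\mathbb K$ is pseudo-finite; 6. every definable meager subset of $\mathbb K$ is pseudo-finite; 7. every definable nowhere dense subset of $\mathbb K$ is discrete; 8. the open core of $\mathbb K$ is locally o-minimal; 9. the union of any definable increasing family of pseudo-finite subsets of $\mathbb K$ is pseudo-finite; 10. for every $n\in\mathbb N$, the union of any definable increasing family of pseudo-finite subsets of $\mathbb K^n$ is pseudo-finite. Moreover, if any of these equivalent conditions is satisfied, then for every $n$ every $\mathcal F_\sigma$ subset of $\mathbb K^n$ is constructible, $\mathbb K$ is Baire, and every meager subset of $\mathbb K^n$ is nowhere dense.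
   Context: Definable means definable with parameters; $\mathbb K^n$ carries the product of the order topology. A linearly ordered structure is definably complete if every definable subset of its domain has a supremum in the domain together with $\pm\infty$. A definable set $X\subseteq\mathbb K^n$ is pseudo-finite if it is closed, bounded and discrete. A set is nowhere dense if its closure has empty interior. A definable increasing family is a definable family $(X_t)_{t\in\mathbb K}$ with $X_s\subseteq X_t$ for $s\le t$. A definable set is meager if it is the union of a definable increasing family of nowhere dense sets. A definable set is an $\mathcal F_\sigma$ if it is the union of a definable increasing family of closed subsets of $\mathbb K^n$. $\mathbb K$ is Baire if $\mathbb K$ is not the union of a definable increasing family of nowhere dense subsets. A set is constructible if it is a finite Boolean combination of open sets. The open core of $\mathbb K$ is the reduct of $\mathbb K$ generated by all definable open subsets of $\mathbb K^n$, for all $n\in\mathbb N$. A definably complete structure $\mathbb K$ is locally o-minimal if for every definable $f:\mathbb K\to\mathbb K$ and every $x\in\mathbb K$ there is $y>x$ such that $f>0$ on $(x,y)$, or $f=0$ on $(x,y)$, or $f<0$ on $(x,y)$. *)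

theory Defs
  imports "HOL-Analysis.Analysis" "HOL-Library.Extended"
begin

text \<open>The universe of a structure is the whole type \<open>'a\<close>. A language may have any sets of
  function and relation symbols; constants are function symbols of arity 0.\<close>

record ('f, 'r, 'a) fo_structure =
  fun_syms :: "'f set"
  fun_arity :: "'f \<Rightarrow> nat"
  fun_interp :: "'f \<Rightarrow> 'a list \<Rightarrow> 'a"
  rel_syms :: "'r set"
  rel_arity :: "'r \<Rightarrow> nat"
  rel_interp :: "'r \<Rightarrow> 'a list \<Rightarrow> bool"

datatype 'f fo_term = Var nat | App 'f "'f fo_term list"

datatype ('f, 'r) fo_formula =
    Eq "'f fo_term" "'f fo_term"
  | Rel 'r "'f fo_term list"
  | Neg "('f, 'r) fo_formula"
  | Conj "('f, 'r) fo_formula" "('f, 'r) fo_formula"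
  | Exi nat "('f, 'r) fo_formula"

fun wf_term :: "('f, 'r, 'a) fo_structure \<Rightarrow> 'f fo_term \<Rightarrow> bool" where
  "wf_term M (Var v) \<longleftrightarrow> True"
| "wf_term M (App f ts) \<longleftrightarrow>
     f \<in> fun_syms M \<and> length ts = fun_arity M f \<and> (\<forall>t\<in>set ts. wf_term M t)"

fun wf_formula :: "('f, 'r, 'a) fo_structure \<Rightarrow> ('f, 'r) fo_formula \<Rightarrow> bool" where
  "wf_formula M (Eq s t) \<longleftrightarrow> wf_term M s \<and> wf_term M t"
| "wf_formula M (Rel r ts) \<longleftrightarrow>
     r \<in> rel_syms M \<and> length ts = rel_arity M r \<and> (\<forall>t\<in>set ts. wf_term M t)"
| "wf_formula M (Neg \<phi>) \<longleftrightarrow> wf_formula M \<phi>"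
| "wf_formula M (Conj \<phi> \<psi>) \<longleftrightarrow> wf_formula M \<phi> \<and> wf_formula M \<psi>"
| "wf_formula M (Exi v \<phi>) \<longleftrightarrow> wf_formula M \<phi>"

fun eval_term :: "('f, 'r, 'a) fo_structure \<Rightarrow> (nat \<Rightarrow> 'a) \<Rightarrow> 'f fo_term \<Rightarrow> 'a" where
  "eval_term M e (Var v) = e v"
| "eval_term M e (App f ts) = fun_interp M f (map (eval_term M e) ts)"

fun sat :: "('f, 'r, 'a) fo_structure \<Rightarrow> (nat \<Rightarrow> 'a) \<Rightarrow> ('f, 'r) fo_formula \<Rightarrow> bool" where
  "sat M e (Eq s t) \<longleftrightarrow> eval_term M e s = eval_term M e t"
| "sat M e (Rel r ts) \<longleftrightarrow> rel_interp M r (map (eval_term M e) ts)"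
| "sat M e (Neg \<phi>) \<longleftrightarrow> \<not> sat M e \<phi>"
| "sat M e (Conj \<phi> \<psi>) \<longleftrightarrow> sat M e \<phi> \<and> sat M e \<psi>"
| "sat M e (Exi v \<phi>) \<longleftrightarrow> (\<exists>a. sat M (e(v := a)) \<phi>)"

text \<open>\<open>Kn n\<close> is the \<open>n\<close>-th Cartesian power of the universe, with coordinates indexed by
  \<open>0, \<dots>, n - 1\<close>. Subsets of the universe itself are treated as subsets of \<open>Kn 1\<close>, unless a
  definition says otherwise.\<close>

definition Kn :: "nat \<Rightarrow> (nat \<Rightarrow> 'a) set" where
  "Kn n = (\<Pi>\<^sub>E i\<in>{..<n}. UNIV)"

text \<open>Variables below \<open>n\<close> are the coordinates; the remaining ones are the parameters, with values
  given by \<open>p\<close>.\<close>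

definition definable :: "('f, 'r, 'a) fo_structure \<Rightarrow> nat \<Rightarrow> (nat \<Rightarrow> 'a) set \<Rightarrow> bool" where
  "definable M n X \<longleftrightarrow>
     (\<exists>\<phi> p. wf_formula M \<phi> \<and> X = {x \<in> Kn n. sat M (\<lambda>i. if i < n then x i else p i) \<phi>})"

definition definable_fun :: "('f, 'r, 'a) fo_structure \<Rightarrow> ('a \<Rightarrow> 'a) \<Rightarrow> bool" where
  "definable_fun M f \<longleftrightarrow> definable M 2 {x \<in> Kn 2. x 1 = f (x 0)}"

text \<open>The index \<open>t\<close> of a family is the last coordinate of its total space.\<close>

definition definable_family ::
  "('f, 'r, 'a) fo_structure \<Rightarrow> nat \<Rightarrow> ('a \<Rightarrow> (nat \<Rightarrow> 'a) set) \<Rightarrow> bool" where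
  "definable_family M n X \<longleftrightarrow>
     (\<forall>t. X t \<subseteq> Kn n) \<and> definable M (Suc n) {y \<in> Kn (Suc n). restrict y {..<n} \<in> X (y n)}"

definition definable_increasing_family ::
  "('f, 'r, 'a::linorder) fo_structure \<Rightarrow> nat \<Rightarrow> ('a \<Rightarrow> (nat \<Rightarrow> 'a) set) \<Rightarrow> bool" where
  "definable_increasing_family M n X \<longleftrightarrow>
     definable_family M n X \<and> (\<forall>s t. s \<le> t \<longrightarrow> X s \<subseteq> X t)"

text \<open>The ordered field is the one given by the type class; its operations and its order must be
  primitives of the structure.\<close>

definition expands_ordered_field :: "('f, 'r, 'a::linordered_field) fo_structure \<Rightarrow> bool" where
  "expands_ordered_field M \<longleftrightarrow>
     (\<exists>z\<in>fun_syms M. fun_arity M z = 0 \<and> fun_interp M z [] = 0) \<and>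
     (\<exists>u\<in>fun_syms M. fun_arity M u = 0 \<and> fun_interp M u [] = 1) \<and>
     (\<exists>a\<in>fun_syms M. fun_arity M a = 2 \<and> (\<forall>x y. fun_interp M a [x, y] = x + y)) \<and>
     (\<exists>m\<in>fun_syms M. fun_arity M m = 2 \<and> (\<forall>x y. fun_interp M m [x, y] = x * y)) \<and>
     (\<exists>l\<in>rel_syms M. rel_arity M l = 2 \<and> (\<forall>x y. rel_interp M l [x, y] \<longleftrightarrow> x < y))"

text \<open>The type \<open>'a extended\<close> adjoins a least and a greatest element to \<open>'a\<close>.\<close>

definition definably_complete :: "('f, 'r, 'a::linorder) fo_structure \<Rightarrow> bool" where
  "definably_complete M \<longleftrightarrow>
     (\<forall>X. definable M 1 {x \<in> Kn 1. x 0 \<in> X} \<longrightarrow>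
        (\<exists>s :: 'a extended. (\<forall>x\<in>X. Fin x \<le> s) \<and> (\<forall>b. (\<forall>x\<in>X. Fin x \<le> b) \<longrightarrow> s \<le> b)))"

definition locally_o_minimal :: "('f, 'r, 'a::linordered_field) fo_structure \<Rightarrow> bool" where
  "locally_o_minimal M \<longleftrightarrow>
     definably_complete M \<and>
     (\<forall>f. definable_fun M f \<longrightarrow>
        (\<forall>x. \<exists>y>x. (\<forall>z\<in>{x<..<y}. f z > 0) \<or> (\<forall>z\<in>{x<..<y}. f z = 0) \<or> (\<forall>z\<in>{x<..<y}. f z < 0)))"

definition Ktop :: "nat \<Rightarrow> (nat \<Rightarrow> 'a::linorder_topology) topology" where
  "Ktop n = product_topology (\<lambda>_. euclidean) {..<n}"

lemma topspace_Ktop [simp]: "topspace (Ktop n) = Kn n"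
  by (simp add: Ktop_def Kn_def)

definition discrete_in :: "'b topology \<Rightarrow> 'b set \<Rightarrow> bool" where
  "discrete_in T X \<longleftrightarrow> subtopology T X = discrete_topology X"

definition nowhere_dense_in :: "'b topology \<Rightarrow> 'b set \<Rightarrow> bool" where
  "nowhere_dense_in T X \<longleftrightarrow> X \<subseteq> topspace T \<and> T interior_of (T closure_of X) = {}"

text \<open>Finite Boolean combinations of arbitrary (not necessarily definable) open sets.\<close>

inductive constructible_in :: "'b topology \<Rightarrow> 'b set \<Rightarrow> bool" for T where
  "openin T U \<Longrightarrow> constructible_in T U"
| "constructible_in T A \<Longrightarrow> constructible_in T (topspace T - A)"
| "constructible_in T A \<Longrightarrow> constructible_in T B \<Longrightarrow> constructible_in T (A \<union> B)"
| "constructible_in T A \<Longrightarrow> constructible_in T B \<Longrightarrow> constructible_in T (A \<inter> B)"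

definition bounded_Kn :: "nat \<Rightarrow> (nat \<Rightarrow> 'a::linordered_field) set \<Rightarrow> bool" where
  "bounded_Kn n X \<longleftrightarrow> (\<exists>r. \<forall>x\<in>X. \<forall>i<n. \<bar>x i\<bar> \<le> r)"

definition pseudo_finite ::
  "('f, 'r, 'a::{linordered_field, linorder_topology}) fo_structure \<Rightarrow> nat \<Rightarrow> (nat \<Rightarrow> 'a) set \<Rightarrow> bool"
where
  "pseudo_finite M n X \<longleftrightarrow>
     definable M n X \<and> closedin (Ktop n) X \<and> bounded_Kn n X \<and> discrete_in (Ktop n) X"

definition meager ::
  "('f, 'r, 'a::linorder_topology) fo_structure \<Rightarrow> nat \<Rightarrow> (nat \<Rightarrow> 'a) set \<Rightarrow> bool" where
  "meager M n X \<longleftrightarrow>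
     definable M n X \<and>
     (\<exists>Y. definable_increasing_family M n Y \<and> (\<forall>t. nowhere_dense_in (Ktop n) (Y t)) \<and> X = (\<Union>t. Y t))"

definition F_sigma ::
  "('f, 'r, 'a::linorder_topology) fo_structure \<Rightarrow> nat \<Rightarrow> (nat \<Rightarrow> 'a) set \<Rightarrow> bool" where
  "F_sigma M n X \<longleftrightarrow>
     definable M n X \<and>
     (\<exists>Y. definable_increasing_family M n Y \<and> (\<forall>t. closedin (Ktop n) (Y t)) \<and> X = (\<Union>t. Y t))"

definition Baire :: "('f, 'r, 'a::linorder_topology) fo_structure \<Rightarrow> bool" where
  "Baire M \<longleftrightarrow>
     \<not> (\<exists>Y. definable_increasing_family M 1 Y \<and> (\<forall>t. nowhere_dense_in (Ktop 1) (Y t)) \<and>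
            Kn 1 = (\<Union>t. Y t))"

text \<open>One relation symbol for each definable open subset of each power of the universe.\<close>

definition open_core ::
  "('f, 'r, 'a::linorder_topology) fo_structure \<Rightarrow> (unit, nat \<times> (nat \<Rightarrow> 'a) set, 'a) fo_structure"
where
  "open_core M =
     \<lparr>fun_syms = {}, fun_arity = (\<lambda>_. 0), fun_interp = (\<lambda>_ _. undefined),
      rel_syms = {(n, U). definable M n U \<and> openin (Ktop n) U},
      rel_arity = fst,
      rel_interp = (\<lambda>(n, U) xs. restrict (nth xs) {..<n} \<in> U)\<rparr>"

end

theory Submission
  imports Defs
begin

text \<open>Everything rests on definable compactness, in the form that a decreasing definable family of nonempty
  bounded sets has a cluster point. It shows that a decreasing definable family of nonempty subsets of a
  pseudo-finite set has a common point, so that a definable disjoint family of such subsets has a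
  pseudo-finite index set, and that projections of \<open>F\<^sub>\<sigma>\<close> sets are \<open>F\<^sub>\<sigma>\<close>.

  If closed discrete definable subsets of the line are bounded, then an increasing union of pseudo-finite sets
  is stationary, because the times at which the family grows form a closed discrete set; this bounds
  discrete sets and (through the midpoints of complementary intervals) nowhere dense subsets of the line.
  A Kuratowski-Ulam argument without countability then gives, by induction on the dimension, that \<open>K\<^sup>n\<close> is
  definably Baire and that \<open>F\<^sub>\<sigma>\<close> sets without interior are nowhere dense. Over a generic point of a
  coordinate space of maximal dimension the fibres of an \<open>F\<^sub>\<sigma>\<close> set are pseudo-finite, hence the set is locally closed
  there; so it is constructible, and the \<open>F\<^sub>\<sigma>\<close> sets are closed under complements as well as
  projections. Thus all sets definable in the open core are \<open>F\<^sub>\<sigma>\<close>, and subsets of the line of that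
  kind have a nowhere dense, hence discrete, boundary.\<close>

section \<open>Substitution in formulas\<close>

text \<open>The field may be non-archimedean and nothing is countable. Finite sets, sequences and
  countable unions are therefore replaced by pseudo-finite sets and by definable families indexed by
  the whole field, and limits along a sequence become definable suprema or infima. Two category
  statements go through the induction on the dimension. The first, \<open>baire\<close>, is the
  usual one. The second, \<open>regular\<close>, fails in the real field with the integers named,
  where the rationals form a dense \<open>fsigma\<close> set without interior, so it is a genuine
  effect of tameness. It is inherited because over a suitable open set of base points all fibres are
  pseudo-finite; compactness and category then put everything over a smaller open set into a single
  closed level. The same fact yields constructibility and hence complements of \<open>fsigma\<close>
  sets, which no formal argument provides and which negation in formulas of the open core requires.
  Powers of the field are indexed by finite sets of coordinates, not by numbers, since these
  inductions project to arbitrary sets of coordinates.\<close>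

fun tvars :: "'f fo_term \<Rightarrow> nat set" where
  "tvars (Var v) = {v}"
| "tvars (App f ts) = (\<Union>t\<in>set ts. tvars t)"

text \<open>Bound variables are included on purpose. In \<open>open_core_fsigma\<close> every
  variable of the formula is a coordinate of the ambient power, so a quantifier is a projection
  inside that power.\<close>

fun fvars :: "('f, 'r) fo_formula \<Rightarrow> nat set" where
  "fvars (Eq s t) = tvars s \<union> tvars t"
| "fvars (Rel r ts) = (\<Union>t\<in>set ts. tvars t)"
| "fvars (Neg \<phi>) = fvars \<phi>"
| "fvars (Conj \<phi> \<psi>) = fvars \<phi> \<union> fvars \<psi>"
| "fvars (Exi v \<phi>) = insert v (fvars \<phi>)"

fun tsubst :: "(nat \<Rightarrow> nat) \<Rightarrow> 'f fo_term \<Rightarrow> 'f fo_term" where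
  "tsubst \<sigma> (Var v) = Var (\<sigma> v)"
| "tsubst \<sigma> (App f ts) = App f (map (tsubst \<sigma>) ts)"

lemma finite_tvars [simp]: "finite (tvars t)"
  by (induction t) auto

lemma finite_fvars [simp]: "finite (fvars \<phi>)"
  by (induction \<phi>) auto

lemma eval_term_cong: "(\<And>i. i \<in> tvars t \<Longrightarrow> e i = e' i) \<Longrightarrow> eval_term M e t = eval_term M e' t"
proof (induction t)
  case (App f ts)
  then have "map (eval_term M e) ts = map (eval_term M e') ts"
    by (intro map_cong) auto
  then show ?case by (simp del: map_eq_conv)
qed auto

lemma sat_cong: "(\<And>i. i \<in> fvars \<phi> \<Longrightarrow> e i = e' i) \<Longrightarrow> sat M e \<phi> = sat M e' \<phi>"
proof (induction \<phi> arbitrary: e e')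
  case (Eq s t)
  have "eval_term M e s = eval_term M e' s" "eval_term M e t = eval_term M e' t"
    by (auto intro!: eval_term_cong Eq)
  then show ?case by (simp only: sat.simps)
next
  case (Rel r ts)
  then have "map (eval_term M e) ts = map (eval_term M e') ts"
    by (intro map_cong eval_term_cong) auto
  then show ?case by (simp only: sat.simps)
next
  case (Neg \<phi>)
  from Neg.IH[of e e'] Neg.prems show ?case by auto
next
  case (Conj \<phi> \<psi>)
  from Conj.IH(1)[of e e'] Conj.IH(2)[of e e'] Conj.prems show ?case by auto
next
  case (Exi v \<phi>)
  have "sat M (e(v := a)) \<phi> = sat M (e'(v := a)) \<phi>" for a
    using Exi.prems by (intro Exi.IH) auto
  then show ?case by simp
qed

lemma eval_tsubst: "eval_term M e (tsubst \<sigma> t) = eval_term M (\<lambda>i. e (\<sigma> i)) t"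
proof (induction t)
  case (App f ts)
  then have "map (eval_term M e \<circ> tsubst \<sigma>) ts = map (eval_term M (\<lambda>i. e (\<sigma> i))) ts"
    by (intro map_cong) auto
  then show ?case by (simp add: comp_def del: map_eq_conv)
qed auto

lemma wf_tsubst: "wf_term M t \<Longrightarrow> wf_term M (tsubst \<sigma> t)"
  by (induction t) auto

text \<open>The renaming \<open>\<sigma>\<close> need not be injective, so a bound variable could be
  captured; it is renamed to some \<open>w\<close> outside the image of all variables. Since
  \<open>w\<close> is merely chosen, the result is an existence statement instead of a function on
  formulas.\<close>

lemma formula_substitution:
  "wf_formula M \<phi> \<Longrightarrow> \<exists>\<phi>'. wf_formula M \<phi>' \<and> (\<forall>e. sat M e \<phi>' = sat M (\<lambda>i. e (\<sigma> i)) \<phi>)"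
proof (induction \<phi> arbitrary: \<sigma>)
  case (Eq s t)
  then show ?case
    by (intro exI[of _ "Eq (tsubst \<sigma> s) (tsubst \<sigma> t)"]) (simp add: eval_tsubst wf_tsubst)
next
  case (Rel r ts)
  have "map (eval_term M e \<circ> tsubst \<sigma>) ts = map (eval_term M (\<lambda>i. e (\<sigma> i))) ts" for e
    by (intro map_cong) (auto simp: eval_tsubst)
  with Rel show ?case
    by (intro exI[of _ "Rel r (map (tsubst \<sigma>) ts)"]) (simp add: wf_tsubst del: map_eq_conv)
next
  case (Neg \<phi>)
  then obtain \<phi>' where "wf_formula M \<phi>'" "\<forall>e. sat M e \<phi>' = sat M (\<lambda>i. e (\<sigma> i)) \<phi>" by auto
  then show ?case by (intro exI[of _ "Neg \<phi>'"]) simp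
next
  case (Conj \<phi> \<psi>)
  from Conj.prems Conj.IH(1)[of \<sigma>] Conj.IH(2)[of \<sigma>] obtain \<phi>' \<psi>' where
    "wf_formula M \<phi>'" "\<forall>e. sat M e \<phi>' = sat M (\<lambda>i. e (\<sigma> i)) \<phi>"
    "wf_formula M \<psi>'" "\<forall>e. sat M e \<psi>' = sat M (\<lambda>i. e (\<sigma> i)) \<psi>" by auto
  then show ?case by (intro exI[of _ "Conj \<phi>' \<psi>'"]) simp
next
  case (Exi v \<phi>)
  obtain w where w: "w \<notin> \<sigma> ` fvars \<phi>"
    by (metis ex_new_if_finite infinite_UNIV_nat finite_imageI finite_fvars)
  from Exi.prems Exi.IH[of "\<sigma>(v := w)"] obtain \<phi>' where
    \<phi>': "wf_formula M \<phi>'" "\<forall>e. sat M e \<phi>' = sat M (\<lambda>i. e ((\<sigma>(v := w)) i)) \<phi>" by auto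
  have "sat M (e(w := a)) \<phi>' = sat M ((\<lambda>i. e (\<sigma> i))(v := a)) \<phi>" for e a
    unfolding \<phi>'(2)[rule_format] using w by (intro sat_cong) auto
  with \<phi>'(1) show ?case by (intro exI[of _ "Exi w \<phi>'"]) simp
qed

section \<open>Definable predicates and terms\<close>

definition pts :: "nat set \<Rightarrow> (nat \<Rightarrow> 'a) set" where
  "pts I = PiE I (\<lambda>_. UNIV)"

lemma Kn_eq_pts: "Kn n = pts {..<n}"
  by (simp add: Kn_def pts_def)

lemma restrict_in_pts [simp]: "restrict f I \<in> pts I"
  by (simp add: pts_def)

lemma pts_restrict [simp]: "x \<in> pts I \<Longrightarrow> restrict x I = x"
  by (simp add: pts_def PiE_restrict)

lemma pts_upd [simp]: "u \<in> pts J \<Longrightarrow> u(k := a) \<in> pts (insert k J)"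
  by (auto simp: pts_def PiE_def extensional_def)

lemma pts_eqI: "\<lbrakk>x \<in> pts I; y \<in> pts I; \<And>i. i \<in> I \<Longrightarrow> x i = y i\<rbrakk> \<Longrightarrow> x = y"
  unfolding pts_def by (rule PiE_ext) auto

text \<open>A formula variable is interpreted either by a coordinate of the environment or by a
  parameter; this keeps parameters and coordinates apart under all operations.\<close>

primrec valof :: "(nat \<Rightarrow> 'a) \<Rightarrow> nat + 'a \<Rightarrow> 'a" where
  "valof e (Inl j) = e j"
| "valof e (Inr c) = c"

text \<open>Predicates on total environments carry no arity, so connectives and quantifiers act on
  them directly; \<open>definable_iff_dpred\<close> gives the link with
  \<open>definable\<close>.\<close>

definition dpred :: "('f, 'r, 'a) fo_structure \<Rightarrow> ((nat \<Rightarrow> 'a) \<Rightarrow> bool) \<Rightarrow> bool" where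
  "dpred M P \<longleftrightarrow> (\<exists>\<phi> s. wf_formula M \<phi> \<and> (\<forall>e. P e = sat M (\<lambda>i. valof e (s i)) \<phi>))"

lemma dpred_definable: "definable M n {x \<in> Kn n. P x}" if "dpred M P"
proof -
  from that obtain \<phi> s where \<phi>: "wf_formula M \<phi>" "\<And>e. P e = sat M (\<lambda>i. valof e (s i)) \<phi>"
    unfolding dpred_def by blast
  \<comment> \<open>On points of \<open>Kn n\<close> a coordinate \<open>j \<ge> n\<close> has the
    value \<open>undefined\<close>, so it turns into a parameter with that value. The parameter of
    formula variable \<open>i\<close> is stored at position \<open>n + i\<close>.\<close>
  define \<sigma> where "\<sigma> i = (case s i of Inl j \<Rightarrow> if j < n then j else n + i | Inr c \<Rightarrow> n + i)" for i
  define p where "p i = (case s (i - n) of Inl j \<Rightarrow> undefined | Inr c \<Rightarrow> c)" for i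
  from formula_substitution[OF \<phi>(1), of \<sigma>] obtain \<phi>' where
    \<phi>': "wf_formula M \<phi>'" "\<And>e. sat M e \<phi>' = sat M (\<lambda>i. e (\<sigma> i)) \<phi>" by blast
  have "P x = sat M (\<lambda>i. if i < n then x i else p i) \<phi>'" if "x \<in> Kn n" for x
  proof -
    have "valof x (s i) = (\<lambda>i. if i < n then x i else p i) (\<sigma> i)" for i
      using that by (auto simp: \<sigma>_def p_def Kn_def PiE_def extensional_def split: sum.split)
    then have "(\<lambda>i. valof x (s i)) = (\<lambda>i. (\<lambda>i. if i < n then x i else p i) (\<sigma> i))" by blast
    then show ?thesis by (simp only: \<phi>(2) \<phi>'(2))
  qed
  with \<phi>'(1) show ?thesis unfolding definable_def by blast
qed

lemma dpred_subst: "dpred M (\<lambda>e. P (\<lambda>i. valof e (\<tau> i)))" if "dpred M P"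
proof -
  from that obtain \<phi> s where \<phi>: "wf_formula M \<phi>" "\<And>e. P e = sat M (\<lambda>i. valof e (s i)) \<phi>"
    unfolding dpred_def by blast
  have "valof (\<lambda>i. valof e (\<tau> i)) (s i) = valof e (case s i of Inl j \<Rightarrow> \<tau> j | Inr c \<Rightarrow> Inr c)" for e i
    by (cases "s i") auto
  with \<phi> show ?thesis unfolding dpred_def
    by (intro exI[of _ \<phi>] exI[of _ "\<lambda>i. case s i of Inl j \<Rightarrow> \<tau> j | Inr c \<Rightarrow> Inr c"]) simp
qed

lemma dpred_rename: "dpred M P \<Longrightarrow> dpred M (\<lambda>e. P (\<lambda>i. e (\<tau> i)))"
  using dpred_subst[of M P "\<lambda>i. Inl (\<tau> i)"] by simp

lemma definable_iff_dpred:
  "definable M n X \<longleftrightarrow> X \<subseteq> Kn n \<and> dpred M (\<lambda>e. restrict e {..<n} \<in> X)"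
proof
  assume "definable M n X"
  then obtain \<phi> p where \<phi>: "wf_formula M \<phi>"
    "X = {x \<in> Kn n. sat M (\<lambda>i. if i < n then x i else p i) \<phi>}"
    unfolding definable_def by blast
  have "restrict e {..<n} \<in> X \<longleftrightarrow> sat M (\<lambda>i. valof e (if i < n then Inl i else Inr (p i))) \<phi>" for e
  proof -
    have "(\<lambda>i. if i < n then restrict e {..<n} i else p i) =
        (\<lambda>i. valof e (if i < n then Inl i else Inr (p i)))" by (rule ext) simp
    then show ?thesis by (simp add: \<phi>(2) Kn_eq_pts)
  qed
  with \<phi> show "X \<subseteq> Kn n \<and> dpred M (\<lambda>e. restrict e {..<n} \<in> X)"
    unfolding dpred_def by (intro conjI exI[of _ \<phi>] exI[of _ "\<lambda>i. if i < n then Inl i else Inr (p i)"]) auto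
next
  assume *: "X \<subseteq> Kn n \<and> dpred M (\<lambda>e. restrict e {..<n} \<in> X)"
  from dpred_definable[OF *[THEN conjunct2], of n]
  have "definable M n {x \<in> Kn n. restrict x {..<n} \<in> X}" .
  moreover have "{x \<in> Kn n. restrict x {..<n} \<in> X} = X"
    using * by (auto simp: Kn_eq_pts subset_iff)
  ultimately show "definable M n X" by simp
qed

lemma dpred_not: "dpred M P \<Longrightarrow> dpred M (\<lambda>e. \<not> P e)"
  unfolding dpred_def by (metis wf_formula.simps(3) sat.simps(3))

lemma dpred_conj: "dpred M (\<lambda>e. P e \<and> Q e)" if PQ: "dpred M P" "dpred M Q"
proof -
  from PQ obtain \<phi> s \<psi> r where
    \<phi>: "wf_formula M \<phi>" "\<And>e. P e = sat M (\<lambda>i. valof e (s i)) \<phi>" and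
    \<psi>: "wf_formula M \<psi>" "\<And>e. Q e = sat M (\<lambda>i. valof e (r i)) \<psi>"
    unfolding dpred_def by blast
  \<comment> \<open>The variables of the two formulas are moved to even and odd positions, so that
    the independent assignments \<open>s\<close> and \<open>r\<close> merge into the single
    assignment \<open>q\<close>.\<close>
  from formula_substitution[OF \<phi>(1), of "\<lambda>i. 2 * i"] obtain \<phi>' where
    \<phi>': "wf_formula M \<phi>'" "\<And>e. sat M e \<phi>' = sat M (\<lambda>i. e (2 * i)) \<phi>" by blast
  from formula_substitution[OF \<psi>(1), of "\<lambda>i. Suc (2 * i)"] obtain \<psi>' where
    \<psi>': "wf_formula M \<psi>'" "\<And>e. sat M e \<psi>' = sat M (\<lambda>i. e (Suc (2 * i))) \<psi>" by blast
  define q where "q i = (if even i then s (i div 2) else r (i div 2))" for i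
  have "(P e \<and> Q e) = sat M (\<lambda>i. valof e (q i)) (Conj \<phi>' \<psi>')" for e
    by (simp add: \<phi>(2) \<phi>'(2) \<psi>(2) \<psi>'(2) comp_def q_def)
  moreover have "wf_formula M (Conj \<phi>' \<psi>')" using \<phi>'(1) \<psi>'(1) by simp
  ultimately show ?thesis unfolding dpred_def by blast
qed

text \<open>De Bruijn style: in the premise the quantified value is coordinate 0 and the old
  environment is shifted by one.\<close>

lemma dpred_ex: "dpred M (\<lambda>e. \<exists>a. Q e a)" if "dpred M (\<lambda>e. Q (\<lambda>i. e (Suc i)) (e 0))"
proof -
  from that obtain \<phi> s where \<phi>: "wf_formula M \<phi>"
    "\<And>e. Q (\<lambda>i. e (Suc i)) (e 0) = sat M (\<lambda>i. valof e (s i)) \<phi>"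
    unfolding dpred_def by blast
  \<comment> \<open>Several formula variables may read coordinate 0; all of them are merged into
    variable 0, which is then bound, and the others move out of its way.\<close>
  define \<sigma> where "\<sigma> i = (if s i = Inl 0 then 0 else Suc i)" for i
  define r where "r i = (case s (i - 1) of Inl j \<Rightarrow> Inl (j - 1) | Inr c \<Rightarrow> Inr c)" for i :: nat
  from formula_substitution[OF \<phi>(1), of \<sigma>] obtain \<phi>' where
    \<phi>': "wf_formula M \<phi>'" "\<And>e. sat M e \<phi>' = sat M (\<lambda>i. e (\<sigma> i)) \<phi>" by blast
  have "Q e a = sat M ((\<lambda>i. valof e (r i))(0 := a)) \<phi>'" for e a
  proof -
    have "valof (case_nat a e) (s i) = ((\<lambda>i. valof e (r i))(0 := a)) (\<sigma> i)" for i
      by (auto simp: \<sigma>_def r_def split: sum.split nat.split)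
    then have "(\<lambda>i. valof (case_nat a e) (s i)) = (\<lambda>i. ((\<lambda>i. valof e (r i))(0 := a)) (\<sigma> i))" by blast
    then show ?thesis using \<phi>(2)[of "case_nat a e"] by (simp only: \<phi>'(2) nat.case)
  qed
  then have "(\<exists>a. Q e a) = sat M (\<lambda>i. valof e (r i)) (Exi 0 \<phi>')" for e by simp
  moreover have "wf_formula M (Exi 0 \<phi>')" using \<phi>'(1) by simp
  ultimately show ?thesis unfolding dpred_def by blast
qed

lemma dpred_disj: "dpred M P \<Longrightarrow> dpred M Q \<Longrightarrow> dpred M (\<lambda>e. P e \<or> Q e)"
  using dpred_not[OF dpred_conj[OF dpred_not dpred_not], of M P Q] by simp

lemma dpred_imp: "dpred M P \<Longrightarrow> dpred M Q \<Longrightarrow> dpred M (\<lambda>e. P e \<longrightarrow> Q e)"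
  unfolding imp_conv_disj by (intro dpred_disj dpred_not)

lemma dpred_all:
  assumes "dpred M (\<lambda>e. Q (\<lambda>i. e (Suc i)) (e 0))" shows "dpred M (\<lambda>e. \<forall>a. Q e a)"
  using dpred_not[OF dpred_ex[of M "\<lambda>e a. \<not> Q e a", OF dpred_not[OF assms]]] by simp

lemma dpred_eq_var: "dpred M (\<lambda>e. e i = e j)"
  unfolding dpred_def by (intro exI[of _ "Eq (Var i) (Var j)"] exI[of _ Inl]) simp

lemma dpred_const: "dpred M (\<lambda>_. b)"
proof -
  have t: "dpred M (\<lambda>e. e 0 = e 0)" by (rule dpred_eq_var)
  show ?thesis using t dpred_not[OF t] by (cases b) simp_all
qed

lemma dpred_ball_fin:
  assumes "finite I" "\<And>i. i \<in> I \<Longrightarrow> dpred M (\<lambda>e. P i e)"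
  shows "dpred M (\<lambda>e. \<forall>i\<in>I. P i e)"
  using assms
proof (induction I)
  case empty
  show ?case using dpred_const[of M True] by simp
next
  case (insert i I)
  then show ?case using dpred_conj[of M "P i" "\<lambda>e. \<forall>i\<in>I. P i e"] by simp
qed

text \<open>Definable functions, not terms of the language: absolute value and inverse belong here
  although they need not be symbols.\<close>

definition dterm :: "('f, 'r, 'a) fo_structure \<Rightarrow> ((nat \<Rightarrow> 'a) \<Rightarrow> 'a) \<Rightarrow> bool" where
  "dterm M f \<longleftrightarrow> dpred M (\<lambda>e. e 0 = f (\<lambda>i. e (Suc i)))"

lemma dterm_var: "dterm M (\<lambda>e. e i)"
  unfolding dterm_def by (rule dpred_eq_var)

lemma dterm_const: "dterm M (\<lambda>_. c)"
  using dpred_subst[OF dpred_eq_var[of M 0 1], of "case_nat (Inl 0) (\<lambda>_. Inr c)"]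
  unfolding dterm_def by simp

lemma dpred_subst1:
  assumes R: "dpred M (\<lambda>e. R (\<lambda>i. e (Suc i)) (e 0))" and f: "dterm M f"
  shows "dpred M (\<lambda>e. R e (f e))"
  using dpred_ex[of M "\<lambda>e a. a = f e \<and> R e a"] dpred_conj[OF f[unfolded dterm_def] R] by simp

lemma dterm_rename: "dterm M f \<Longrightarrow> dterm M (\<lambda>e. f (\<lambda>i. e (\<tau> i)))"
  using dpred_rename[of M "\<lambda>e. e 0 = f (\<lambda>i. e (Suc i))" "case_nat 0 (\<lambda>i. Suc (\<tau> i))"]
  unfolding dterm_def by simp

lemma dpred_app1:
  assumes R: "dpred M (\<lambda>e. R (e 0))" and f: "dterm M f"
  shows "dpred M (\<lambda>e. R (f e))"
  using R f by (rule dpred_subst1)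

lemma dpred_app2:
  assumes R: "dpred M (\<lambda>e. R (e 0) (e 1))" and f: "dterm M f" and g: "dterm M g"
  shows "dpred M (\<lambda>e. R (f e) (g e))"
proof (rule dpred_subst1[OF _ g])
  have R': "dpred M (\<lambda>e. R (e 0) (e (Suc 0)))" using R by simp
  show "dpred M (\<lambda>e. R (f (\<lambda>i. e (Suc i))) (e 0))"
    using dpred_subst1[of M "\<lambda>e a. R a (e 0)" "\<lambda>e. f (\<lambda>i. e (Suc i))", OF R' dterm_rename[OF f]] .
qed

lemma dterm_app2:
  assumes F: "dpred M (\<lambda>e. e 0 = F (e 1) (e 2))" and f: "dterm M f" and g: "dterm M g"
  shows "dterm M (\<lambda>e. F (f e) (g e))"
proof -
  have 1: "dpred M (\<lambda>e. e (Suc (Suc 0)) = F (e 0) (e 1))"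
    using dpred_rename[OF F, of "\<lambda>i. if i = 0 then 2 else i - 1"] by (simp add: numeral_2_eq_2)
  have "dpred M (\<lambda>e. e (Suc 0) = F (e 0) (g (\<lambda>i. e (Suc (Suc i)))))"
  proof (rule dpred_subst1[where R = "\<lambda>e a. e (Suc 0) = F (e 0) a"])
    show "dpred M (\<lambda>e. e (Suc (Suc 0)) = F (e (Suc 0)) (e 0))"
      using dpred_rename[OF 1, of "\<lambda>i. if i = 0 then 1 else if i = 1 then 0 else i"] by simp
  qed (rule dterm_rename[OF g])
  then have "dpred M (\<lambda>e. (\<lambda>e a. e 0 = F a (g (\<lambda>i. e (Suc i)))) (\<lambda>i. e (Suc i)) (e 0))" by simp
  from dpred_subst1[OF this dterm_rename[OF f, of Suc]] show ?thesis
    unfolding dterm_def .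
qed

lemma dpred_eq: "dterm M f \<Longrightarrow> dterm M g \<Longrightarrow> dpred M (\<lambda>e. f e = g e)"
  using dpred_app2[of M "(=)" f g, OF dpred_eq_var] .

lemma dterm_app1:
  assumes F: "dpred M (\<lambda>e. e 0 = F (e 1))" and f: "dterm M f"
  shows "dterm M (\<lambda>e. F (f e))"
  using dterm_app2[of M "\<lambda>a b. F a" f f] assms by simp

section \<open>Definable points, sets and families in powers indexed by finite sets\<close>

definition dpoint :: "('f, 'r, 'a) fo_structure \<Rightarrow> nat set \<Rightarrow> ((nat \<Rightarrow> 'a) \<Rightarrow> nat \<Rightarrow> 'a) \<Rightarrow> bool" where
  "dpoint M I f \<longleftrightarrow> (\<forall>i\<in>I. dterm M (\<lambda>e. f e i))"

lemma dpoint_const: "dpoint M I (\<lambda>_. c)"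
  by (simp add: dpoint_def dterm_const)

lemma dterm_restrict: "(\<And>j. dterm M (\<lambda>e. f j e)) \<Longrightarrow> dterm M (\<lambda>e. restrict (\<lambda>j. f j e) J i)"
  by (cases "i \<in> J") (simp_all add: dterm_const)

lemma dpoint_restrict: "(\<And>j. dterm M (\<lambda>e. f j e)) \<Longrightarrow> dpoint M I (\<lambda>e. restrict (\<lambda>j. f j e) J)"
  unfolding dpoint_def by (blast intro: dterm_restrict)

lemma dpoint_upd: "dpoint M (I - {k}) f \<Longrightarrow> dterm M g \<Longrightarrow> dpoint M I (\<lambda>e. (f e)(k := g e))"
  unfolding dpoint_def
proof
  fix i assume "\<forall>i\<in>I - {k}. dterm M (\<lambda>e. f e i)" "dterm M g" "i \<in> I"
  then show "dterm M (\<lambda>e. ((f e)(k := g e)) i)" by (cases "i = k") simp_all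
qed

lemma dpred_ex_block:
  assumes P: "dpred M P"
  shows "dpred M (\<lambda>e. \<exists>x. P (\<lambda>i. if i < N then x i else e (i - N)))"
proof (induction N)
  case 0
  show ?case using P by simp
next
  case (Suc N)
  define S where "S e \<longleftrightarrow> (\<exists>x. P (\<lambda>i. if i < N then x i else e (i - N)))" for e
  have "case_nat (e 0) (\<lambda>i. e (Suc i)) = e" for e :: "nat \<Rightarrow> 'c"
    by (auto simp: fun_eq_iff split: nat.split)
  with Suc have "dpred M (\<lambda>e. \<exists>a. S (case_nat a e))"
    using dpred_ex[of M "\<lambda>e a. S (case_nat a e)"] by (simp add: S_def)
  moreover have "(\<exists>a. S (case_nat a e)) \<longleftrightarrow> (\<exists>x. P (\<lambda>i. if i < Suc N then x i else e (i - Suc N)))" for e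
  proof -
    define G where "G x = (\<lambda>i. if i < Suc N then x i else e (i - Suc N))" for x
    have "(if i < N then x i else case_nat a e (i - N)) = G (x(N := a)) i" for a x i
      by (cases i N rule: linorder_cases) (auto simp: G_def dest: less_imp_Suc_add)
    then have "S (case_nat a e) \<longleftrightarrow> (\<exists>x. P (G (x(N := a))))" for a by (simp add: S_def)
    then have "(\<exists>a. S (case_nat a e)) \<longleftrightarrow> (\<exists>x. P (G x))" by (metis fun_upd_triv)
    then show ?thesis by (simp add: G_def)
  qed
  ultimately show ?case by simp
qed

definition bnd :: "nat set \<Rightarrow> nat" where
  "bnd I = Suc (Max (insert 0 I))"

lemma less_bnd: "finite I \<Longrightarrow> i \<in> I \<Longrightarrow> i < bnd I"
  by (simp add: bnd_def less_Suc_eq_le)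

text \<open>The point occupies the coordinates \<open>I\<close> of a block of length
  \<open>bnd I\<close>. The whole block is quantified, and the environment starts after it.\<close>

lemma dpred_ex_pts:
  assumes I: "finite I" and "dpred M (\<lambda>e. Q (\<lambda>i. e (i + bnd I)) (restrict (\<lambda>i. e i) I))"
  shows "dpred M (\<lambda>e. \<exists>x\<in>pts I. Q e x)"
  using dpred_ex_block[OF assms(2), of "bnd I"]
proof (rule back_subst[where P = "dpred M"], intro ext iffI)
  fix e
  assume "\<exists>x. Q (\<lambda>i. if i + bnd I < bnd I then x (i + bnd I) else e (i + bnd I - bnd I))
                (\<lambda>i\<in>I. if i < bnd I then x i else e (i - bnd I))"
  then obtain x where "Q e (restrict (\<lambda>i. if i < bnd I then x i else e (i - bnd I)) I)" by auto
  then show "\<exists>x\<in>pts I. Q e x" by (meson restrict_in_pts)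
next
  fix e
  assume "\<exists>x\<in>pts I. Q e x"
  then obtain x where x: "x \<in> pts I" "Q e x" by blast
  have "restrict (\<lambda>i. if i < bnd I then x i else e (i - bnd I)) I = x"
    using x(1) less_bnd[OF I] by (intro pts_eqI[of _ I]) auto
  with x(2) show "\<exists>x. Q (\<lambda>i. if i + bnd I < bnd I then x (i + bnd I) else e (i + bnd I - bnd I))
                (\<lambda>i\<in>I. if i < bnd I then x i else e (i - bnd I))"
    by (intro exI[of _ x]) simp
qed

lemma dpred_all_pts:
  assumes I: "finite I" and "dpred M (\<lambda>e. Q (\<lambda>i. e (i + bnd I)) (restrict (\<lambda>i. e i) I))"
  shows "dpred M (\<lambda>e. \<forall>x\<in>pts I. Q e x)"
  using dpred_not[OF dpred_ex_pts[of I M "\<lambda>e x. \<not> Q e x", OF I dpred_not[OF assms(2)]]] by simp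

definition dset :: "('f, 'r, 'a) fo_structure \<Rightarrow> nat set \<Rightarrow> (nat \<Rightarrow> 'a) set \<Rightarrow> bool" where
  "dset M I X \<longleftrightarrow> finite I \<and> X \<subseteq> pts I \<and> dpred M (\<lambda>e. restrict e I \<in> X)"

lemma definable_iff_dset: "definable M n X \<longleftrightarrow> dset M {..<n} X"
  by (simp add: definable_iff_dpred dset_def Kn_eq_pts)

text \<open>The index sits at coordinate 0, where \<open>dpred_ex\<close> and
  \<open>dpred_all\<close> expect a quantified value; \<open>definable_family_iff\<close> translates
  from the index in last position.\<close>

definition dfam :: "('f, 'r, 'a) fo_structure \<Rightarrow> nat set \<Rightarrow> ('a \<Rightarrow> (nat \<Rightarrow> 'a) set) \<Rightarrow> bool" where
  "dfam M I Y \<longleftrightarrow> finite I \<and> (\<forall>t. Y t \<subseteq> pts I) \<and>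
     dpred M (\<lambda>e. restrict (\<lambda>i. e (Suc i)) I \<in> Y (e 0))"

text \<open>Substitution of a whole point: quantify over \<open>x\<close> agreeing with
  \<open>f e\<close> on \<open>I\<close>. Since both lie in \<open>pts I\<close>, such an
  \<open>x\<close> is \<open>f e\<close>.\<close>

lemma dpred_fam:
  assumes Y: "dfam M I Y" and f: "dpoint M I f" and g: "dterm M g" and f_pts: "\<And>e. f e \<in> pts I"
  shows "dpred M (\<lambda>e. f e \<in> Y (g e))"
proof -
  have I: "finite I" using Y by (simp add: dfam_def)
  define N where "N = bnd I"
  have Y': "dpred M (\<lambda>e. restrict (\<lambda>i. e (Suc i)) I \<in> Y (e 0))" using Y by (simp add: dfam_def)
  have "dpred M (\<lambda>e. (\<lambda>e t. restrict (\<lambda>i. e i) I \<in> Y t) (\<lambda>i. e (Suc i)) (e 0))" using Y' by simp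
  then have "dpred M (\<lambda>e. restrict (\<lambda>i. e i) I \<in> Y (g (\<lambda>i. e (i + N))))"
    by (rule dpred_subst1) (rule dterm_rename[OF g])
  moreover have "dpred M (\<lambda>e. \<forall>i\<in>I. e i = f (\<lambda>i. e (i + N)) i)"
  proof (rule dpred_ball_fin[OF I])
    fix i assume "i \<in> I"
    then have "dterm M (\<lambda>e. f (\<lambda>i. e (i + N)) i)"
      using dterm_rename[of M "\<lambda>e. f e i" "\<lambda>i. i + N"] f by (simp add: dpoint_def)
    then show "dpred M (\<lambda>e. e i = f (\<lambda>i. e (i + N)) i)" by (intro dpred_eq dterm_var)
  qed
  ultimately have "dpred M (\<lambda>e. (\<forall>i\<in>I. restrict (\<lambda>i. e i) I i = f (\<lambda>i. e (i + bnd I)) i) \<and>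
      restrict (\<lambda>i. e i) I \<in> Y (g (\<lambda>i. e (i + bnd I))))"
    unfolding N_def by (simp add: dpred_conj)
  from dpred_ex_pts[OF I, of M "\<lambda>e x. (\<forall>i\<in>I. x i = f e i) \<and> x \<in> Y (g e)", OF this]
  have "dpred M (\<lambda>e. \<exists>x\<in>pts I. (\<forall>i\<in>I. x i = f e i) \<and> x \<in> Y (g e))" .
  moreover have "(\<exists>x\<in>pts I. (\<forall>i\<in>I. x i = f e i) \<and> x \<in> Y (g e)) \<longleftrightarrow> f e \<in> Y (g e)" for e
    using f_pts[of e] by (metis pts_eqI)
  ultimately show ?thesis by simp
qed

lemma dset_fam: "dset M I X \<Longrightarrow> dfam M I (\<lambda>_. X)"
  unfolding dset_def dfam_def by (auto dest: dpred_rename[of _ _ Suc])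

lemma dpred_mem:
  assumes "dset M I X" "dpoint M I f" "\<And>e. f e \<in> pts I"
  shows "dpred M (\<lambda>e. f e \<in> X)"
  by (rule dpred_fam[OF dset_fam[OF assms(1)] assms(2) dterm_const assms(3)])

lemma dfam_dset: "dfam M I Y \<Longrightarrow> dset M I (Y t)"
  unfolding dset_def
  by (auto simp: dfam_def simp del: restrict_apply intro!: dpred_fam[of M I Y] dpoint_restrict dterm_const dterm_var)

lemma definable_family_iff: "definable_family M n Y \<longleftrightarrow> dfam M {..<n} Y"
proof -
  have *: "definable M (Suc n) {y \<in> Kn (Suc n). restrict y {..<n} \<in> Y (y n)} \<longleftrightarrow>
    dpred M (\<lambda>e. restrict e {..<n} \<in> Y (e n))" (is "_ \<longleftrightarrow> dpred M ?P")
  proof -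
    have "restrict (restrict e {..<Suc n}) {..<n} = restrict e {..<n}" for e :: "nat \<Rightarrow> 'c"
      by (auto simp: fun_eq_iff)
    then show ?thesis by (auto simp: definable_iff_dpred Kn_eq_pts)
  qed
  show ?thesis
  proof
    assume L: "definable_family M n Y"
    then have "dpred M ?P" using * by (simp add: definable_family_def)
    from dpred_rename[OF this, of "\<lambda>i. if i < n then Suc i else 0"]
    have "dpred M (\<lambda>e. restrict (\<lambda>i. if i < n then e (Suc i) else e 0) {..<n} \<in> Y (e 0))"
      by (simp add: if_distrib cong: if_cong)
    moreover have "restrict (\<lambda>i. if i < n then e (Suc i) else e 0) {..<n} = restrict (\<lambda>i. e (Suc i)) {..<n}"
      for e :: "nat \<Rightarrow> 'c" by (auto simp: fun_eq_iff)
    ultimately show "dfam M {..<n} Y" using L by (simp add: dfam_def definable_family_def Kn_eq_pts)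
  next
    assume R: "dfam M {..<n} Y"
    have "dpred M ?P"
      by (rule dpred_fam[OF R]) (auto intro!: dpoint_restrict dterm_var)
    with R * show "definable_family M n Y" by (simp add: dfam_def definable_family_def Kn_eq_pts)
  qed
qed

section \<open>Definable topology of the ordered field\<close>

definition cube :: "nat set \<Rightarrow> (nat \<Rightarrow> 'a::linordered_field) \<Rightarrow> 'a \<Rightarrow> (nat \<Rightarrow> 'a) set" where
  "cube I x \<epsilon> = {y \<in> pts I. \<forall>i\<in>I. \<bar>y i - x i\<bar> < \<epsilon>}"

lemma cube_subset_pts: "cube I x \<epsilon> \<subseteq> pts I"
  by (auto simp: cube_def)

lemma cube_mono: "\<epsilon> \<le> \<delta> \<Longrightarrow> cube I x \<epsilon> \<subseteq> cube I x \<delta>"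
  by (auto simp: cube_def)

lemma cube_center: "x \<in> pts I \<Longrightarrow> 0 < \<epsilon> \<Longrightarrow> x \<in> cube I x \<epsilon>"
  by (auto simp: cube_def)

lemma finite_radius:
  fixes P :: "nat \<Rightarrow> 'a::linordered_field \<Rightarrow> bool"
  assumes "finite I" "\<And>i. i \<in> I \<Longrightarrow> \<exists>\<epsilon>>0. P i \<epsilon>"
    and "\<And>i \<epsilon> \<delta>. i \<in> I \<Longrightarrow> P i \<epsilon> \<Longrightarrow> 0 < \<delta> \<Longrightarrow> \<delta> \<le> \<epsilon> \<Longrightarrow> P i \<delta>"
  shows "\<exists>\<epsilon>>0. \<forall>i\<in>I. P i \<epsilon>"
  using assms
proof (induction I)
  case empty
  show ?case by (rule exI[of _ 1]) simp
next
  case (insert j I)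
  have "\<exists>\<epsilon>>0. \<forall>i\<in>I. P i \<epsilon>"
    by (rule insert.IH) (blast intro: insert.prems)+
  then obtain \<epsilon> where \<epsilon>: "\<epsilon> > 0" "\<forall>i\<in>I. P i \<epsilon>" by blast
  from insert.prems(1)[of j] obtain \<delta> where \<delta>: "\<delta> > 0" "P j \<delta>" by auto
  show ?case
  proof (intro exI[of _ "min \<epsilon> \<delta>"] conjI ballI)
    have m: "min \<epsilon> \<delta> > 0" using \<epsilon> \<delta> by simp
    fix i assume i: "i \<in> insert j I"
    then consider "i = j" | "i \<in> I" by blast
    then show "P i (min \<epsilon> \<delta>)"
    proof cases
      case 1
      show ?thesis using insert.prems(2)[OF i _ m, of \<delta>] \<delta>(2) 1 by simp
    next
      case 2
      show ?thesis using insert.prems(2)[OF i _ m, of \<epsilon>] \<epsilon>(2) 2 by simp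
    qed
  qed (use \<epsilon> \<delta> in simp)
qed

lemma cube_nested:
  assumes I: "finite I" and y: "y \<in> cube I x \<epsilon>"
  shows "\<exists>\<delta>>0. cube I y \<delta> \<subseteq> cube I x \<epsilon>"
proof -
  have "\<exists>\<delta>>0. \<forall>i\<in>I. \<bar>y i - x i\<bar> + \<delta> \<le> \<epsilon>"
  proof (rule finite_radius[OF I])
    fix i assume "i \<in> I"
    then show "\<exists>\<delta>>0. \<bar>y i - x i\<bar> + \<delta> \<le> \<epsilon>"
      using y by (intro exI[of _ "\<epsilon> - \<bar>y i - x i\<bar>"]) (simp add: cube_def)
  qed auto
  then obtain \<delta> where \<delta>: "\<delta> > 0" "\<forall>i\<in>I. \<bar>y i - x i\<bar> + \<delta> \<le> \<epsilon>" by blast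
  have "\<bar>z i - x i\<bar> < \<epsilon>" if "z \<in> cube I y \<delta>" "i \<in> I" for z i
  proof -
    have "\<bar>z i - y i\<bar> < \<delta>" "\<bar>y i - x i\<bar> + \<delta> \<le> \<epsilon>" using that \<delta> by (auto simp: cube_def)
    then show ?thesis by (simp add: abs_if split: if_splits)
  qed
  with \<delta>(1) show ?thesis by (intro exI[of _ \<delta>]) (auto simp: cube_def)
qed

lemma cube_restrict:
  assumes "J \<subseteq> I" "y \<in> cube I x \<epsilon>"
  shows "restrict y J \<in> cube J (restrict x J) \<epsilon>" "restrict y J \<in> cube J x \<epsilon>"
  using assms by (auto simp: cube_def)

text \<open>Closure, closed and open are phrased with cubes of radius in the field, so that they
  unfold to first-order conditions. They are matched with the product topology only at the
  end.\<close>

definition clo :: "nat set \<Rightarrow> (nat \<Rightarrow> 'a::linordered_field) set \<Rightarrow> (nat \<Rightarrow> 'a) set" where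
  "clo I X = {x \<in> pts I. \<forall>\<epsilon>>0. cube I x \<epsilon> \<inter> X \<noteq> {}}"

definition cls :: "nat set \<Rightarrow> (nat \<Rightarrow> 'a::linordered_field) set \<Rightarrow> bool" where
  "cls I C \<longleftrightarrow> C \<subseteq> pts I \<and> clo I C \<subseteq> C"

definition opn :: "nat set \<Rightarrow> (nat \<Rightarrow> 'a::linordered_field) set \<Rightarrow> bool" where
  "opn I U \<longleftrightarrow> U \<subseteq> pts I \<and> (\<forall>x\<in>U. \<exists>\<epsilon>>0. cube I x \<epsilon> \<subseteq> U)"

text \<open>Nonempty interior. For \<open>I = {}\<close> this just means nonempty, which starts the
  inductions on the dimension.\<close>

definition solid :: "nat set \<Rightarrow> (nat \<Rightarrow> 'a::linordered_field) set \<Rightarrow> bool" where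
  "solid I X \<longleftrightarrow> (\<exists>x\<in>pts I. \<exists>\<epsilon>>0. cube I x \<epsilon> \<subseteq> X)"

definition bdd :: "nat set \<Rightarrow> (nat \<Rightarrow> 'a::linordered_field) set \<Rightarrow> bool" where
  "bdd I X \<longleftrightarrow> (\<exists>r. \<forall>x\<in>X. \<forall>i\<in>I. \<bar>x i\<bar> \<le> r)"

lemma clo_mono: "X \<subseteq> Y \<Longrightarrow> clo I X \<subseteq> clo I Y"
  unfolding clo_def by blast

lemma clo_subset: "X \<subseteq> pts I \<Longrightarrow> X \<subseteq> clo I X"
  using cube_center unfolding clo_def by blast

lemma cls_clo: assumes I: "finite I" shows "cls I (clo I X)"
  unfolding cls_def
proof (intro conjI subsetI)
  fix x assume x: "x \<in> clo I (clo I X)"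
  show "x \<in> clo I X" unfolding clo_def
  proof (intro CollectI conjI allI impI)
    show "x \<in> pts I" using x by (simp add: clo_def)
    fix \<epsilon> :: 'a assume "\<epsilon> > 0"
    with x obtain y where y: "y \<in> cube I x \<epsilon>" "y \<in> clo I X" unfolding clo_def by blast
    from cube_nested[OF I y(1)] obtain \<delta> where "\<delta> > 0" "cube I y \<delta> \<subseteq> cube I x \<epsilon>" by blast
    with y(2) show "cube I x \<epsilon> \<inter> X \<noteq> {}" unfolding clo_def by blast
  qed
qed (simp add: clo_def)

lemma clsD: "cls I C \<Longrightarrow> x \<in> pts I \<Longrightarrow> (\<And>\<epsilon>. 0 < \<epsilon> \<Longrightarrow> \<exists>y\<in>C. y \<in> cube I x \<epsilon>) \<Longrightarrow> x \<in> C"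
  unfolding cls_def clo_def by blast

lemma clsI:
  assumes "C \<subseteq> pts I" "\<And>x. x \<in> pts I \<Longrightarrow> x \<notin> C \<Longrightarrow> \<exists>\<epsilon>>0. cube I x \<epsilon> \<inter> C = {}"
  shows "cls I C"
  using assms unfolding cls_def clo_def by blast

lemma cls_avoid: "cls I C \<Longrightarrow> x \<in> pts I \<Longrightarrow> x \<notin> C \<Longrightarrow> \<exists>\<epsilon>>0. cube I x \<epsilon> \<inter> C = {}"
  unfolding cls_def clo_def by blast

lemma clo_least: "cls I C \<Longrightarrow> X \<subseteq> C \<Longrightarrow> clo I X \<subseteq> C"
  using clo_mono[of X C I] unfolding cls_def by blast

lemma cube_center_min: "x \<in> pts I \<Longrightarrow> 0 < \<epsilon> \<Longrightarrow> 0 < \<delta> \<Longrightarrow> cube I x (min \<epsilon> \<delta>) \<subseteq> cube I x \<epsilon> \<inter> cube I x \<delta>"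
  by (auto simp: cube_def)

lemma cls_Un: "cls I C \<Longrightarrow> cls I D \<Longrightarrow> cls I (C \<union> D)"
proof (rule clsI)
  fix x assume CD: "cls I C" "cls I D" and x: "x \<in> pts I" "x \<notin> C \<union> D"
  then obtain \<epsilon> \<delta> where "\<epsilon> > 0" "cube I x \<epsilon> \<inter> C = {}" "\<delta> > 0" "cube I x \<delta> \<inter> D = {}"
    using cls_avoid[of I C x] cls_avoid[of I D x] by auto
  with cube_center_min[of x I \<epsilon> \<delta>] x show "\<exists>\<epsilon>>0. cube I x \<epsilon> \<inter> (C \<union> D) = {}"
    by (intro exI[of _ "min \<epsilon> \<delta>"]) auto
qed (auto simp: cls_def)

lemma cls_Int: "cls I C \<Longrightarrow> cls I D \<Longrightarrow> cls I (C \<inter> D)"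
  using clo_mono[of "C \<inter> D" C I] clo_mono[of "C \<inter> D" D I] by (auto simp: cls_def)

lemma opn_compl: "cls I C \<Longrightarrow> opn I (pts I - C)"
  unfolding opn_def using cls_avoid[of I C] cube_subset_pts by fast

lemma cls_compl: "opn I U \<Longrightarrow> cls I (pts I - U)"
  unfolding opn_def by (rule clsI) (simp, fast)

lemma opn_cube: "finite I \<Longrightarrow> opn I (cube I x \<epsilon>)"
  unfolding opn_def by (meson cube_nested cube_subset_pts)

lemma opn_Int: "opn I U \<Longrightarrow> opn I V \<Longrightarrow> opn I (U \<inter> V)"
  using cls_compl[of I U] cls_compl[of I V] cls_Un[of I "pts I - U" "pts I - V"]
    opn_compl[of I "(pts I - U) \<union> (pts I - V)"]
  by (simp add: opn_def[of I U] Diff_Un double_diff opn_def[of I V])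

lemma opn_solid: "opn I U \<Longrightarrow> U \<noteq> {} \<Longrightarrow> solid I U"
  unfolding opn_def solid_def by blast

lemma solid_mono: "solid I X \<Longrightarrow> X \<subseteq> Y \<Longrightarrow> solid I Y"
  unfolding solid_def by blast

lemma solid_opn: assumes "finite I" "solid I X" shows "\<exists>V. opn I V \<and> V \<noteq> {} \<and> V \<subseteq> X"
proof -
  from assms(2) obtain x \<epsilon> where "x \<in> pts I" "\<epsilon> > 0" "cube I x \<epsilon> \<subseteq> X" unfolding solid_def by blast
  then show ?thesis using opn_cube[OF assms(1), of x \<epsilon>] cube_center[of x I \<epsilon>] by blast
qed

lemma opn_meets_clo: "opn I V \<Longrightarrow> x \<in> V \<Longrightarrow> x \<in> clo I X \<Longrightarrow> V \<inter> X \<noteq> {}"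
  unfolding opn_def clo_def by blast

text \<open>The recurring way to reach generic points: an open set is shrunk so as to avoid a closed
  set that does not contain it.\<close>

lemma shrink_off_closed:
  "opn I V \<Longrightarrow> V \<noteq> {} \<Longrightarrow> cls I C \<Longrightarrow> \<not> V \<subseteq> C \<Longrightarrow> \<exists>W. opn I W \<and> W \<noteq> {} \<and> W \<subseteq> V \<and> W \<inter> C = {}"
  by (rule exI[of _ "V \<inter> (pts I - C)"]) (use opn_Int[OF _ opn_compl, of I V C] in \<open>auto simp: opn_def[of I V]\<close>)

lemma opn_vimage_restrict:
  assumes "J \<subseteq> I" "opn J V" shows "opn I {x \<in> pts I. restrict x J \<in> V}"
  unfolding opn_def
proof (intro conjI ballI)
  fix x assume x: "x \<in> {x \<in> pts I. restrict x J \<in> V}"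
  with assms(2) obtain \<epsilon> where "\<epsilon> > 0" "cube J (restrict x J) \<epsilon> \<subseteq> V" unfolding opn_def by blast
  with cube_restrict(1)[OF assms(1), of _ x \<epsilon>] cube_subset_pts
  show "\<exists>\<epsilon>>0. cube I x \<epsilon> \<subseteq> {x \<in> pts I. restrict x J \<in> V}" by blast
qed auto

lemma cls_vimage_restrict:
  assumes "J \<subseteq> I" "cls J C" shows "cls I {x \<in> pts I. restrict x J \<in> C}"
proof -
  have "{x \<in> pts I. restrict x J \<in> C} = pts I - {x \<in> pts I. restrict x J \<in> pts J - C}" by auto
  then show ?thesis using cls_compl[OF opn_vimage_restrict[OF assms(1) opn_compl[OF assms(2)]]] by simp
qed

section \<open>Definability in expansions of ordered fields\<close>

locale dc_structure =
  fixes M :: "('f, 'r, 'a::{linordered_field, linorder_topology}) fo_structure"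
  assumes expands: "expands_ordered_field M" and complete: "definably_complete M"
begin

lemma dpred_add_base: "dpred M (\<lambda>e. e i = e j + e k)"
proof -
  obtain a where a: "a \<in> fun_syms M" "fun_arity M a = 2" "\<And>x y. fun_interp M a [x, y] = x + y"
    using expands unfolding expands_ordered_field_def by metis
  show ?thesis unfolding dpred_def
    by (rule exI[of _ "Eq (Var i) (App a [Var j, Var k])"], rule exI[of _ Inl]) (simp add: a)
qed

lemma dpred_mult_base: "dpred M (\<lambda>e. e i = e j * e k)"
proof -
  obtain a where a: "a \<in> fun_syms M" "fun_arity M a = 2" "\<And>x y. fun_interp M a [x, y] = x * y"
    using expands unfolding expands_ordered_field_def by metis
  show ?thesis unfolding dpred_def
    by (rule exI[of _ "Eq (Var i) (App a [Var j, Var k])"], rule exI[of _ Inl]) (simp add: a)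
qed

lemma dpred_less_base: "dpred M (\<lambda>e. e i < e j)"
proof -
  obtain l where l: "l \<in> rel_syms M" "rel_arity M l = 2" "\<And>x y. rel_interp M l [x, y] \<longleftrightarrow> x < y"
    using expands unfolding expands_ordered_field_def by metis
  show ?thesis unfolding dpred_def
    by (rule exI[of _ "Rel l [Var i, Var j]"], rule exI[of _ Inl]) (simp add: l)
qed

lemma dterm_add: "dterm M f \<Longrightarrow> dterm M g \<Longrightarrow> dterm M (\<lambda>e. f e + g e)"
  using dterm_app2[of M "(+)" f g, OF dpred_add_base] .

lemma dterm_mult: "dterm M f \<Longrightarrow> dterm M g \<Longrightarrow> dterm M (\<lambda>e. f e * g e)"
  using dterm_app2[of M "(*)" f g, OF dpred_mult_base] .

lemma dpred_less: "dterm M f \<Longrightarrow> dterm M g \<Longrightarrow> dpred M (\<lambda>e. f e < g e)"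
  using dpred_app2[of M "(<)" f g, OF dpred_less_base] .

lemma dpred_le: "dterm M f \<Longrightarrow> dterm M g \<Longrightarrow> dpred M (\<lambda>e. f e \<le> g e)"
  unfolding not_less[symmetric] by (intro dpred_not dpred_less)

lemma dterm_minus: "dterm M f \<Longrightarrow> dterm M g \<Longrightarrow> dterm M (\<lambda>e. f e - g e)"
proof -
  have "dpred M (\<lambda>e. e 1 = e 0 + e 2)" by (rule dpred_add_base)
  then have "dpred M (\<lambda>e. e 0 = e 1 - e 2)" by (rule back_subst[where P = "dpred M"]) (auto simp: eq_diff_eq)
  then show "dterm M f \<Longrightarrow> dterm M g \<Longrightarrow> dterm M (\<lambda>e. f e - g e)"
    using dterm_app2[of M "(-)" f g] by blast
qed

lemma dterm_abs: assumes f: "dterm M f" shows "dterm M (\<lambda>e. \<bar>f e\<bar>)"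
proof -
  have "dpred M (\<lambda>e. 0 \<le> e 0 \<and> (e 0 = e 1 \<or> e 0 = 0 - e 1))"
    by (intro dpred_conj dpred_disj dpred_le dpred_eq dterm_minus dterm_const dterm_var)
  moreover have "(\<lambda>e :: nat \<Rightarrow> 'a. 0 \<le> e 0 \<and> (e 0 = e 1 \<or> e 0 = 0 - e 1)) = (\<lambda>e. e 0 = \<bar>e 1\<bar>)"
    by (auto simp: fun_eq_iff abs_if)
  ultimately show ?thesis using dterm_app1[of M abs f, OF _ f] by simp
qed

lemma dterm_inverse: assumes f: "dterm M f" shows "dterm M (\<lambda>e. inverse (f e))"
proof -
  have "dpred M (\<lambda>e. (e 1 = 0 \<and> e 0 = 0) \<or> e 0 * e 1 = 1)"
    \<comment> \<open>The first disjunct of the graph is the default value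
      \<open>inverse 0 = 0\<close>.\<close>
    by (intro dpred_conj dpred_disj dpred_eq dterm_mult dterm_const dterm_var)
  moreover have "(\<lambda>e :: nat \<Rightarrow> 'a. (e 1 = 0 \<and> e 0 = 0) \<or> e 0 * e 1 = 1) = (\<lambda>e. e 0 = inverse (e 1))"
  proof (intro ext iffI)
    fix e :: "nat \<Rightarrow> 'a"
    assume "(e 1 = 0 \<and> e 0 = 0) \<or> e 0 * e 1 = 1"
    then show "e 0 = inverse (e 1)" by (metis inverse_unique inverse_zero mult.commute)
  next
    fix e :: "nat \<Rightarrow> 'a"
    assume "e 0 = inverse (e 1)"
    then show "(e 1 = 0 \<and> e 0 = 0) \<or> e 0 * e 1 = 1" by (cases "e 1 = 0") simp_all
  qed
  ultimately show ?thesis using dterm_app1[of M inverse f, OF _ f] by simp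
qed

lemma dpred_cube:
  assumes "finite I" "dpoint M I f" "dpoint M I g" "dterm M h" "\<And>e. g e \<in> pts I"
  shows "dpred M (\<lambda>e. g e \<in> cube I (f e) (h e))"
  unfolding cube_def using assms
  by (auto simp: dpoint_def intro!: dpred_ball_fin dpred_less dterm_abs dterm_minus)

lemma dpred_ex_fam:
  assumes Y: "dfam M I Y" and g: "dterm M g"
    and Q: "dpred M (\<lambda>e. Q (\<lambda>i. e (i + bnd I)) (restrict (\<lambda>i. e i) I))"
  shows "dpred M (\<lambda>e. \<exists>x\<in>Y (g e). Q e x)"
proof -
  have "dpred M (\<lambda>e. restrict (\<lambda>i. e i) I \<in> Y (g (\<lambda>i. e (i + bnd I))) \<and>
      Q (\<lambda>i. e (i + bnd I)) (restrict (\<lambda>i. e i) I))"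
    by (intro dpred_conj Q dpred_fam[OF Y] dterm_rename[OF g] dpoint_restrict dterm_var) simp
  from dpred_ex_pts[of I M "\<lambda>e x. x \<in> Y (g e) \<and> Q e x", OF _ this] Y
  have "dpred M (\<lambda>e. \<exists>x\<in>pts I. x \<in> Y (g e) \<and> Q e x)" by (simp add: dfam_def)
  moreover have "(\<exists>x\<in>pts I. x \<in> Y (g e) \<and> Q e x) \<longleftrightarrow> (\<exists>x\<in>Y (g e). Q e x)" for e
    using Y by (auto simp: dfam_def)
  ultimately show ?thesis by simp
qed

lemma dpred_all_fam:
  assumes Y: "dfam M I Y" and g: "dterm M g"
    and Q: "dpred M (\<lambda>e. Q (\<lambda>i. e (i + bnd I)) (restrict (\<lambda>i. e i) I))"
  shows "dpred M (\<lambda>e. \<forall>x\<in>Y (g e). Q e x)"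
  using dpred_not[OF dpred_ex_fam[of I Y g "\<lambda>e x. \<not> Q e x", OF Y g dpred_not[OF Q]]] by simp

lemma dpred_ex_mem:
  assumes "dset M I X" "dpred M (\<lambda>e. Q (\<lambda>i. e (i + bnd I)) (restrict (\<lambda>i. e i) I))"
  shows "dpred M (\<lambda>e. \<exists>x\<in>X. Q e x)"
  using dpred_ex_fam[OF dset_fam[OF assms(1)] dterm_const assms(2)] .

lemma dpred_all_mem:
  assumes "dset M I X" "dpred M (\<lambda>e. Q (\<lambda>i. e (i + bnd I)) (restrict (\<lambda>i. e i) I))"
  shows "dpred M (\<lambda>e. \<forall>x\<in>X. Q e x)"
  using dpred_all_fam[OF dset_fam[OF assms(1)] dterm_const assms(2)] .

text \<open>Syntax-directed rules; with the membership and cube rules for the sets at hand they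
  reduce a definability goal to its atoms.\<close>

lemmas dI = dpred_not dpred_conj dpred_disj dpred_imp dpred_ex dpred_all dpred_ex_pts dpred_all_pts
  dpred_eq dpred_less dpred_le dpred_const dterm_add dterm_mult dterm_minus dterm_abs dterm_inverse
  dterm_var dterm_const dterm_restrict dpoint_restrict dpoint_const dpoint_upd

lemma dsetI:
  assumes "finite I" "\<And>e. dpred M (\<lambda>e. P (restrict (\<lambda>i. e i) I))"
  shows "dset M I {x \<in> pts I. P x}"
  using assms by (simp add: dset_def)

lemma dfamI:
  assumes "finite I" "dpred M (\<lambda>e. P (e 0) (restrict (\<lambda>i. e (Suc i)) I))"
  shows "dfam M I (\<lambda>t. {x \<in> pts I. P t x})"
  using assms by (simp add: dfam_def)

lemma dset_clo: assumes X: "dset M I X" shows "dset M I (clo I X)"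
proof -
  have I: "finite I" using X by (simp add: dset_def)
  have "clo I X = {x \<in> pts I. \<forall>\<epsilon>. 0 < \<epsilon> \<longrightarrow> (\<exists>y\<in>X. y \<in> cube I x \<epsilon>)}" by (auto simp: clo_def)
  also have "dset M I \<dots>"
    by (rule dsetI[OF I]) (intro dI dpred_ex_mem[OF X] dpred_cube[OF I]; simp)
  finally show ?thesis .
qed

lemma dset_Un: "dset M I X \<Longrightarrow> dset M I Z \<Longrightarrow> dset M I (X \<union> Z)"
  unfolding dset_def using dpred_disj by auto

lemma dset_Int: "dset M I X \<Longrightarrow> dset M I Z \<Longrightarrow> dset M I (X \<inter> Z)"
  unfolding dset_def using dpred_conj by auto

lemma dset_Diff: "dset M I X \<Longrightarrow> dset M I Z \<Longrightarrow> dset M I (X - Z)"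
  unfolding dset_def using dpred_conj[OF _ dpred_not] by auto

lemma dset_pts: "finite I \<Longrightarrow> dset M I (pts I)"
  unfolding dset_def by (simp add: dpred_const)

lemma dset_cube: "finite I \<Longrightarrow> dset M I (cube I x \<epsilon>)"
  unfolding dset_def by (auto simp: cube_subset_pts simp del: restrict_apply intro!: dpred_cube dI)

section \<open>Definable compactness\<close>

lemma definable_lub:
  assumes S: "dpred M (\<lambda>e. e 0 \<in> S)" "S \<noteq> {}" "\<And>x. x \<in> S \<Longrightarrow> x \<le> b"
  shows "\<exists>s. (\<forall>x\<in>S. x \<le> s) \<and> (\<forall>c. (\<forall>x\<in>S. x \<le> c) \<longrightarrow> s \<le> c)"
proof -
  from complete dpred_definable[OF S(1), of 1] obtain s :: "'a extended" where
    s: "\<forall>x\<in>S. Fin x \<le> s" "\<forall>c. (\<forall>x\<in>S. Fin x \<le> c) \<longrightarrow> s \<le> c"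
    unfolding definably_complete_def by blast
  have "s \<le> Fin b" using s(2) S(3) by simp
  moreover obtain x where "x \<in> S" using S(2) by blast
  ultimately obtain r where "s = Fin r" using s(1) by (cases s) auto
  with s show ?thesis by (intro exI[of _ r]) (metis less_eq_extended.simps(1))
qed

text \<open>Throughout, \<open>t * \<bar>a\<bar> < 1\<close> stands for
  \<open>\<bar>a\<bar> < 1/t\<close>. It is void for \<open>t \<le> 0\<close> and gets stronger as
  \<open>t\<close> grows, so it defines decreasing families indexed by the whole field. The radius
  \<open>inverse (max t 1)\<close> realizes it for every \<open>t\<close>.\<close>

lemma scaled_less_one: "s \<le> t \<Longrightarrow> t * \<bar>a\<bar> < 1 \<Longrightarrow> s * \<bar>a\<bar> < 1" for a :: 'a
  using mult_right_mono[of s t "\<bar>a\<bar>"] by simp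

lemma inverse_max_pos: "0 < inverse (max t 1)" for t :: 'a
  by (simp add: less_max_iff_disj)

lemma scaled_small:
  fixes a :: 'a
  assumes "\<bar>a\<bar> < inverse (max t 1)" shows "t * \<bar>a\<bar> < 1"
proof (rule scaled_less_one[of t "max t 1"])
  have "0 < max t 1" by (simp add: less_max_iff_disj)
  then show "max t 1 * \<bar>a\<bar> < 1" using assms by (simp add: field_simps)
qed simp

lemma less_of_scaled: "0 < \<epsilon> \<Longrightarrow> inverse \<epsilon> * \<bar>a\<bar> < 1 \<Longrightarrow> \<bar>a\<bar> < \<epsilon>" for a :: 'a
  by (simp add: field_simps)

text \<open>Coordinates are settled one at a time. With \<open>a\<close> the lower limit of
  coordinate \<open>j\<close> along \<open>C\<close>, the points of \<open>C t\<close> whose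
  coordinate \<open>j\<close> is within \<open>1/t\<close> of \<open>a\<close> again form a
  decreasing family \<open>D\<close> of nonempty sets, to which the induction hypothesis
  applies.\<close>

lemma cluster_point:
  assumes C: "dfam M I C" "antimono C" "\<And>t. C t \<noteq> {}" "bdd I (C 0)" and J: "finite J" "J \<subseteq> I"
  shows "\<exists>x. \<forall>t. \<forall>\<epsilon>>0. \<exists>y\<in>C t. \<forall>j\<in>J. \<bar>y j - x j\<bar> < \<epsilon>"
  using J C
proof (induction J arbitrary: C)
  case empty
  then show ?case by auto
next
  case (insert j J)
  note C = \<open>dfam M I C\<close> \<open>antimono C\<close> \<open>\<And>t. C t \<noteq> {}\<close> \<open>bdd I (C 0)\<close>
  have I: "finite I" using C(1) by (simp add: dfam_def)
  have j: "j \<in> I" using insert.prems by auto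
  obtain r where r: "\<And>x. x \<in> C 0 \<Longrightarrow> \<bar>x j\<bar> \<le> r" using C(4) j unfolding bdd_def by blast
  have C_sub: "C t \<subseteq> C s" if "s \<le> t" for s t using C(2) that by (simp add: antimono_def)
  \<comment> \<open>The eventual strict lower bounds of coordinate \<open>j\<close>; their supremum
    is the lower limit.\<close>
  define S where "S = {s. \<exists>t. \<forall>x\<in>C t. s < x j}"
  have S_def': "dpred M (\<lambda>e. e 0 \<in> S)" unfolding S_def mem_Collect_eq
    by (intro dI dpred_all_fam[OF C(1)])
  have "- r - 1 \<in> S" unfolding S_def
    using r by (force intro!: exI[of _ 0] simp: abs_le_iff)
  moreover have "s \<le> r" if "s \<in> S" for s
  proof -
    from that obtain t where t: "\<forall>x\<in>C t. s < x j" unfolding S_def by blast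
    obtain x where x: "x \<in> C (max t 0)" using C(3) by blast
    then have "x \<in> C t" "x \<in> C 0" using C_sub[of t "max t 0"] C_sub[of 0 "max t 0"] by auto
    with t r[of x] show ?thesis by (force simp: abs_le_iff)
  qed
  ultimately obtain a where a: "\<And>x. x \<in> S \<Longrightarrow> x \<le> a" "\<And>c. (\<forall>x\<in>S. x \<le> c) \<Longrightarrow> a \<le> c"
    using definable_lub[OF S_def', of r] by blast
  have near: "\<exists>x\<in>C t. \<bar>x j - a\<bar> < \<epsilon>" if "\<epsilon> > 0" for t \<epsilon>
  proof -
    have "\<not> (\<forall>x\<in>S. x \<le> a - \<epsilon> / 2)"
    proof
      assume "\<forall>x\<in>S. x \<le> a - \<epsilon> / 2"
      then have "a \<le> a - \<epsilon> / 2" by (rule a(2))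
      with that show False by simp
    qed
    then obtain s t0 where s: "a - \<epsilon> / 2 < s" "\<forall>x\<in>C t0. s < x j" unfolding S_def by (auto simp: not_le)
    have "a + \<epsilon> / 2 \<notin> S" using a(1)[of "a + \<epsilon> / 2"] that by auto
    then obtain x where x: "x \<in> C (max t t0)" "x j \<le> a + \<epsilon> / 2" unfolding S_def by (auto simp: not_less)
    then have "x \<in> C t" "x \<in> C t0" using C_sub[of t "max t t0"] C_sub[of t0 "max t t0"] by auto
    with s x that have "a - \<epsilon> / 2 < x j" "x j \<le> a + \<epsilon> / 2" "\<epsilon> / 2 < \<epsilon>" by auto
    with \<open>x \<in> C t\<close> show ?thesis by (intro bexI[of _ x]) (auto simp: abs_less_iff)
  qed
  define D where "D t = {x \<in> pts I. x \<in> C t \<and> t * \<bar>x j - a\<bar> < 1}" for t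
  have "dfam M I D" unfolding D_def
    by (rule dfamI[OF I]) (intro dI dpred_fam[OF C(1)]; simp)
  moreover have "antimono D"
  proof (rule antimonoI, rule subsetI)
    fix s t x assume st: "s \<le> t" and x: "x \<in> D t"
    with C_sub[OF st] scaled_less_one[OF st] show "x \<in> D s" by (auto simp: D_def)
  qed
  moreover have "D t \<noteq> {}" for t
  proof -
    obtain x where "x \<in> C t" "\<bar>x j - a\<bar> < inverse (max t 1)"
      using near[OF inverse_max_pos, of t t] by blast
    with C(1) scaled_small show ?thesis by (force simp: D_def dfam_def)
  qed
  moreover have "bdd I (D 0)" using C(4) by (auto simp: bdd_def D_def)
  ultimately obtain x where x: "\<And>t \<epsilon>. \<epsilon> > 0 \<Longrightarrow> \<exists>y\<in>D t. \<forall>i\<in>J. \<bar>y i - x i\<bar> < \<epsilon>"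
    using insert.IH[of D] insert.prems(1) by blast
  show ?case
  proof (intro exI[of _ "x(j := a)"] allI impI)
    fix t \<epsilon> :: 'a assume \<epsilon>: "\<epsilon> > 0"
    define s where "s = max t (inverse \<epsilon>)"
    obtain y where y: "y \<in> D s" "\<forall>i\<in>J. \<bar>y i - x i\<bar> < \<epsilon>" using x[OF \<epsilon>] by blast
    have "\<bar>y j - a\<bar> < \<epsilon>"
      using y(1) scaled_less_one[of "inverse \<epsilon>" s] by (intro less_of_scaled[OF \<epsilon>]) (auto simp: D_def s_def)
    moreover have "y \<in> C t" using y(1) C_sub[of t s] by (auto simp: D_def s_def)
    ultimately show "\<exists>y\<in>C t. \<forall>i\<in>insert j J. \<bar>y i - (x(j := a)) i\<bar> < \<epsilon>"
      using y(2) insert.hyps by (intro bexI[of _ y]) auto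
  qed
qed

lemma cluster_cube:
  assumes C: "dfam M I C" "antimono C" "\<And>t. C t \<noteq> {}" "bdd I (C 0)"
  shows "\<exists>x\<in>pts I. \<forall>t. \<forall>\<epsilon>>0. C t \<inter> cube I x \<epsilon> \<noteq> {}"
proof -
  from C(1) have I: "finite I" "\<And>t. C t \<subseteq> pts I" by (auto simp: dfam_def)
  from cluster_point[OF C I(1)] obtain x where x: "\<And>t \<epsilon>. \<epsilon> > 0 \<Longrightarrow> \<exists>y\<in>C t. \<forall>j\<in>I. \<bar>y j - x j\<bar> < \<epsilon>" by blast
  show ?thesis
  proof (intro bexI[of _ "restrict x I"] allI impI)
    fix t \<epsilon> :: 'a assume "\<epsilon> > 0"
    with x[of \<epsilon> t] I(2)[of t] show "C t \<inter> cube I (restrict x I) \<epsilon> \<noteq> {}" by (auto simp: cube_def)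
  qed simp
qed

text \<open>For \<open>y\<close> in the closure of the projection, the points of \<open>Z\<close>
  lying within \<open>1/t\<close> of the fibre over \<open>y\<close> form a decreasing family. Its
  cluster point belongs to \<open>Z\<close> and projects to \<open>y\<close>.\<close>

lemma cls_projection:
  assumes Z: "dset M I Z" "cls I Z" "bdd I Z" and J: "J \<subseteq> I"
  shows "cls J ((\<lambda>x. restrict x J) ` Z)"
  unfolding cls_def
proof (intro conjI subsetI)
  have I: "finite I" "Z \<subseteq> pts I" using Z(1) by (auto simp: dset_def)
  have Jf: "finite J" using I(1) J by (rule rev_finite_subset)
  fix y assume y: "y \<in> clo J ((\<lambda>x. restrict x J) ` Z)"
  define C where "C t = {z \<in> pts I. z \<in> Z \<and> (\<forall>j\<in>J. t * \<bar>z j - y j\<bar> < 1)}" for t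
  have C1: "dfam M I C" unfolding C_def
    by (rule dfamI[OF I(1)]) (intro dI dpred_mem[OF Z(1)] dpred_ball_fin[OF Jf]; simp)
  have C2: "antimono C"
  proof (rule antimonoI, rule subsetI)
    fix s t z assume st: "s \<le> t" and z: "z \<in> C t"
    with scaled_less_one[OF st] show "z \<in> C s" unfolding C_def by blast
  qed
  have C3: "C t \<noteq> {}" for t
  proof -
    from y inverse_max_pos[of t] obtain z where
      z: "z \<in> Z" "restrict z J \<in> cube J y (inverse (max t 1))" unfolding clo_def by blast
    have "t * \<bar>z j - y j\<bar> < 1" if "j \<in> J" for j
      using z(2) that by (intro scaled_small) (auto simp: cube_def)
    with z(1) I(2) show ?thesis by (auto simp: C_def)
  qed
  have C4: "bdd I (C 0)" using Z(3) by (auto simp: bdd_def C_def)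
  obtain x where x: "x \<in> pts I" "\<And>t \<epsilon>. \<epsilon> > 0 \<Longrightarrow> C t \<inter> cube I x \<epsilon> \<noteq> {}"
    using cluster_cube[OF C1 C2 C3 C4] by blast
  have "x \<in> Z"
  proof (rule clsD[OF Z(2) x(1)])
    fix \<epsilon> :: 'a assume "\<epsilon> > 0"
    with x(2)[of \<epsilon> 0] show "\<exists>z\<in>Z. z \<in> cube I x \<epsilon>" by (auto simp: C_def)
  qed
  moreover have "restrict x J = y"
  proof (rule pts_eqI)
    fix j assume j: "j \<in> J"
    show "restrict x J j = y j"
    proof (rule ccontr)
      assume "restrict x J j \<noteq> y j"
      moreover define \<epsilon> where "\<epsilon> = \<bar>x j - y j\<bar> / 2"
      ultimately have \<epsilon>: "\<epsilon> > 0" using j by simp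
      obtain z where z: "z \<in> C (inverse \<epsilon>)" "z \<in> cube I x \<epsilon>" using x(2)[OF \<epsilon>] by blast
      have "\<bar>z j - y j\<bar> < \<epsilon>" using z(1) j by (intro less_of_scaled[OF \<epsilon>]) (auto simp: C_def)
      moreover have "\<bar>z j - x j\<bar> < \<epsilon>" using z(2) j J by (auto simp: cube_def)
      moreover have "\<bar>x j - y j\<bar> \<le> \<bar>z j - y j\<bar> + \<bar>z j - x j\<bar>" by (simp add: abs_if)
      ultimately show False by (simp add: \<epsilon>_def)
    qed
  qed (use y in \<open>auto simp: clo_def\<close>)
  ultimately show "y \<in> (\<lambda>x. restrict x J) ` Z" by blast
qed auto

end

text \<open>Subsets of the field as sets of points with the single coordinate 0; as
  \<open>{0}\<close> is \<open>{..<1}\<close>, these are subsets of \<open>Kn 1\<close>.\<close>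

definition line :: "'a set \<Rightarrow> (nat \<Rightarrow> 'a) set" where
  "line A = {x \<in> pts {0}. x 0 \<in> A}"

lemma ball_pts_line: "(\<forall>x\<in>pts {0}. P (x 0)) \<longleftrightarrow> (\<forall>a. P a)"
proof
  assume L: "\<forall>x\<in>pts {0}. P (x 0)"
  show "\<forall>a. P a"
  proof
    fix a
    show "P a" using L[rule_format, of "restrict (\<lambda>_. a) {0}"] by simp
  qed
qed simp

lemma line_Un: "line (A \<union> B) = line A \<union> line B"
  by (auto simp: line_def)

lemma line_image: "X \<subseteq> pts {0} \<Longrightarrow> X = line ((\<lambda>x. x 0) ` X)"
proof (intro equalityI subsetI)
  fix y assume X: "X \<subseteq> pts {0}" and "y \<in> line ((\<lambda>x. x 0) ` X)"
  then obtain x where x: "x \<in> X" "y 0 = x 0" "y \<in> pts {0}" by (auto simp: line_def)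
  then have "y = x" using X by (intro pts_eqI[of y "{0}" x]) auto
  with x(1) show "y \<in> X" by simp
qed (auto simp: line_def)

context dc_structure
begin

lemma dset_line: "dset M {0} (line A) \<longleftrightarrow> dpred M (\<lambda>e. e 0 \<in> A)"
  by (auto simp: dset_def line_def)

section \<open>Pseudo-finite sets\<close>

text \<open>No accumulation point in the whole space: closed and discrete.\<close>

definition isolated :: "nat set \<Rightarrow> (nat \<Rightarrow> 'a) set \<Rightarrow> bool" where
  "isolated I X \<longleftrightarrow> (\<forall>x\<in>pts I. \<exists>\<epsilon>>0. cube I x \<epsilon> \<inter> X \<subseteq> {x})"

definition pfin :: "nat set \<Rightarrow> (nat \<Rightarrow> 'a) set \<Rightarrow> bool" where
  "pfin I X \<longleftrightarrow> dset M I X \<and> bdd I X \<and> isolated I X"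

lemma isolated_line: "isolated {0} (line A) \<longleftrightarrow> (\<forall>a. \<exists>\<epsilon>>0. \<forall>b\<in>A. \<bar>b - a\<bar> < \<epsilon> \<longrightarrow> b = a)"
proof -
  have "cube {0} x \<epsilon> \<inter> line A \<subseteq> {x} \<longleftrightarrow> (\<forall>b\<in>A. \<bar>b - x 0\<bar> < \<epsilon> \<longrightarrow> b = x 0)"
    if x: "x \<in> pts {0}" for x :: "nat \<Rightarrow> 'a" and \<epsilon>
  proof
    assume L: "cube {0} x \<epsilon> \<inter> line A \<subseteq> {x}"
    show "\<forall>b\<in>A. \<bar>b - x 0\<bar> < \<epsilon> \<longrightarrow> b = x 0"
    proof (intro ballI impI)
      fix b assume "b \<in> A" "\<bar>b - x 0\<bar> < \<epsilon>"
      then have "restrict (\<lambda>_. b) {0} \<in> cube {0} x \<epsilon> \<inter> line A" by (simp add: cube_def line_def)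
      with L have "restrict (\<lambda>_. b) {0} = x" by blast
      then show "b = x 0" by auto
    qed
  next
    assume R: "\<forall>b\<in>A. \<bar>b - x 0\<bar> < \<epsilon> \<longrightarrow> b = x 0"
    have "y = x" if "y \<in> cube {0} x \<epsilon>" "y \<in> line A" for y
      by (rule pts_eqI[OF _ x]) (use that R in \<open>auto simp: cube_def line_def\<close>)
    then show "cube {0} x \<epsilon> \<inter> line A \<subseteq> {x}" by blast
  qed
  then have "isolated {0} (line A) \<longleftrightarrow> (\<forall>x\<in>pts {0}. \<exists>\<epsilon>>0. \<forall>b\<in>A. \<bar>b - x 0\<bar> < \<epsilon> \<longrightarrow> b = x 0)"
    unfolding isolated_def by simp
  also have "\<dots> \<longleftrightarrow> (\<forall>a. \<exists>\<epsilon>>0. \<forall>b\<in>A. \<bar>b - a\<bar> < \<epsilon> \<longrightarrow> b = a)"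
    by (rule ball_pts_line)
  finally show ?thesis .
qed

lemma bdd_line: "bdd {0} (line A) \<longleftrightarrow> (\<exists>r. \<forall>a\<in>A. \<bar>a\<bar> \<le> r)"
  using ball_pts_line[of "\<lambda>a. a \<in> A \<longrightarrow> \<bar>a\<bar> \<le> _"] unfolding bdd_def line_def by auto

lemma isolated_subset: "isolated I X \<Longrightarrow> Z \<subseteq> X \<Longrightarrow> isolated I Z"
  unfolding isolated_def by (meson Int_mono order_refl order_trans)

lemma pfin_subset: "pfin I X \<Longrightarrow> dset M I Z \<Longrightarrow> Z \<subseteq> X \<Longrightarrow> pfin I Z"
  unfolding pfin_def bdd_def by (blast intro: isolated_subset)

lemma isolated_cls:
  assumes "isolated I X" "X \<subseteq> pts I" shows "cls I X"
proof (rule clsI[OF assms(2)])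
  fix x assume "x \<in> pts I" "x \<notin> X"
  then show "\<exists>\<epsilon>>0. cube I x \<epsilon> \<inter> X = {}" using assms(1) unfolding isolated_def by fast
qed

lemma isolated_Un: assumes "isolated I X" "isolated I Z" shows "isolated I (X \<union> Z)"
  unfolding isolated_def
proof
  fix x :: "nat \<Rightarrow> 'a" assume x: "x \<in> pts I"
  with assms obtain \<epsilon> \<delta> where e: "\<epsilon> > 0" "cube I x \<epsilon> \<inter> X \<subseteq> {x}" "\<delta> > 0" "cube I x \<delta> \<inter> Z \<subseteq> {x}"
    unfolding isolated_def by metis
  then show "\<exists>\<epsilon>>0. cube I x \<epsilon> \<inter> (X \<union> Z) \<subseteq> {x}"
    using cube_center_min[OF x e(1,3)] by (intro exI[of _ "min \<epsilon> \<delta>"]) auto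
qed

lemma pfin_Un: assumes "pfin I X" "pfin I Z" shows "pfin I (X \<union> Z)"
proof -
  from assms obtain r s where r: "\<forall>x\<in>X. \<forall>i\<in>I. \<bar>x i\<bar> \<le> r" "\<forall>x\<in>Z. \<forall>i\<in>I. \<bar>x i\<bar> \<le> s"
    unfolding pfin_def bdd_def by blast
  have "\<bar>x i\<bar> \<le> max r s" if "x \<in> X \<union> Z" "i \<in> I" for x i
  proof (cases "x \<in> X")
    case True
    with r(1) that(2) show ?thesis by (auto simp: le_max_iff_disj)
  next
    case False
    with r(2) that show ?thesis by (auto simp: le_max_iff_disj)
  qed
  then have "bdd I (X \<union> Z)" unfolding bdd_def by blast
  with assms show ?thesis by (auto simp: pfin_def intro: isolated_Un dset_Un)
qed

text \<open>A cluster point of \<open>C\<close> belongs to every \<open>C t\<close>, because a small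
  cube around it meets \<open>X\<close> at most in that point.\<close>

lemma pfin_Inter:
  assumes X: "pfin I X" and C: "dfam M I C" "antimono C" "\<And>t. C t \<noteq> {}" "\<And>t. C t \<subseteq> X"
  shows "\<exists>z. \<forall>t. z \<in> C t"
proof -
  have "bdd I (C 0)" using X C(4)[of 0] unfolding pfin_def bdd_def by blast
  from cluster_cube[OF C(1-3) this] obtain x where
    x: "x \<in> pts I" "\<And>t \<epsilon>. \<epsilon> > 0 \<Longrightarrow> C t \<inter> cube I x \<epsilon> \<noteq> {}" by blast
  from X x(1) obtain \<epsilon> where "\<epsilon> > 0" "cube I x \<epsilon> \<inter> X \<subseteq> {x}" unfolding pfin_def isolated_def by blast
  with x(2)[of \<epsilon>] C(4) have "x \<in> C t" for t by blast
  then show ?thesis by blast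
qed

text \<open>Otherwise the sets \<open>X - Y t\<close> would decrease and have a common
  point.\<close>

lemma pfin_cover:
  assumes X: "pfin I X" and Y: "dfam M I Y" "mono Y" "X \<subseteq> (\<Union>t. Y t)"
  shows "\<exists>t. X \<subseteq> Y t"
proof (rule ccontr)
  assume neg: "\<nexists>t. X \<subseteq> Y t"
  have X': "dset M I X" using X by (simp add: pfin_def)
  define C where "C t = {x \<in> pts I. x \<in> X \<and> x \<notin> Y t}" for t
  have "dfam M I C" unfolding C_def using X'
    by (intro dfamI dI dpred_mem[OF X'] dpred_fam[OF Y(1)]) (auto simp: dset_def)
  moreover have "antimono C"
    using Y(2) unfolding C_def by (auto simp: monotone_def)
  moreover have "C t \<noteq> {}" "C t \<subseteq> X" for t using neg X' by (auto simp: C_def dset_def)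
  ultimately obtain z where "\<And>t. z \<in> C t" using pfin_Inter[OF X, of C] by blast
  with Y(3) show False by (auto simp: C_def)
qed

text \<open>In effect, images of pseudo-finite sets under definable functions are pseudo-finite: a
  point determines the index \<open>s\<close> of its set. If the indices were unbounded or
  accumulated at \<open>w\<close>, the points with large index, or with index near \<open>w\<close>,
  would form decreasing families with a common point, which has only one index.\<close>

lemma pfin_index_set:
  assumes X: "pfin I X" and Y: "dfam M I Y" "\<And>s. Y s \<subseteq> X"
    and disj: "\<And>x s s'. x \<in> Y s \<Longrightarrow> x \<in> Y s' \<Longrightarrow> s = s'"
  shows "pfin {0} (line {s. Y s \<noteq> {}})"
proof -
  have I: "finite I" "\<And>s. Y s \<subseteq> pts I" using Y(1) by (auto simp: dfam_def)
  have common: "\<exists>z. \<forall>t. z \<in> C t"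
    if "dfam M I C" "antimono C" "\<And>t. C t \<noteq> {}" "\<And>t x. x \<in> C t \<Longrightarrow> \<exists>s. x \<in> Y s" for C
    using that Y(2) by (intro pfin_Inter[OF X]) blast+
  have "dpred M (\<lambda>e. \<exists>x\<in>pts I. x \<in> Y (e 0))"
    by (intro dpred_ex_pts I dpred_fam[OF Y(1)] dI; simp)
  moreover have "(\<exists>x\<in>pts I. x \<in> Y s) \<longleftrightarrow> Y s \<noteq> {}" for s using I(2)[of s] by blast
  ultimately have "dset M {0} (line {s. Y s \<noteq> {}})" by (simp only: dset_line mem_Collect_eq)
  moreover have "bdd {0} (line {s. Y s \<noteq> {}})"
  proof (rule ccontr)
    assume nb: "\<not> bdd {0} (line {s. Y s \<noteq> {}})"
    define C where "C t = {x \<in> pts I. \<exists>s. t < \<bar>s\<bar> \<and> x \<in> Y s}" for t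
    have "dfam M I C" unfolding C_def by (rule dfamI[OF I(1)]) (intro dpred_fam[OF Y(1)] dI; simp)
    moreover have "antimono C" unfolding C_def by (rule antimonoI) (auto intro: le_less_trans)
    moreover have "C t \<noteq> {}" for t using nb I(2) unfolding bdd_line C_def by (force simp: not_le)
    moreover have "x \<in> C t \<Longrightarrow> \<exists>s. x \<in> Y s" for t x by (auto simp: C_def)
    ultimately obtain z where z: "\<And>t. z \<in> C t" using common[of C] by blast
    from z[of 0] obtain s where "z \<in> Y s" by (auto simp: C_def)
    moreover from z[of "\<bar>s\<bar>"] obtain s' where "\<bar>s\<bar> < \<bar>s'\<bar>" "z \<in> Y s'" by (auto simp: C_def)
    ultimately show False using disj by blast
  qed
  moreover have "isolated {0} (line {s. Y s \<noteq> {}})" unfolding isolated_line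
  proof (rule allI, rule ccontr)
    fix w assume neg: "\<not> (\<exists>\<epsilon>>0. \<forall>s\<in>{s. Y s \<noteq> {}}. \<bar>s - w\<bar> < \<epsilon> \<longrightarrow> s = w)"
    define C where "C t = {x \<in> pts I. \<exists>s. s \<noteq> w \<and> t * \<bar>s - w\<bar> < 1 \<and> x \<in> Y s}" for t
    have "dfam M I C" unfolding C_def by (rule dfamI[OF I(1)]) (intro dpred_fam[OF Y(1)] dI; simp)
    moreover have "antimono C" unfolding C_def by (rule antimonoI) (use scaled_less_one in blast)
    moreover have "C t \<noteq> {}" for t
    proof -
      obtain s where "Y s \<noteq> {}" "\<bar>s - w\<bar> < inverse (max t 1)" "s \<noteq> w"
        using neg inverse_max_pos[of t] by blast
      with scaled_small I(2) show ?thesis unfolding C_def by blast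
    qed
    moreover have "x \<in> C t \<Longrightarrow> \<exists>s. x \<in> Y s" for t x by (auto simp: C_def)
    ultimately obtain z where z: "\<And>t. z \<in> C t" using common[of C] by blast
    from z[of 0] obtain s where s: "z \<in> Y s" "s \<noteq> w" by (auto simp: C_def)
    \<comment> \<open>At this parameter an index of \<open>z\<close> must be strictly closer to
      \<open>w\<close> than \<open>s\<close>, the only index of \<open>z\<close>.\<close>
    from z[of "inverse \<bar>s - w\<bar>"] obtain s' where "inverse \<bar>s - w\<bar> * \<bar>s' - w\<bar> < 1" "z \<in> Y s'" by (auto simp: C_def)
    with s disj[of z s s'] show False by simp
  qed
  ultimately show ?thesis by (simp add: pfin_def)
qed

text \<open>\<open>X\<close> lies in the product of its coordinate images, where bounds and
  separating radii can be combined over finitely many coordinates.\<close>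

lemma pfin_coordinates:
  assumes X: "dset M I X" and pr: "\<And>i. i \<in> I \<Longrightarrow> pfin {0} (line ((\<lambda>x. x i) ` X))"
  shows "pfin I X"
proof -
  have I: "finite I" using X by (simp add: dset_def)
  have iso: "\<exists>\<epsilon>>0. \<forall>b\<in>(\<lambda>x. x i) ` X. \<bar>b - a\<bar> < \<epsilon> \<longrightarrow> b = a" if "i \<in> I" for i a
    using pr[OF that] by (simp add: pfin_def isolated_line)
  have "isolated I X" unfolding isolated_def
  proof
    fix x :: "nat \<Rightarrow> 'a" assume x: "x \<in> pts I"
    have "\<exists>\<epsilon>>0. \<forall>i\<in>I. \<forall>b\<in>(\<lambda>x. x i) ` X. \<bar>b - x i\<bar> < \<epsilon> \<longrightarrow> b = x i"
    proof (rule finite_radius[OF I])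
      fix i assume "i \<in> I"
      from iso[OF this, of "x i"] show "\<exists>\<epsilon>>0. \<forall>b\<in>(\<lambda>x. x i) ` X. \<bar>b - x i\<bar> < \<epsilon> \<longrightarrow> b = x i" .
    qed auto
    then obtain \<epsilon> where e: "\<epsilon> > 0" "\<And>i y. i \<in> I \<Longrightarrow> y \<in> X \<Longrightarrow> \<bar>y i - x i\<bar> < \<epsilon> \<Longrightarrow> y i = x i" by blast
    have "y = x" if "y \<in> cube I x \<epsilon>" "y \<in> X" for y
      by (rule pts_eqI[OF _ x]) (use that e in \<open>auto simp: cube_def\<close>)
    with e(1) show "\<exists>\<epsilon>>0. cube I x \<epsilon> \<inter> X \<subseteq> {x}" by blast
  qed
  moreover have "bdd I X"
  proof -
    have "\<exists>r. \<forall>x\<in>X. \<forall>i\<in>J. \<bar>x i\<bar> \<le> r" if "J \<subseteq> I" for J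
      using rev_finite_subset[OF I that] that
    proof (induction J)
      case (insert j J)
      then obtain r where r: "\<forall>x\<in>X. \<forall>i\<in>J. \<bar>x i\<bar> \<le> r" by blast
      obtain s where s: "\<forall>x\<in>X. \<bar>x j\<bar> \<le> s"
        using pr[of j] insert.prems by (auto simp: pfin_def bdd_line)
      have "\<forall>x\<in>X. \<forall>i\<in>insert j J. \<bar>x i\<bar> \<le> max r s"
        using r s by (auto simp: le_max_iff_disj)
      then show ?case by blast
    qed simp
    then show ?thesis unfolding bdd_def by blast
  qed
  ultimately show ?thesis using X by (simp add: pfin_def)
qed

end

text \<open>The first condition of the theorem, in the form in which the other ones follow from it.\<close>

locale tame_structure = dc_structure M
  for M :: "('f, 'r, 'a::{linordered_field, linorder_topology}) fo_structure" +
  assumes isolated_bounded: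
    "\<And>A. dpred M (\<lambda>e. e 0 \<in> A) \<Longrightarrow> isolated {0} (line A) \<Longrightarrow> \<exists>r. \<forall>a\<in>A. \<bar>a\<bar> \<le> r"
begin

text \<open>With \<open>h x\<close> the infimum of the \<open>t \<ge> 0\<close> such that \<open>x \<in> Y t\<close>, the range \<open>H\<close> of \<open>h\<close> is closed
  and discrete, since its part below \<open>a\<close> indexes a disjoint family of subsets of the pseudo-finite set \<open>Y (a + 1)\<close>.\<close>

lemma union_pfin_stationary:
  assumes Y: "dfam M I Y" "mono Y" "\<And>t. pfin I (Y t)"
  shows "\<exists>t. (\<Union>t. Y t) = Y t"
proof -
  define P where "P x s \<longleftrightarrow> 0 \<le> s \<and> (\<forall>t. s < t \<longrightarrow> x \<in> Y t) \<and> (\<forall>t. 0 \<le> t \<and> t < s \<longrightarrow> x \<notin> Y t)" for x s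
  define H where "H = {s. \<exists>x\<in>pts I. P x s}"
  have I: "finite I" "\<And>t. Y t \<subseteq> pts I" using Y(1) by (auto simp: dfam_def)
  have Y_sub: "Y s \<subseteq> Y t" if "s \<le> t" for s t using Y(2) that by (simp add: mono_def)
  have uniq: "s = s'" if "P x s" "P x s'" for x s s'
  proof -
    have False if "P x s" "P x s'" "s < s'" for s s'
    proof -
      from dense[OF that(3)] obtain t where "s < t" "t < s'" by blast
      with that show False by (auto simp: P_def)
    qed
    with that show ?thesis by (metis linorder_neqE)
  qed
  have H_def': "dpred M (\<lambda>e. e 0 \<in> H)" unfolding H_def P_def mem_Collect_eq
    by (intro dI dpred_fam[OF Y(1)] I) simp_all
  moreover have "isolated {0} (line H)" unfolding isolated_line
  proof
    fix a
    \<comment> \<open>The window up to \<open>a + 1\<close> contains a neighbourhood of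
      \<open>a\<close>. Since \<open>P x s\<close> guarantees membership only strictly after
      \<open>s\<close>, one more unit is added to land in \<open>Y (a + 2)\<close>.\<close>
    have "pfin {0} (line {s. {x \<in> pts I. x \<in> Y (a + 2) \<and> P x s \<and> s \<le> a + 1} \<noteq> {}})"
      by (rule pfin_index_set[OF Y(3)[of "a + 2"] dfamI[OF I(1)]])
        (auto simp: uniq P_def intro!: dI dpred_fam[OF Y(1)])
    also have "{s. {x \<in> pts I. x \<in> Y (a + 2) \<and> P x s \<and> s \<le> a + 1} \<noteq> {}} = H \<inter> {..a + 1}"
    proof -
      have "x \<in> Y (a + 2)" if "P x s" "s \<le> a + 1" for x s
      proof -
        have "s < a + 2" using that(2) by (rule le_less_trans) simp
        with that(1) show ?thesis by (simp add: P_def)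
      qed
      then show ?thesis by (auto simp: H_def)
    qed
    finally obtain \<epsilon> where e: "\<epsilon> > 0" "\<And>b. b \<in> H \<Longrightarrow> b \<le> a + 1 \<Longrightarrow> \<bar>b - a\<bar> < \<epsilon> \<Longrightarrow> b = a"
      unfolding pfin_def isolated_line by blast
    show "\<exists>\<epsilon>>0. \<forall>b\<in>H. \<bar>b - a\<bar> < \<epsilon> \<longrightarrow> b = a"
      using e by (intro exI[of _ "min \<epsilon> 1"]) (auto simp: abs_less_iff)
  qed
  ultimately obtain r where r: "\<forall>s\<in>H. \<bar>s\<bar> \<le> r" using isolated_bounded by blast
  have "x \<in> Y (\<bar>r\<bar> + 1)" if x: "x \<in> Y t" for x t
  proof (cases "\<forall>t\<ge>0. x \<in> Y t")
    case False
    \<comment> \<open>The nonnegative times before \<open>x\<close> enters the family; their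
      supremum satisfies \<open>P x\<close>, hence lies in \<open>H\<close>.\<close>
    define S where "S = {t. 0 \<le> t \<and> x \<notin> Y t}"
    have bnd: "s \<le> \<bar>t\<bar>" if "s \<in> S" for s
    proof (rule ccontr)
      assume "\<not> s \<le> \<bar>t\<bar>"
      then have "t \<le> s" by (simp add: abs_if split: if_splits)
      with x Y_sub[OF this] that show False by (auto simp: S_def)
    qed
    have "dpred M (\<lambda>e. e 0 \<in> S)" unfolding S_def mem_Collect_eq
      using x I by (intro dI dpred_fam[OF Y(1)]) auto
    moreover have "S \<noteq> {}" using False by (auto simp: S_def)
    ultimately obtain s where s: "\<forall>t\<in>S. t \<le> s" "\<And>c. (\<forall>t\<in>S. t \<le> c) \<Longrightarrow> s \<le> c"
      using definable_lub[of S, OF _ _ bnd] by blast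
    have "0 \<le> s" using s(1) \<open>S \<noteq> {}\<close> unfolding S_def by force
    moreover have "x \<in> Y t" if "s < t" for t
    proof -
      have "t \<notin> S" using that s(1) by force
      with that \<open>0 \<le> s\<close> show ?thesis by (auto simp: S_def)
    qed
    moreover have "x \<notin> Y t" if t: "0 \<le> t" "t < s" for t
    proof -
      obtain u where "u \<in> S" "t < u" using s(2)[of t] t(2) by force
      with Y_sub[of t u] show ?thesis by (auto simp: S_def)
    qed
    ultimately have P: "P x s" by (simp add: P_def)
    then have "s \<in> H" using x I(2) by (auto simp: H_def)
    with r have "\<bar>s\<bar> \<le> r" by blast
    then have "s < \<bar>r\<bar> + 1" by linarith
    with P show ?thesis by (simp add: P_def)
  qed (simp add: abs_if)
  then show ?thesis by blast
qed

lemma union_pfin: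
  assumes "dfam M I Y" "mono Y" "\<And>t. pfin I (Y t)"
  shows "pfin I (\<Union>t. Y t)"
  using union_pfin_stationary[OF assms] assms(3) by metis

end

section \<open>Discrete sets, and nowhere dense subsets of the line\<close>

lemma cube_separate:
  assumes "x \<in> pts I" "z \<in> pts I" "x \<noteq> z" shows "\<exists>\<delta>>0. x \<notin> cube I z \<delta>"
proof -
  from assms pts_eqI[of x I z] obtain i where "i \<in> I" "x i \<noteq> z i" by blast
  then show ?thesis by (intro exI[of _ "\<bar>x i - z i\<bar>"]) (auto simp: cube_def)
qed

definition discr :: "nat set \<Rightarrow> (nat \<Rightarrow> 'a::linordered_field) set \<Rightarrow> bool" where
  "discr I X \<longleftrightarrow> (\<forall>x\<in>X. \<exists>\<epsilon>>0. cube I x \<epsilon> \<inter> X \<subseteq> {x})"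

text \<open>Empty interior of a subset of the line, expressed by the order alone.\<close>

definition thin :: "'a::linordered_field set \<Rightarrow> bool" where
  "thin A \<longleftrightarrow> (\<forall>a b. a < b \<longrightarrow> (\<exists>c. a < c \<and> c < b \<and> c \<notin> A))"

lemma solid_line: "solid {0} (line A) \<longleftrightarrow> \<not> thin A"
proof
  assume "solid {0} (line A)"
  then obtain x \<epsilon> where x: "x \<in> pts {0}" "\<epsilon> > 0" "cube {0} x \<epsilon> \<subseteq> line A" unfolding solid_def by blast
  have "c \<in> A" if "x 0 - \<epsilon> < c" "c < x 0 + \<epsilon>" for c
  proof -
    have "restrict (\<lambda>_. c) {0} \<in> cube {0} x \<epsilon>" using that by (simp add: cube_def abs_less_iff algebra_simps)
    then show ?thesis using x(3) by (auto simp: line_def)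
  qed
  moreover have "x 0 - \<epsilon> < x 0 + \<epsilon>" using x(2) by simp
  ultimately show "\<not> thin A" unfolding thin_def by blast
next
  assume "\<not> thin A"
  then obtain a b where ab: "a < b" "\<And>c. a < c \<Longrightarrow> c < b \<Longrightarrow> c \<in> A" unfolding thin_def by blast
  define x where "x = restrict (\<lambda>_. (a + b) / 2) {0 :: nat}"
  have "cube {0} x ((b - a) / 2) \<subseteq> line A"
    using ab(2) by (auto simp: cube_def x_def line_def abs_less_iff field_simps)
  moreover have "(b - a) / 2 > 0" using ab(1) by simp
  ultimately show "solid {0} (line A)" unfolding solid_def x_def by (meson restrict_in_pts)
qed

lemma clo_line: "clo {0} (line A) = line {a. \<forall>\<epsilon>>0. \<exists>b\<in>A. \<bar>b - a\<bar> < \<epsilon>}"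
proof -
  have "cube {0} x \<epsilon> \<inter> line A \<noteq> {} \<longleftrightarrow> (\<exists>b\<in>A. \<bar>b - x 0\<bar> < \<epsilon>)" for x :: "nat \<Rightarrow> 'a" and \<epsilon>
  proof
    assume "\<exists>b\<in>A. \<bar>b - x 0\<bar> < \<epsilon>"
    then obtain b where "b \<in> A" "\<bar>b - x 0\<bar> < \<epsilon>" by blast
    then have "restrict (\<lambda>_. b) {0} \<in> cube {0} x \<epsilon> \<inter> line A" by (simp add: cube_def line_def)
    then show "cube {0} x \<epsilon> \<inter> line A \<noteq> {}" by blast
  qed (auto simp: cube_def line_def)
  then show ?thesis unfolding clo_def line_def by simp
qed

lemma line_subset_iff: "line A \<subseteq> line B \<longleftrightarrow> A \<subseteq> B"
proof
  assume L: "line A \<subseteq> line B"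
  show "A \<subseteq> B"
  proof
    fix a assume "a \<in> A"
    then have "restrict (\<lambda>_. a) {0} \<in> line A" by (simp add: line_def)
    with L have "restrict (\<lambda>_. a) {0} \<in> line B" by blast
    then show "a \<in> B" by (simp add: line_def)
  qed
qed (auto simp: line_def)

lemma cls_line_iff: "cls {0} (line A) \<longleftrightarrow> (\<forall>a. (\<forall>\<epsilon>>0. \<exists>b\<in>A. \<bar>b - a\<bar> < \<epsilon>) \<longrightarrow> a \<in> A)"
  unfolding cls_def clo_line line_subset_iff by (auto simp: line_def)

context dc_structure
begin

lemma definable_glb:
  assumes S: "dpred M (\<lambda>e. e 0 \<in> S)" "S \<noteq> {}" "\<And>x. x \<in> S \<Longrightarrow> b \<le> x"
  shows "\<exists>s. (\<forall>x\<in>S. s \<le> x) \<and> (\<forall>c. (\<forall>x\<in>S. c \<le> x) \<longrightarrow> c \<le> s)"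
proof -
  define L where "L = {l. \<forall>x. x \<in> S \<longrightarrow> l \<le> x}"
  have "dpred M (\<lambda>e. e 0 \<in> L)" unfolding L_def mem_Collect_eq
    by (intro dI dpred_app1[OF S(1)])
  moreover have "b \<in> L" using S(3) by (auto simp: L_def)
  moreover obtain z where z: "z \<in> S" using S(2) by blast
  moreover have "l \<le> z" if "l \<in> L" for l using that z by (auto simp: L_def)
  ultimately obtain s where s: "\<forall>x\<in>L. x \<le> s" "\<forall>c. (\<forall>x\<in>L. x \<le> c) \<longrightarrow> s \<le> c"
    using definable_lub[of L z] by blast
  then show ?thesis by (intro exI[of _ s]) (auto simp: L_def)
qed

lemma isolated_thin: assumes "isolated {0} (line A)" shows "thin A"
  unfolding thin_def
proof (intro allI impI)
  fix a b :: 'a assume "a < b"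
  then obtain m where m: "a < m" "m < b" using dense by blast
  obtain \<epsilon> where \<epsilon>: "\<epsilon> > 0" "\<And>c. c \<in> A \<Longrightarrow> \<bar>c - m\<bar> < \<epsilon> \<Longrightarrow> c = m"
    using assms unfolding isolated_line by blast
  obtain c where c: "m < c" "c < min b (m + \<epsilon>)" using dense[of m "min b (m + \<epsilon>)"] m \<epsilon>(1) by auto
  then have "c \<notin> A" using \<epsilon>(2)[of c] by (auto simp: abs_if)
  with c m show "\<exists>c. a < c \<and> c < b \<and> c \<notin> A" by (intro exI[of _ c]) auto
qed

end

context tame_structure
begin

text \<open>The points of \<open>X\<close> of norm at most \<open>t\<close> whose \<open>1/t\<close>-neighbourhoods contain no other point of \<open>X\<close> are
  uniformly separated, hence form a pseudo-finite set \<open>D t\<close>.\<close>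

lemma discr_pfin:
  assumes X: "dset M I X" "discr I X"
  shows "pfin I X"
proof -
  define D where "D t = {x \<in> pts I. x \<in> X \<and> (\<forall>i\<in>I. \<bar>x i\<bar> \<le> t) \<and>
    (\<forall>y\<in>X. (\<forall>i\<in>I. t * \<bar>y i - x i\<bar> < 1) \<longrightarrow> (\<forall>i\<in>I. y i = x i))}" for t
  have I: "finite I" "X \<subseteq> pts I" using X(1) by (auto simp: dset_def)
  have D1: "dfam M I D" unfolding D_def
    by (rule dfamI[OF I(1)]) (intro dpred_mem[OF X(1)] dpred_conj dpred_all_mem[OF X(1)] dpred_imp dpred_ball_fin[OF I(1)] dI; simp)
  have D2: "mono D"
  proof (rule monoI, rule subsetI)
    fix s t x assume st: "s \<le> t" and x: "x \<in> D s"
    with scaled_less_one[OF st] show "x \<in> D t" unfolding D_def by (blast intro: order_trans)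
  qed
  have D3: "pfin I (D t)" for t
  proof -
    have "isolated I (D t)" unfolding isolated_def
    proof
      fix p :: "nat \<Rightarrow> 'a" assume p: "p \<in> pts I"
      \<comment> \<open>With the factor 2, two points of \<open>D t\<close> in the same cube are
        within \<open>1/t\<close> of each other when \<open>t > 0\<close>, hence equal by the choice
        of \<open>D t\<close>.\<close>
      define \<epsilon> where "\<epsilon> = inverse (max (2 * t) 1)"
      have \<epsilon>: "\<epsilon> > 0" unfolding \<epsilon>_def by (rule inverse_max_pos)
      have eq: "y = x" if x: "x \<in> cube I p \<epsilon> \<inter> D t" and y: "y \<in> cube I p \<epsilon> \<inter> D t" for x y
      proof (rule pts_eqI[of _ I])
        have "t * \<bar>y i - x i\<bar> < 1" if "i \<in> I" for i
        proof (cases "0 \<le> t")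
          case True
          have "2 * t * \<bar>x i - p i\<bar> < 1" "2 * t * \<bar>y i - p i\<bar> < 1"
            using x y that by (auto intro!: scaled_small simp: cube_def \<epsilon>_def)
          moreover have "t * \<bar>y i - x i\<bar> \<le> t * (\<bar>y i - p i\<bar> + \<bar>x i - p i\<bar>)"
            using True by (intro mult_left_mono) (auto simp: abs_if)
          ultimately show ?thesis by (simp add: distrib_left)
        next
          case False
          then show ?thesis by (simp add: order.strict_trans1[OF mult_nonpos_nonneg])
        qed
        then show "i \<in> I \<Longrightarrow> y i = x i" for i using x y unfolding D_def by blast
      qed (use x y in \<open>auto simp: D_def\<close>)
      show "\<exists>\<epsilon>>0. cube I p \<epsilon> \<inter> D t \<subseteq> {p}"
      \<comment> \<open>The cube contains at most one point of \<open>D t\<close>; if that is some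
        \<open>x\<close> other than \<open>p\<close>, a smaller cube leaves it out.\<close>
      proof (cases "cube I p \<epsilon> \<inter> D t \<subseteq> {p}")
        case False
        then obtain x where x: "x \<in> cube I p \<epsilon> \<inter> D t" "x \<noteq> p" by blast
        then obtain \<delta> where d: "\<delta> > 0" "x \<notin> cube I p \<delta>"
          using cube_separate[of x I p] p cube_subset_pts by blast
        have "cube I p (min \<epsilon> \<delta>) \<inter> D t = {}"
          using cube_center_min[OF p \<epsilon> d(1)] d(2) eq[OF x(1)] by blast
        then show ?thesis using \<epsilon> d(1) by (intro exI[of _ "min \<epsilon> \<delta>"]) simp
      qed (use \<epsilon> in blast)
    qed
    then show ?thesis using dfam_dset[OF D1, of t] unfolding pfin_def bdd_def D_def by blast
  qed
  have "(\<Union>t. D t) = X"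
  proof (intro equalityI subsetI)
    fix x assume x: "x \<in> X"
    obtain \<epsilon> where e: "\<epsilon> > 0" "cube I x \<epsilon> \<inter> X \<subseteq> {x}" using X(2) x unfolding discr_def by blast
    \<comment> \<open>Large enough for both requirements of \<open>D t\<close>: the norm of
      \<open>x\<close> and its distance \<open>\<epsilon>\<close> from the rest of \<open>X\<close>.
      For empty \<open>I\<close> the value of \<open>Max\<close> is irrelevant.\<close>
    define t where "t = max (Max ((\<lambda>i. \<bar>x i\<bar>) ` I)) (inverse \<epsilon>)"
    have "\<forall>i\<in>I. \<bar>x i\<bar> \<le> t" using I(1) by (simp add: t_def le_max_iff_disj)
    moreover have "y = x" if y: "y \<in> X" "\<forall>i\<in>I. t * \<bar>y i - x i\<bar> < 1" for y
    proof -
      have "\<bar>y i - x i\<bar> < \<epsilon>" if "i \<in> I" for i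
        using y(2) that scaled_less_one[of "inverse \<epsilon>" t] by (intro less_of_scaled[OF e(1)]) (auto simp: t_def)
      then show ?thesis using y(1) I(2) e(2) by (auto simp: cube_def)
    qed
    ultimately have "x \<in> D t" using x I(2) by (auto simp: D_def)
    then show "x \<in> (\<Union>t. D t)" by blast
  qed (auto simp: D_def)
  with union_pfin[OF D1 D2 D3] show ?thesis by simp
qed

text \<open>The midpoints \<open>E\<close> of the bounded gaps of \<open>C\<close> form a discrete set, so the right endpoints of
  these gaps form a pseudo-finite, hence closed, set. It contains all points of \<open>C\<close> except possibly
  the least one.\<close>

lemma thin_closed_pfin:
  assumes C: "dpred M (\<lambda>e. e 0 \<in> C)" "cls {0} (line C)" "thin C"
  shows "pfin {0} (line C)"
proof -
  define gap where "gap a b \<longleftrightarrow> a \<in> C \<and> b \<in> C \<and> a < b \<and> (\<forall>c. c \<in> C \<longrightarrow> \<not> (a < c \<and> c < b))" for a b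
  define E where "E = {m. \<exists>a b. gap a b \<and> m + m = a + b}"
  define B where "B = {b. \<exists>a. gap a b}"
  have gap_eq: "a' = a \<and> b' = b" if g: "gap a b" "gap a' b'" and u: "a < u" "u < b" "a' < u" "u < b'" for a b a' b' u
  proof -
    have "a' \<le> a" "a \<le> a'" "b \<le> b'" "b' \<le> b"
      using g u unfolding gap_def by (meson less_trans not_le)+
    then show ?thesis by simp
  qed
  have mid: "a < m" "m < b" if "gap a b" "m + m = a + b" for a b m
    using that unfolding gap_def by (metis add_less_le_mono add_le_less_mono linorder_not_less less_imp_le add_mono not_le)+
  have E_def': "dset M {0} (line E)" unfolding dset_line E_def gap_def mem_Collect_eq
    by (intro dI dpred_app1[OF C(1)])
  moreover have "discr {0} (line E)" unfolding discr_def
  proof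
    fix x assume x: "x \<in> line E"
    then obtain a b where ab: "gap a b" "x 0 + x 0 = a + b" by (auto simp: line_def E_def)
    \<comment> \<open>As \<open>x 0\<close> is the midpoint, \<open>b - x 0\<close> is half the
      length of the gap and the cube is the gap itself, which contains no other midpoint.\<close>
    have "y = x" if y: "y \<in> cube {0} x (b - x 0)" "y \<in> line E" for y
    proof -
      obtain a' b' where ab': "gap a' b'" "y 0 + y 0 = a' + b'" using y(2) by (auto simp: line_def E_def)
      have "a < y 0" "y 0 < b" using y(1) ab(2) by (auto simp: cube_def abs_less_iff algebra_simps)
      from gap_eq[OF ab(1) ab'(1) this mid[OF ab']] ab(2) ab'(2) have "y 0 + y 0 = x 0 + x 0" by simp
      then have "y 0 = x 0" by simp
      with x y(2) show "y = x" by (auto simp: line_def intro: pts_eqI)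
    qed
    moreover have "b - x 0 > 0" using mid(2)[OF ab] by simp
    ultimately show "\<exists>\<epsilon>>0. cube {0} x \<epsilon> \<inter> line E \<subseteq> {x}" by blast
  qed
  ultimately have E: "pfin {0} (line E)" by (rule discr_pfin)
  \<comment> \<open>The midpoint determines the right endpoint \<open>b\<close>, so the sets
    \<open>Y b\<close> are disjoint and \<open>B\<close> is their index set; thus pseudo-finiteness
    passes from \<open>E\<close> to \<open>B\<close>.\<close>
  define Y where "Y b = {x \<in> pts {0}. x 0 \<in> E \<and> (\<exists>a. gap a b \<and> x 0 + x 0 = a + b)}" for b
  have Y1: "dfam M {0} Y" unfolding Y_def gap_def
    by (rule dfamI) (simp, intro dI dpred_app1[OF C(1)] dpred_app1[OF E_def'[unfolded dset_line]])
  have Y2: "Y b \<subseteq> line E" for b by (auto simp: Y_def line_def)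
  have Y3: "b = b'" if x: "x \<in> Y b" "x \<in> Y b'" for x b b'
  proof -
    from x obtain a a' where g: "gap a b" "x 0 + x 0 = a + b" "gap a' b'" "x 0 + x 0 = a' + b'"
      unfolding Y_def by blast
    from gap_eq[OF g(1,3) mid[OF g(1,2)] mid[OF g(3,4)]] show ?thesis by simp
  qed
  have "{b. Y b \<noteq> {}} = B"
  proof -
    have "Y b \<noteq> {}" if "gap a b" for a b
    proof -
      define m where "m = (a + b) / 2"
      have "m + m = a + b" by (simp add: m_def)
      with that have "restrict (\<lambda>_. m) {0} \<in> Y b" by (auto simp: Y_def E_def)
      then show ?thesis by blast
    qed
    then show ?thesis by (auto simp: B_def Y_def)
  qed
  with pfin_index_set[OF E Y1 Y2 Y3] have B: "pfin {0} (line B)" by simp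
  then have Bc: "cls {0} (line B)" by (intro isolated_cls) (auto simp: pfin_def line_def)
  have in_B: "c \<in> B" if c: "c \<in> C" "c' \<in> C" "c' < c" for c c'
  proof -
    \<comment> \<open>Thinness provides \<open>u\<close> outside \<open>C\<close> just to the left
      of \<open>c\<close>. The gap around \<open>u\<close> ends at some \<open>b\<close> between
      \<open>u\<close> and \<open>c\<close>, so \<open>c\<close> is a limit of points of the closed
      set \<open>B\<close>.\<close>
    have "\<exists>b\<in>B. \<bar>b - c\<bar> < \<epsilon>" if e: "\<epsilon> > 0" for \<epsilon>
    proof -
      have "max c' (c - \<epsilon>) < c" using c(3) e by simp
      then obtain u where u: "max c' (c - \<epsilon>) < u" "u < c" "u \<notin> C" using C(3) unfolding thin_def by blast
      define S where "S = {x. x \<in> C \<and> x < u}"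
      define T where "T = {x. x \<in> C \<and> u < x}"
      have "dpred M (\<lambda>e. e 0 \<in> S)" "dpred M (\<lambda>e. e 0 \<in> T)" unfolding S_def T_def mem_Collect_eq
        by (intro dI dpred_app1[OF C(1)])+
      moreover have "c' \<in> S" "c \<in> T" using u c by (auto simp: S_def T_def)
      moreover have "x \<le> u" if "x \<in> S" for x using that by (simp add: S_def)
      moreover have "u \<le> x" if "x \<in> T" for x using that by (simp add: T_def)
      ultimately have "\<exists>s. (\<forall>x\<in>S. x \<le> s) \<and> (\<forall>c. (\<forall>x\<in>S. x \<le> c) \<longrightarrow> s \<le> c)"
        "\<exists>s. (\<forall>x\<in>T. s \<le> x) \<and> (\<forall>c. (\<forall>x\<in>T. c \<le> x) \<longrightarrow> c \<le> s)"
        by (blast intro!: definable_lub definable_glb)+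
      then obtain a b where a: "\<forall>x\<in>S. x \<le> a" "\<And>c. (\<forall>x\<in>S. x \<le> c) \<Longrightarrow> a \<le> c"
        and b: "\<forall>x\<in>T. b \<le> x" "\<And>c. (\<forall>x\<in>T. c \<le> x) \<Longrightarrow> c \<le> b" by blast
      have "a \<in> C"
      proof (rule cls_line_iff[THEN iffD1, OF C(2), rule_format])
        fix \<delta> :: 'a assume "\<delta> > 0"
        then obtain x where "x \<in> S" "a - \<delta> < x" using a(2)[of "a - \<delta>"] by force
        with a(1) \<open>\<delta> > 0\<close> show "\<exists>b\<in>C. \<bar>b - a\<bar> < \<delta>" by (force simp: S_def abs_less_iff algebra_simps)
      qed
      have "b \<in> C"
      proof (rule cls_line_iff[THEN iffD1, OF C(2), rule_format])
        fix \<delta> :: 'a assume "\<delta> > 0"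
        then obtain x where "x \<in> T" "x < b + \<delta>" using b(2)[of "b + \<delta>"] by force
        with b(1) \<open>\<delta> > 0\<close> show "\<exists>a\<in>C. \<bar>a - b\<bar> < \<delta>" by (force simp: T_def abs_less_iff algebra_simps)
      qed
      have "a \<le> u" "u \<le> b" by (auto intro!: a(2) b(2) simp: S_def T_def)
      then have "a < u" "u < b" using u(3) \<open>a \<in> C\<close> \<open>b \<in> C\<close> by (auto simp: less_le)
      then have "gap a b"
        using a(1) b(1) u(3) \<open>a \<in> C\<close> \<open>b \<in> C\<close> unfolding gap_def S_def T_def
        by (metis (mono_tags, lifting) mem_Collect_eq linorder_neqE not_less less_trans)
      then have "b \<in> B" by (auto simp: B_def)
      moreover have "b \<le> c" using b(1) \<open>c \<in> T\<close> by blast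
      moreover have "c - \<epsilon> < b" using u \<open>u < b\<close> by simp
      ultimately show ?thesis using e by (intro bexI[of _ b]) (auto simp: abs_less_iff algebra_simps)
    qed
    then show ?thesis using Bc unfolding cls_line_iff by blast
  qed
  have "\<exists>m. C - B \<subseteq> {m}"
    using in_B by (metis Diff_iff linorder_neqE singletonI subsetI)
  then obtain m where m: "C \<subseteq> B \<union> {m}" by blast
  have "\<exists>\<epsilon>>0. \<bar>m - a\<bar> < \<epsilon> \<longrightarrow> m = a" for a
    by (cases "m = a") (auto intro: exI[of _ 1] exI[of _ "\<bar>m - a\<bar>"])
  then have "pfin {0} (line {m})" unfolding pfin_def
    by (simp add: dset_line isolated_line bdd_line dI) (meson order_refl)
  with B have "pfin {0} (line (B \<union> {m}))" unfolding line_Un by (rule pfin_Un)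
  then show ?thesis
    by (rule pfin_subset[OF _ dset_line[THEN iffD2, OF C(1)]]) (use m in \<open>auto simp: line_def\<close>)
qed

lemma nowhere_dense_pfin:
  assumes X: "dset M {0} X" "\<not> solid {0} (clo {0} X)"
  shows "pfin {0} X"
proof -
  have X': "X \<subseteq> pts {0}" using X(1) by (simp add: dset_def)
  obtain C where C: "clo {0} X = line C" using line_image[of "clo {0} X"] by (auto simp: clo_def)
  have "pfin {0} (line C)"
    using dset_clo[OF X(1)] X(2) cls_clo[of "{0}" X] unfolding C
    by (intro thin_closed_pfin) (simp_all add: dset_line solid_line)
  then show ?thesis using clo_subset[OF X'] C X(1) by (metis pfin_subset)
qed

text \<open>The source of both category statements: every level is pseudo-finite, so the union is.
  In the real field with the integers named, the rationals are such a union.\<close>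

lemma union_thin_pfin:
  assumes A: "dpred M (\<lambda>e. e 1 \<in> A (e 0))" "mono A" "\<And>t. cls {0} (line (A t))" "\<And>t. thin (A t)"
  shows "pfin {0} (line (\<Union>t. A t))"
proof -
  have "dfam M {0} (\<lambda>t. line (A t))" unfolding line_def
    using A(1) by (intro dfamI) simp_all
  moreover have "mono (\<lambda>t. line (A t))" using A(2) by (auto simp: mono_def line_def)
  moreover have "pfin {0} (line (A t))" for t
  proof (rule thin_closed_pfin[OF _ A(3,4)])
    show "dpred M (\<lambda>e. e 0 \<in> A t)"
      using dpred_app2[of M "\<lambda>s x. x \<in> A s" "\<lambda>_. t" "\<lambda>e. e 0"] A(1) by (simp add: dI)
  qed
  ultimately have "pfin {0} (\<Union>t. line (A t))" by (rule union_pfin)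
  moreover have "(\<Union>t. line (A t)) = line (\<Union>t. A t)" by (auto simp: line_def)
  ultimately show ?thesis by simp
qed

end

section \<open>Cylinders, fibres and closed coordinate conditions\<close>

lemma cube_sym: "x \<in> pts I \<Longrightarrow> y \<in> cube I x \<epsilon> \<Longrightarrow> x \<in> cube I y \<epsilon>"
  by (auto simp: cube_def abs_minus_commute)

lemma pts_split: "v \<in> pts (insert k J) \<Longrightarrow> k \<notin> J \<Longrightarrow> (restrict v J)(k := v k) = v"
  by (rule pts_eqI[of _ "insert k J"]) auto

lemma pts_upd_mem [simp]: "u \<in> pts I \<Longrightarrow> k \<in> I \<Longrightarrow> u(k := c) \<in> pts I"
  using pts_upd[of u I k c] by (simp add: insert_absorb)

lemma restrict_upd [simp]: "u \<in> pts J \<Longrightarrow> k \<notin> J \<Longrightarrow> restrict (u(k := c)) J = u"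
  by (rule pts_eqI[of _ J]) auto

text \<open>Together with its converse \<open>solid_insertE\<close>, this replaces interior over
  \<open>insert k J\<close> by an open set over \<open>J\<close> times an interval in coordinate
  \<open>k\<close>, the form suited to arguments about fibres.\<close>

lemma solid_cylinder:
  assumes J: "finite J" "k \<notin> J" and V: "opn J V" "V \<noteq> {}" and ab: "a < b"
    and Z: "\<And>u c. u \<in> V \<Longrightarrow> a < c \<Longrightarrow> c < b \<Longrightarrow> u(k := c) \<in> Z"
  shows "solid (insert k J) Z"
proof -
  obtain u \<epsilon> where u: "u \<in> V" "\<epsilon> > 0" "cube J u \<epsilon> \<subseteq> V" using V unfolding opn_def by blast
  have up: "u \<in> pts J" using u V unfolding opn_def by blast
  define v where "v = u(k := (a + b) / 2)"
  define \<delta> where "\<delta> = min \<epsilon> ((b - a) / 2)"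
  have "\<delta> > 0" using u ab by (simp add: \<delta>_def)
  moreover have "cube (insert k J) v \<delta> \<subseteq> Z"
  proof
    fix w assume w: "w \<in> cube (insert k J) v \<delta>"
    have "\<bar>w i - u i\<bar> < \<epsilon>" if "i \<in> J" for i
    proof -
      have "i \<noteq> k" using that J by blast
      then show ?thesis using w that by (auto simp: cube_def v_def \<delta>_def)
    qed
    then have "restrict w J \<in> cube J u \<epsilon>" by (simp add: cube_def)
    moreover have "\<bar>w k - (a + b) / 2\<bar> < (b - a) / 2" using w by (auto simp: cube_def v_def \<delta>_def)
    then have "a < w k" "w k < b" by (auto simp: abs_less_iff field_simps)
    ultimately have "(restrict w J)(k := w k) \<in> Z" using Z u(3) by blast
    then show "w \<in> Z" using w J pts_split[of w k J] by (auto simp: cube_def)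
  qed
  moreover have "v \<in> pts (insert k J)" using up by (simp add: v_def)
  ultimately show ?thesis unfolding solid_def by blast
qed

lemma solid_insertE:
  assumes J: "finite J" "k \<notin> J" and Z: "solid (insert k J) Z"
  obtains V a b where "opn J V" "V \<noteq> {}" "a < b" "\<And>u c. u \<in> V \<Longrightarrow> a < c \<Longrightarrow> c < b \<Longrightarrow> u(k := c) \<in> Z"
proof -
  obtain v \<epsilon> where v: "v \<in> pts (insert k J)" "\<epsilon> > 0" "cube (insert k J) v \<epsilon> \<subseteq> Z"
    using Z unfolding solid_def by blast
  show ?thesis
  proof (rule that[of "cube J (restrict v J) \<epsilon>" "v k - \<epsilon>" "v k + \<epsilon>"])
    fix u c assume "u \<in> cube J (restrict v J) \<epsilon>" "v k - \<epsilon> < c" "c < v k + \<epsilon>"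
    then have "u(k := c) \<in> cube (insert k J) v \<epsilon>" using J by (auto simp: cube_def abs_less_iff algebra_simps)
    with v(3) show "u(k := c) \<in> Z" by blast
  qed (use v J cube_center[of "restrict v J" J \<epsilon>] in \<open>auto intro: opn_cube\<close>)
qed

lemma cls_fibre:
  assumes J: "k \<notin> J" and Z: "cls (insert k J) Z" and u: "u \<in> pts J"
  shows "cls {0} (line {c. u(k := c) \<in> Z})"
  unfolding cls_line_iff
proof (intro allI impI)
  fix a assume a: "\<forall>\<epsilon>>0. \<exists>b\<in>{c. u(k := c) \<in> Z}. \<bar>b - a\<bar> < \<epsilon>"
  have "u(k := a) \<in> Z"
  proof (rule clsD[OF Z])
    fix \<epsilon> :: 'a assume "\<epsilon> > 0"
    with a obtain b where "u(k := b) \<in> Z" "\<bar>b - a\<bar> < \<epsilon>" by blast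
    then show "\<exists>y\<in>Z. y \<in> cube (insert k J) (u(k := a)) \<epsilon>"
      using u J \<open>\<epsilon> > 0\<close> by (intro bexI[of _ "u(k := b)"]) (auto simp: cube_def)
  qed (use u in simp)
  then show "a \<in> {c. u(k := c) \<in> Z}" by simp
qed

lemma cls_bounded: "cls I {x \<in> pts I. \<forall>i\<in>I. \<bar>x i\<bar> \<le> t}"
proof (rule clsI)
  fix x assume "x \<in> pts I" "x \<notin> {x \<in> pts I. \<forall>i\<in>I. \<bar>x i\<bar> \<le> t}"
  then obtain i where i: "i \<in> I" "t < \<bar>x i\<bar>" by auto
  have "\<not> \<bar>y i\<bar> \<le> t" if "\<bar>y i - x i\<bar> < \<bar>x i\<bar> - t" for y
  proof -
    have "\<bar>x i\<bar> \<le> \<bar>y i\<bar> + \<bar>y i - x i\<bar>" by (simp add: abs_if)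
    with that show ?thesis by simp
  qed
  with i show "\<exists>\<epsilon>>0. cube I x \<epsilon> \<inter> {x \<in> pts I. \<forall>i\<in>I. \<bar>x i\<bar> \<le> t} = {}"
    by (intro exI[of _ "\<bar>x i\<bar> - t"]) (auto simp: cube_def)
qed auto

lemma cls_coord_le: "k \<in> I \<Longrightarrow> cls I {x \<in> pts I. x k \<le> t}"
proof (rule clsI)
  fix x assume "k \<in> I" "x \<in> pts I" "x \<notin> {x \<in> pts I. x k \<le> t}"
  then show "\<exists>\<epsilon>>0. cube I x \<epsilon> \<inter> {x \<in> pts I. x k \<le> t} = {}"
    by (intro exI[of _ "x k - t"]) (auto simp: cube_def abs_less_iff)
qed auto

lemma cls_coord_ge: "k \<in> I \<Longrightarrow> cls I {x \<in> pts I. t \<le> x k}"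
proof (rule clsI)
  fix x assume "k \<in> I" "x \<in> pts I" "x \<notin> {x \<in> pts I. t \<le> x k}"
  then show "\<exists>\<epsilon>>0. cube I x \<epsilon> \<inter> {x \<in> pts I. t \<le> x k} = {}"
    by (intro exI[of _ "t - x k"]) (auto simp: cube_def abs_less_iff)
qed auto

lemma cls_coord_eq: "i \<in> I \<Longrightarrow> j \<in> I \<Longrightarrow> cls I {x \<in> pts I. x i = (x j :: 'a::linordered_field)}"
proof (rule clsI)
  fix x :: "nat \<Rightarrow> 'a"
  assume ij: "i \<in> I" "j \<in> I" and x: "x \<in> pts I" "x \<notin> {x \<in> pts I. x i = x j}"
  have "y i \<noteq> y j" if y: "y \<in> cube I x (\<bar>x i - x j\<bar> / 2)" for y
  proof
    assume "y i = y j"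
    then have "\<bar>x i - x j\<bar> \<le> \<bar>y i - x i\<bar> + \<bar>y j - x j\<bar>" by (simp add: abs_if)
    moreover have "\<bar>y i - x i\<bar> < \<bar>x i - x j\<bar> / 2" "\<bar>y j - x j\<bar> < \<bar>x i - x j\<bar> / 2"
      using y ij unfolding cube_def by blast+
    ultimately show False by simp
  qed
  with x show "\<exists>\<epsilon>>0. cube I x \<epsilon> \<inter> {x \<in> pts I. x i = x j} = {}"
    by (intro exI[of _ "\<bar>x i - x j\<bar> / 2"]) auto
qed auto

lemma cls_params: "K \<subseteq> I \<Longrightarrow> cls I {x \<in> pts I. \<forall>i\<in>K. x i = p i}"
proof (rule clsI)
  fix x assume K: "K \<subseteq> I" and x: "x \<in> pts I" "x \<notin> {x \<in> pts I. \<forall>i\<in>K. x i = p i}"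
  then obtain i where "i \<in> K" "x i \<noteq> p i" by blast
  with K show "\<exists>\<epsilon>>0. cube I x \<epsilon> \<inter> {x \<in> pts I. \<forall>i\<in>K. x i = p i} = {}"
    by (intro exI[of _ "\<bar>p i - x i\<bar>"]) (fastforce simp: cube_def)
qed auto

context dc_structure
begin

section \<open>\<open>F\<^sub>\<sigma>\<close> sets\<close>

definition closed_family :: "nat set \<Rightarrow> ('a \<Rightarrow> (nat \<Rightarrow> 'a) set) \<Rightarrow> bool" where
  "closed_family I Y \<longleftrightarrow> dfam M I Y \<and> mono Y \<and> (\<forall>t. cls I (Y t))"

definition fsigma :: "nat set \<Rightarrow> (nat \<Rightarrow> 'a) set \<Rightarrow> bool" where
  "fsigma I X \<longleftrightarrow> (\<exists>Y. closed_family I Y \<and> X = (\<Union>t. Y t))"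

lemma closed_familyD:
  assumes "closed_family I Y"
  shows "dfam M I Y" "mono Y" "cls I (Y t)" "finite I" "Y t \<subseteq> pts I" "s \<le> t \<Longrightarrow> Y s \<subseteq> Y t"
  using assms by (auto simp: closed_family_def dfam_def dest: monoD)

lemma dset_union: "dfam M I Y \<Longrightarrow> dset M I (\<Union>t. Y t)"
proof -
  assume Y: "dfam M I Y"
  have "(\<Union>t. Y t) = {x \<in> pts I. \<exists>t. x \<in> Y t}" using Y by (auto simp: dfam_def)
  also have "dset M I \<dots>" using Y by (intro dsetI dI dpred_fam[OF Y]) (auto simp: dfam_def)
  finally show ?thesis .
qed

lemma fsigma_dset: "fsigma I X \<Longrightarrow> dset M I X"
  unfolding fsigma_def using closed_familyD(1) dset_union by blast

lemma fsigma_finite: "fsigma I X \<Longrightarrow> finite I \<and> X \<subseteq> pts I"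
  using fsigma_dset by (auto simp: dset_def)

lemma fsigma_cls: "dset M I X \<Longrightarrow> cls I X \<Longrightarrow> fsigma I X"
  unfolding fsigma_def closed_family_def by (rule exI[of _ "\<lambda>_. X"]) (auto simp: dset_fam mono_def)

text \<open>\<open>U\<close> is exhausted by the points whose open cube of radius \<open>1/t\<close>
  stays inside \<open>U\<close>. These form a closed set: a point \<open>z\<close> outside
  \<open>U\<close> in the open cube of \<open>x\<close> is also in the cubes of all points near
  \<open>x\<close>.\<close>

lemma fsigma_opn:
  assumes U: "dset M I U" "opn I U" shows "fsigma I U"
proof -
  have I: "finite I" "U \<subseteq> pts I" using U(1) by (auto simp: dset_def)
  define Y where "Y t = {x \<in> pts I. 0 < t \<and> (\<forall>z\<in>pts I. (\<forall>i\<in>I. t * \<bar>z i - x i\<bar> < 1) \<longrightarrow> z \<in> U)}" for t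
  have "dfam M I Y" unfolding Y_def
    by (rule dfamI[OF I(1)]) (intro dpred_mem[OF U(1)] dpred_conj dpred_imp dpred_all_pts[OF I(1)] dpred_ball_fin[OF I(1)] dI; simp)
  moreover have "mono Y"
  proof (rule monoI, rule subsetI)
    fix s t x assume st: "s \<le> t" and x: "x \<in> Y s"
    with scaled_less_one[OF st] st show "x \<in> Y t" unfolding Y_def by auto
  qed
  moreover have cubes: "{z \<in> pts I. \<forall>i\<in>I. t * \<bar>z i - x i\<bar> < 1} = cube I x (inverse t)" if "t > 0" for t x
    using that by (auto simp: cube_def field_simps)
  have Y_eq: "Y t = {x \<in> pts I. 0 < t \<and> cube I x (inverse t) \<subseteq> U}" for t
    unfolding Y_def using cubes[of t] by blast
  have "cls I (Y t)" for t
  proof (rule clsI)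
    fix x assume x: "x \<in> pts I" "x \<notin> Y t"
    show "\<exists>\<epsilon>>0. cube I x \<epsilon> \<inter> Y t = {}"
    proof (cases "0 < t")
      case True
      with x obtain z where z: "z \<in> cube I x (inverse t)" "z \<notin> U" by (auto simp: Y_eq)
      from cube_nested[OF I(1) cube_sym[OF x(1) z(1)]] obtain \<delta> where
        d: "\<delta> > 0" "cube I x \<delta> \<subseteq> cube I z (inverse t)" by blast
      have "z \<in> pts I" using z(1) cube_subset_pts by blast
      have "w \<notin> Y t" if "w \<in> cube I x \<delta>" for w
        using cube_sym[OF \<open>z \<in> pts I\<close>, of w "inverse t"] d(2) that z(2) by (auto simp: Y_eq)
      with d(1) show ?thesis by blast
    qed (auto simp: Y_eq intro: exI[of _ 1])
  qed (auto simp: Y_def)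
  moreover have "U = (\<Union>t. Y t)"
  proof (intro equalityI subsetI)
    fix x assume x: "x \<in> U"
    with U(2) obtain \<epsilon> where "\<epsilon> > 0" "cube I x \<epsilon> \<subseteq> U" unfolding opn_def by blast
    then have "x \<in> Y (inverse \<epsilon>)" using x I by (auto simp: Y_eq)
    then show "x \<in> (\<Union>t. Y t)" by blast
  next
    fix x assume "x \<in> (\<Union>t. Y t)"
    then obtain t where "x \<in> pts I" "0 < t" "cube I x (inverse t) \<subseteq> U" by (auto simp: Y_eq)
    then show "x \<in> U" using cube_center[of x I "inverse t"] by auto
  qed
  ultimately show ?thesis unfolding fsigma_def closed_family_def by blast
qed

lemma closed_family_Un: "closed_family I Y \<Longrightarrow> closed_family I Z \<Longrightarrow> closed_family I (\<lambda>t. Y t \<union> Z t)"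
  unfolding closed_family_def dfam_def by (auto simp: mono_def cls_Un intro: dpred_disj) blast+

lemma closed_family_Int: "closed_family I Y \<Longrightarrow> closed_family I Z \<Longrightarrow> closed_family I (\<lambda>t. Y t \<inter> Z t)"
  unfolding closed_family_def dfam_def by (auto simp: mono_def cls_Int intro: dpred_conj) blast+

lemma fsigma_Un: assumes "fsigma I X" "fsigma I Z" shows "fsigma I (X \<union> Z)"
proof -
  from assms obtain A B where "closed_family I A" "X = (\<Union>t. A t)" "closed_family I B" "Z = (\<Union>t. B t)"
    unfolding fsigma_def by blast
  then show ?thesis unfolding fsigma_def
    by (intro exI[of _ "\<lambda>t. A t \<union> B t"]) (auto intro: closed_family_Un)
qed

lemma fsigma_Int: assumes "fsigma I X" "fsigma I Z" shows "fsigma I (X \<inter> Z)"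
proof -
  from assms obtain A B where AB: "closed_family I A" "X = (\<Union>t. A t)" "closed_family I B" "Z = (\<Union>t. B t)"
    unfolding fsigma_def by blast
  have "x \<in> (\<Union>t. A t \<inter> B t)" if "x \<in> A s" "x \<in> B t" for x s t
    using closed_familyD(6)[OF AB(1), of s "max s t"] closed_familyD(6)[OF AB(3), of t "max s t"] that
    by (intro UN_I[of "max s t"]) auto
  with AB show ?thesis unfolding fsigma_def
    by (intro exI[of _ "\<lambda>t. A t \<inter> B t"]) (auto intro: closed_family_Int)
qed

lemma closed_family_projection:
  assumes Y: "closed_family I Y" and J: "J \<subseteq> I" and b: "\<And>t. bdd I (Y t)"
  shows "closed_family J (\<lambda>t. (\<lambda>x. restrict x J) ` Y t)"
proof -
  have Jf: "finite J" using closed_familyD(4)[OF Y] J by (rule rev_finite_subset)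
  have "(\<lambda>x. restrict x J) ` Y t = {y \<in> pts J. \<exists>x\<in>Y t. \<forall>j\<in>J. x j = y j}" for t
  proof (intro equalityI subsetI)
    fix y assume "y \<in> {y \<in> pts J. \<exists>x\<in>Y t. \<forall>j\<in>J. x j = y j}"
    then obtain x where "y \<in> pts J" "x \<in> Y t" "\<forall>j\<in>J. x j = y j" by blast
    then have "y = restrict x J" by (intro pts_eqI[of _ J]) auto
    with \<open>x \<in> Y t\<close> show "y \<in> (\<lambda>x. restrict x J) ` Y t" by blast
  qed auto
  moreover have "dfam M J (\<lambda>t. {y \<in> pts J. \<exists>x\<in>Y t. \<forall>j\<in>J. x j = y j})"
    by (rule dfamI[OF Jf]) (intro dpred_ex_fam[OF closed_familyD(1)[OF Y]] dpred_ball_fin[OF Jf] dI)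
  ultimately show ?thesis
    using cls_projection[OF dfam_dset[OF closed_familyD(1)[OF Y]] closed_familyD(3)[OF Y] b J]
      image_mono[OF closed_familyD(6)[OF Y], of _ _ "\<lambda>x. restrict x J"]
    unfolding closed_family_def by (simp only: monoI simp_thms)
qed

lemma closed_family_bounded: "finite I \<Longrightarrow> closed_family I (\<lambda>t. {x \<in> pts I. \<forall>i\<in>I. \<bar>x i\<bar> \<le> t})"
  unfolding closed_family_def
proof (intro conjI allI)
  assume I: "finite I"
  show "dfam M I (\<lambda>t. {x \<in> pts I. \<forall>i\<in>I. \<bar>x i\<bar> \<le> t})"
    by (rule dfamI[OF I]) (intro dpred_ball_fin[OF I] dI)
  show "mono (\<lambda>t. {x \<in> pts I. \<forall>i\<in>I. \<bar>x i\<bar> \<le> t})" by (rule monoI) (auto intro: order_trans)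
qed (rule cls_bounded)

lemma pts_bounded: "finite I \<Longrightarrow> \<exists>t. \<forall>i\<in>I. \<bar>x i\<bar> \<le> (t :: 'a)"
  by (intro exI[of _ "Max ((\<lambda>i. \<bar>x i\<bar>) ` I)"]) simp

text \<open>Projections of closed sets need not be closed, so level \<open>t\<close> is first cut
  down to the box of size \<open>t\<close>; then \<open>cls_projection\<close> applies to each
  level.\<close>

lemma fsigma_projection:
  assumes X: "fsigma I X" and J: "J \<subseteq> I" shows "fsigma J ((\<lambda>x. restrict x J) ` X)"
proof -
  have I: "finite I" "X \<subseteq> pts I" using fsigma_finite[OF X] by auto
  have "fsigma I (pts I)" by (intro fsigma_cls dset_pts I) (auto simp: cls_def clo_def)
  from X obtain Y where Y: "closed_family I Y" "X = (\<Union>t. Y t)" unfolding fsigma_def by blast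
  define B where "B t = {x \<in> pts I. \<forall>i\<in>I. \<bar>x i\<bar> \<le> t}" for t :: 'a
  have B: "closed_family I B" unfolding B_def by (rule closed_family_bounded[OF I(1)])
  have "closed_family J (\<lambda>t. (\<lambda>x. restrict x J) ` (Y t \<inter> B t))" (is "closed_family J ?P")
    by (rule closed_family_projection[OF closed_family_Int[OF Y(1) B] J]) (auto simp: bdd_def B_def)
  moreover have X_eq: "X = (\<Union>t. Y t \<inter> B t)"
  proof (intro equalityI subsetI)
    fix x assume "x \<in> X"
    then obtain s where s: "x \<in> Y s" using Y by blast
    obtain t where t: "\<forall>i\<in>I. \<bar>x i\<bar> \<le> t" using pts_bounded[OF I(1)] by blast
    have "x \<in> B t" using t \<open>x \<in> X\<close> I by (auto simp: B_def)
    then have "x \<in> Y (max s t) \<inter> B (max s t)"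
      using s closed_familyD(6)[OF Y(1), of s "max s t"] closed_familyD(6)[OF B, of t "max s t"] by auto
    then show "x \<in> (\<Union>t. Y t \<inter> B t)" by blast
  qed (use Y in blast)
  moreover have "(\<lambda>x. restrict x J) ` X = (\<Union>t. (\<lambda>x. restrict x J) ` (Y t \<inter> B t))"
    by (subst X_eq) (rule image_UN)
  ultimately show ?thesis unfolding fsigma_def
    by (intro exI[of _ ?P]) simp
qed

lemma fsigma_cylinder:
  assumes X: "fsigma J X" and J: "J \<subseteq> I" "finite I" shows "fsigma I {x \<in> pts I. restrict x J \<in> X}"
proof -
  from X obtain Y where Y: "closed_family J Y" "X = (\<Union>t. Y t)" unfolding fsigma_def by blast
  have "closed_family I (\<lambda>t. {x \<in> pts I. restrict x J \<in> Y t})" unfolding closed_family_def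
  proof (intro conjI allI)
    show "dfam M I (\<lambda>t. {x \<in> pts I. restrict x J \<in> Y t})"
      by (rule dfamI[OF J(2)]) (intro dpred_fam[OF closed_familyD(1)[OF Y(1)]] dI restrict_in_pts)
    show "mono (\<lambda>t. {x \<in> pts I. restrict x J \<in> Y t})"
      using closed_familyD(6)[OF Y(1)] by (auto simp: mono_def)
  qed (rule cls_vimage_restrict[OF J(1) closed_familyD(3)[OF Y(1)]])
  then show ?thesis using Y(2) unfolding fsigma_def by blast
qed

section \<open>Sets of points with large fibres\<close>

text \<open>\<open>big k J Z t\<close> projects to the set of those \<open>u\<close>, bounded by \<open>t\<close>, for which the fibre of \<open>Z\<close> over
  \<open>u\<close> contains an interval \<open>[a, a + 1/t]\<close> with \<open>\<bar>a\<bar> \<le> t\<close>; the left end \<open>a\<close> is the coordinate \<open>k\<close>.\<close>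

definition big :: "nat \<Rightarrow> nat set \<Rightarrow> (nat \<Rightarrow> 'a) set \<Rightarrow> 'a \<Rightarrow> (nat \<Rightarrow> 'a) set" where
  "big k J Z t = {w \<in> pts (insert k J). 0 < t \<and> (\<forall>i\<in>insert k J. \<bar>w i\<bar> \<le> t) \<and>
     (\<forall>c. w k \<le> c \<and> t * (c - w k) \<le> 1 \<longrightarrow> w(k := c) \<in> Z)}"

text \<open>Nonstrict bounds and the fixed length \<open>1/t\<close> make each level closed, and the
  shrinking length makes the levels increase. One \<open>t\<close> serves as level of
  \<open>Z\<close>, bound and length, so that a single index remains.\<close>

lemma closed_family_big:
  assumes J: "finite J" "k \<notin> J" and Z: "closed_family (insert k J) Z"
  shows "closed_family (insert k J) (\<lambda>t. big k J (Z t) t)"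
  unfolding closed_family_def
proof (intro conjI allI)
  let ?I = "insert k J"
  have I: "finite ?I" using J by simp
  show "dfam M ?I (\<lambda>t. big k J (Z t) t)" unfolding big_def
    by (rule dfamI[OF I]) (intro dpred_conj dpred_all dpred_imp dpred_ball_fin[OF I] dpred_fam[OF closed_familyD(1)[OF Z]] dI; simp)
  show "mono (\<lambda>t. big k J (Z t) t)"
  proof (rule monoI, rule subsetI)
    fix s t w assume st: "s \<le> t" and w: "w \<in> big k J (Z s) s"
    have "s * (c - w k) \<le> 1" if "w k \<le> c" "t * (c - w k) \<le> 1" for c
      using mult_right_mono[OF st, of "c - w k"] that by simp
    with w st closed_familyD(6)[OF Z st] show "w \<in> big k J (Z t) t"
      unfolding big_def by (blast intro: order_trans less_le_trans)
  qed
  fix t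
  show "cls ?I (big k J (Z t) t)" unfolding cls_def
  proof (intro conjI subsetI)
    fix w assume w: "w \<in> clo ?I (big k J (Z t) t)"
    have wp: "w \<in> pts ?I" using w by (simp add: clo_def)
    have t: "0 < t" using w zero_less_one unfolding clo_def big_def by blast
    have "w \<in> {x \<in> pts ?I. \<forall>i\<in>?I. \<bar>x i\<bar> \<le> t}"
      using clo_least[OF cls_bounded[of ?I t], of "big k J (Z t) t"] w by (auto simp: big_def)
    moreover have "w(k := c) \<in> Z t" if c: "w k \<le> c" "t * (c - w k) \<le> 1" for c
    proof (rule clsD[OF closed_familyD(3)[OF Z]])
      show "w(k := c) \<in> pts ?I" using pts_upd[OF wp, of k c] by simp
      fix \<epsilon> :: 'a assume e: "\<epsilon> > 0"
      with w obtain v where v: "v \<in> big k J (Z t) t" "v \<in> cube ?I w \<epsilon>" unfolding clo_def by blast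
      \<comment> \<open>The interval is translated with its left end: the offset from the left end
        is kept, and the error in coordinate \<open>k\<close> is that between \<open>v\<close> and
        \<open>w\<close>.\<close>
      have "v(k := c + (v k - w k)) \<in> Z t"
        using v(1) c unfolding big_def by (simp add: algebra_simps)
      moreover have "v(k := c + (v k - w k)) \<in> cube ?I (w(k := c)) \<epsilon>"
        using v(2) pts_upd[of v ?I k] by (auto simp: cube_def)
      ultimately show "\<exists>y\<in>Z t. y \<in> cube ?I (w(k := c)) \<epsilon>" by blast
    qed
    ultimately show "w \<in> big k J (Z t) t" using t by (simp add: big_def)
  qed (auto simp: big_def)
qed

lemma bdd_big: "bdd (insert k J) (big k J Z t)"
  by (auto simp: bdd_def big_def)

text \<open>The conclusion is for all large \<open>t\<close>, so that a caller can also raise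
  \<open>t\<close> to the level of a family.\<close>

lemma not_thin_big:
  assumes J: "finite J" "k \<notin> J" and u: "u \<in> pts J" and nt: "\<not> thin {c. u(k := c) \<in> Z}"
  shows "\<exists>t0. \<forall>t\<ge>t0. u \<in> (\<lambda>x. restrict x J) ` big k J Z t"
proof -
  from nt obtain a b where ab: "a < b" "\<And>c. a < c \<Longrightarrow> c < b \<Longrightarrow> u(k := c) \<in> Z" unfolding thin_def by blast
  \<comment> \<open>\<open>big\<close> asks for a closed interval, so one is taken inside the open
    one.\<close>
  obtain a' where a': "a < a'" "a' < b" using dense[OF ab(1)] by blast
  obtain b' where b': "a' < b'" "b' < b" using dense[OF a'(2)] by blast
  define w where "w = u(k := a')"
  obtain r where r: "\<forall>i\<in>insert k J. \<bar>w i\<bar> \<le> r" using pts_bounded[of "insert k J" w] J by auto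
  define t0 where "t0 = max 1 (max r (inverse (b' - a')))"
  have "w \<in> big k J Z t" if t: "t0 \<le> t" for t
  proof -
    have t': "1 \<le> t" "r \<le> t" "inverse (b' - a') \<le> t" using t by (auto simp: t0_def)
    have "w(k := c) \<in> Z" if c: "a' \<le> c" "t * (c - a') \<le> 1" for c
    proof -
      have "inverse (b' - a') * (c - a') \<le> t * (c - a')" using t' c by (intro mult_right_mono) auto
      then have "inverse (b' - a') * (c - a') \<le> 1" using c by simp
      then have "c \<le> b'" using b'(1) by (simp add: field_simps)
      then show ?thesis using ab(2)[of c] a' b' c by (simp add: w_def)
    qed
    moreover have "0 < t" using t'(1) by (rule less_le_trans[OF zero_less_one])
    ultimately show ?thesis using r t'(2) u unfolding big_def
      by (auto simp: w_def intro: order_trans)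
  qed
  moreover have "restrict w J = u" using u J by (simp add: w_def)
  ultimately show ?thesis by (metis image_eqI)
qed

text \<open>The left ends \<open>a\<close> can be chosen within \<open>1/(4t)\<close> of a fixed \<open>s0\<close> on an open set: take for \<open>s0\<close> the
  infimum of those \<open>s\<close> for which the \<open>u\<close> with some \<open>a \<le> s\<close> fill an open set. There the
  fibres have a common subinterval.\<close>

lemma solid_of_solid_big:
  assumes J: "finite J" "k \<notin> J" and Z: "dset M (insert k J) Z" "cls (insert k J) Z"
    and B: "solid J ((\<lambda>x. restrict x J) ` big k J Z t)"
  shows "solid (insert k J) Z"
proof -
  let ?I = "insert k J" and ?pr = "\<lambda>x :: nat \<Rightarrow> 'a. restrict x J"
  define W where "W = big k J Z t"
  have fam: "closed_family ?I (\<lambda>t. big k J Z t)"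
    by (rule closed_family_big[OF J, of "\<lambda>_. Z"]) (use Z in \<open>auto simp: closed_family_def dset_fam mono_def\<close>)
  have I: "finite ?I" using J by simp
  have W: "dset M ?I W" "cls ?I W" "bdd ?I W"
    unfolding W_def by (auto intro: dfam_dset closed_familyD[OF fam] bdd_big)
  obtain u0 \<epsilon> where u0: "u0 \<in> pts J" "\<epsilon> > 0" "cube J u0 \<epsilon> \<subseteq> ?pr ` W"
    using B unfolding solid_def W_def by blast
  define V where "V = cube J u0 \<epsilon>"
  have V: "opn J V" "V \<noteq> {}" "V \<subseteq> ?pr ` W" "dset M J V"
    using u0 J cube_center[OF u0(1,2)] by (auto simp: V_def intro: opn_cube dset_cube)
  then have t: "t > 0" by (auto simp: W_def big_def)
  \<comment> \<open>Base points having a left end at most \<open>s\<close>; closed because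
    \<open>W\<close> is bounded.\<close>
  define D where "D s = ?pr ` (W \<inter> {x \<in> pts ?I. x k \<le> s})" for s
  have D_cls: "cls J (D s)" for s unfolding D_def
  proof (rule cls_projection)
    show "dset M ?I (W \<inter> {x \<in> pts ?I. x k \<le> s})"
      by (intro dset_Int W dsetI I dI)
    show "cls ?I (W \<inter> {x \<in> pts ?I. x k \<le> s})" by (intro cls_Int W cls_coord_le) simp
    show "bdd ?I (W \<inter> {x \<in> pts ?I. x k \<le> s})" using W(3) by (auto simp: bdd_def)
  qed auto
  \<comment> \<open>Spelled out as a first-order condition for definability; \<open>S_iff\<close>
    shows that it says that \<open>V \<inter> D s\<close> has interior.\<close>
  define S where "S = {s. \<exists>x\<in>pts J. \<exists>\<delta>. 0 < \<delta> \<and> (\<forall>y\<in>pts J. y \<in> cube J x \<delta> \<longrightarrow> y \<in> V \<and> (\<exists>w\<in>W. w k \<le> s \<and> (\<forall>j\<in>J. w j = y j)))}"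
  have D_iff: "y \<in> D s \<longleftrightarrow> (\<exists>w\<in>W. w k \<le> s \<and> (\<forall>j\<in>J. w j = y j))" if "y \<in> pts J" for y s
  proof
    assume "\<exists>w\<in>W. w k \<le> s \<and> (\<forall>j\<in>J. w j = y j)"
    then obtain w where w: "w \<in> W" "w k \<le> s" "\<forall>j\<in>J. w j = y j" by blast
    then have "restrict w J = y" using that by (intro pts_eqI[of _ J]) auto
    with w show "y \<in> D s" using W(1) by (auto simp: D_def dset_def)
  qed (auto simp: D_def)
  have S_iff: "s \<in> S \<longleftrightarrow> solid J (V \<inter> D s)" for s
  proof -
    have "(\<forall>y\<in>pts J. y \<in> cube J x \<delta> \<longrightarrow> y \<in> V \<and> (\<exists>w\<in>W. w k \<le> s \<and> (\<forall>j\<in>J. w j = y j))) \<longleftrightarrow>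
        cube J x \<delta> \<subseteq> V \<inter> D s" for x \<delta>
      using D_iff[of _ s] cube_subset_pts[of J x \<delta>] by (simp add: subset_iff) metis
    then show ?thesis unfolding S_def solid_def by simp
  qed
  have "dpred M (\<lambda>e. e 0 \<in> S)" unfolding S_def mem_Collect_eq
    by (intro dpred_conj dpred_imp dpred_ex_pts[OF J(1)] dpred_all_pts[OF J(1)] dpred_cube[OF J(1)] dpred_mem[OF V(4)]
        dpred_ex_mem[OF W(1)] dpred_ball_fin[OF J(1)] dI; simp)
  moreover have "t \<in> S"
  proof -
    have "x k \<le> t" "x \<in> pts ?I" if "x \<in> W" for x using that by (auto simp: W_def big_def abs_le_iff)
    then have "W \<inter> {x \<in> pts ?I. x k \<le> t} = W" by blast
    then have "V \<inter> D t = V" using V(3) by (auto simp: D_def)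
    then show ?thesis unfolding S_iff using opn_solid[OF V(1,2)] by simp
  qed
  moreover have "- t \<le> s" if "s \<in> S" for s
  proof -
    have "V \<inter> D s \<noteq> {}"
      using that cube_center unfolding S_iff solid_def by blast
    then obtain w where "w \<in> W" "w k \<le> s" by (auto simp: D_def)
    then have "- w k \<le> t" by (auto simp: W_def big_def abs_le_iff)
    with \<open>w k \<le> s\<close> show ?thesis by simp
  qed
  ultimately obtain s0 where s0: "\<forall>s\<in>S. s0 \<le> s" "\<And>c. (\<forall>s\<in>S. c \<le> s) \<Longrightarrow> c \<le> s0"
    using definable_glb[of S "- t"] by blast
  \<comment> \<open>The length \<open>1/t\<close> is \<open>4 * \<eta>\<close>. Left ends between
    \<open>s0 - \<eta>\<close> and \<open>s0 + \<eta>\<close> then force every interval to cover the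
    range from \<open>s0 + \<eta>\<close> to \<open>s0 + 3 * \<eta>\<close>.\<close>
  define \<eta> where "\<eta> = inverse (4 * t)"
  have \<eta>: "\<eta> > 0" "t * (4 * \<eta>) = 1" using t by (auto simp: \<eta>_def field_simps)
  obtain s1 where s1: "s1 \<in> S" "s1 < s0 + \<eta>" using s0(2)[of "s0 + \<eta>"] \<eta>(1) by force
  obtain V1 where V1: "opn J V1" "V1 \<noteq> {}" "V1 \<subseteq> V \<inter> D s1"
    using s1(1) solid_opn[OF J(1)] unfolding S_iff by blast
  \<comment> \<open>Below the infimum \<open>D\<close> has no interior in \<open>V\<close>, so
    \<open>V1\<close> can be shrunk off this closed set; this gives the lower bound for left
    ends.\<close>
  have "s0 - \<eta> \<notin> S" using s0(1) \<eta>(1) by force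
  then have "\<not> V1 \<subseteq> D (s0 - \<eta>)"
    using opn_solid[OF V1(1,2)] solid_mono[of J V1 "V \<inter> D (s0 - \<eta>)"] V1(3) unfolding S_iff by blast
  from shrink_off_closed[OF V1(1,2) D_cls this] obtain V2 where
    V2: "opn J V2" "V2 \<noteq> {}" "V2 \<subseteq> V1" "V2 \<inter> D (s0 - \<eta>) = {}" by blast
  show ?thesis
  proof (rule solid_cylinder[OF J V2(1,2)])
    show "s0 + \<eta> < s0 + 3 * \<eta>" using \<eta>(1) by simp
    fix u c assume u: "u \<in> V2" and c: "s0 + \<eta> < c" "c < s0 + 3 * \<eta>"
    have "u \<in> D s1" "u \<notin> D (s0 - \<eta>)" using u V2 V1 by auto
    then obtain w where w: "w \<in> W" "restrict w J = u" "w k \<le> s1" "s0 - \<eta> < w k"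
      unfolding D_def by force
    have "t * (c - w k) \<le> t * (4 * \<eta>)" using c w t by (intro mult_left_mono) auto
    then have "t * (c - w k) \<le> 1" using \<eta>(2) by simp
    moreover have "w k \<le> c" using w(3) s1(2) c(1) by simp
    ultimately have "w(k := c) \<in> Z" using w(1) by (auto simp: W_def big_def)
    moreover have "w(k := c) = u(k := c)"
      using w(1) J(2) unfolding w(2)[symmetric] W_def big_def
      by (intro pts_eqI[of _ "insert k J"]) (auto simp: pts_def PiE_def extensional_def)
    ultimately show "u(k := c) \<in> Z" by simp
  qed
qed

end

text \<open>Counterpart of \<open>constructible_in\<close> with definable open generators, so that
  an induction can also show these sets and their complements to be \<open>fsigma\<close>.\<close>

inductive bool_open for M :: "('f, 'r, 'a::linordered_field) fo_structure" and I :: "nat set" where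
  open_set: "dset M I U \<Longrightarrow> opn I U \<Longrightarrow> bool_open M I U"
| compl: "bool_open M I A \<Longrightarrow> bool_open M I (pts I - A)"
| union: "bool_open M I A \<Longrightarrow> bool_open M I B \<Longrightarrow> bool_open M I (A \<union> B)"
| inter: "bool_open M I A \<Longrightarrow> bool_open M I B \<Longrightarrow> bool_open M I (A \<inter> B)"

section \<open>Baire category in all finite dimensions\<close>

lemma pts_empty: "x \<in> pts {} \<longleftrightarrow> x = (\<lambda>_. undefined)"
  by (simp add: pts_def)

lemma solid_empty_index: "X \<subseteq> pts {} \<Longrightarrow> solid {} X \<longleftrightarrow> X \<noteq> {}"
proof
  assume "X \<subseteq> pts {}" "X \<noteq> {}"
  then have "cube {} (\<lambda>_. undefined) 1 \<subseteq> X" by (auto simp: cube_def pts_empty)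
  moreover have "(\<lambda>_. undefined) \<in> pts {}" by (simp add: pts_empty)
  ultimately show "solid {} X" unfolding solid_def using zero_less_one by blast
next
  assume "solid {} X"
  then show "X \<noteq> {}" unfolding solid_def using cube_center by blast
qed

context dc_structure
begin

text \<open>The Baire category theorem for definable increasing families of closed sets.\<close>

definition baire :: "nat set \<Rightarrow> bool" where
  "baire J \<longleftrightarrow> (\<forall>Y. closed_family J Y \<longrightarrow> solid J (\<Union>t. Y t) \<longrightarrow> (\<exists>t. solid J (Y t)))"

text \<open>Contrapositively, \<open>fsigma\<close> sets without interior are nowhere dense. This
  goes beyond Baire category and makes meager sets nowhere dense.\<close>

definition regular :: "nat set \<Rightarrow> bool" where
  "regular J \<longleftrightarrow> (\<forall>X. fsigma J X \<longrightarrow> solid J (clo J X) \<longrightarrow> solid J X)"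

lemma baireD: "baire J \<Longrightarrow> closed_family J Y \<Longrightarrow> solid J (\<Union>t. Y t) \<Longrightarrow> \<exists>t. solid J (Y t)"
  unfolding baire_def by blast

lemma regularD: "regular J \<Longrightarrow> fsigma J X \<Longrightarrow> solid J (clo J X) \<Longrightarrow> solid J X"
  unfolding regular_def by blast

lemma dset_subcube:
  assumes J: "finite J" and V: "opn J V" "V \<noteq> {}"
  shows "\<exists>W. opn J W \<and> W \<noteq> {} \<and> W \<subseteq> V \<and> dset M J W"
proof -
  obtain x \<epsilon> where x: "x \<in> V" "\<epsilon> > 0" "cube J x \<epsilon> \<subseteq> V" using V unfolding opn_def by blast
  have "x \<in> pts J" using x V by (auto simp: opn_def)
  then show ?thesis
    using x J cube_center[of x J \<epsilon>] by (intro exI[of _ "cube J x \<epsilon>"]) (auto intro: opn_cube dset_cube)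
qed

lemma closed_family_clo:
  assumes A: "dfam M J A" "mono A" shows "closed_family J (\<lambda>t. clo J (A t))"
  unfolding closed_family_def
proof (intro conjI allI)
  have Jf: "finite J" using A(1) by (simp add: dfam_def)
  have "clo J (A t) = {u \<in> pts J. \<forall>\<epsilon>. 0 < \<epsilon> \<longrightarrow> (\<exists>y\<in>A t. y \<in> cube J u \<epsilon>)}" for t
    by (auto simp: clo_def)
  moreover have "dfam M J (\<lambda>t. {u \<in> pts J. \<forall>\<epsilon>. 0 < \<epsilon> \<longrightarrow> (\<exists>y\<in>A t. y \<in> cube J u \<epsilon>)})"
    by (rule dfamI[OF Jf]) (intro dpred_ex_fam[OF A(1)] dpred_cube[OF Jf] dI; (rule restrict_in_pts)?)
  ultimately show "dfam M J (\<lambda>t. clo J (A t))" by simp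
  show "mono (\<lambda>t. clo J (A t))"
    using A(2) by (intro monoI clo_mono) (rule monoD)
  show "cls J (clo J (A t))" for t by (rule cls_clo[OF Jf])
qed

text \<open>Over \<open>V\<close> the definable sets \<open>A t\<close> of points whose fibre already lies in \<open>Y t\<close> increase
  to \<open>V\<close>, so some \<open>A t\<close> is dense in an open set; the projection of \<open>X - Y t\<close>, being \<open>F\<^sub>\<sigma>\<close> and
  disjoint from \<open>A t\<close>, is nowhere dense there.\<close>

lemma stationary_over_open_set:
  assumes J: "baire J" "regular J" "J \<subseteq> I"
    and Y: "closed_family I Y" "X = (\<Union>t. Y t)"
    and V: "opn J V" "V \<noteq> {}" and fin: "\<And>u. u \<in> V \<Longrightarrow> pfin I {x \<in> X. restrict x J = u}"
  shows "\<exists>t W. opn J W \<and> W \<noteq> {} \<and> W \<subseteq> V \<and> {x \<in> X. restrict x J \<in> W} \<subseteq> Y t"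
proof -
  have I: "finite I" using closed_familyD(4)[OF Y(1)] .
  have Jf: "finite J" using I J(3) by (rule rev_finite_subset)
  have X: "fsigma I X" using Y unfolding fsigma_def by blast
  note Xd = fsigma_dset[OF X]
  obtain V0 where V0: "opn J V0" "V0 \<noteq> {}" "V0 \<subseteq> V" "dset M J V0" using dset_subcube[OF Jf V] by blast
  define A where "A t = {u \<in> pts J. u \<in> V0 \<and> (\<forall>x\<in>X. (\<forall>j\<in>J. x j = u j) \<longrightarrow> x \<in> Y t)}" for t
  have A_iff: "u \<in> A t \<longleftrightarrow> u \<in> V0 \<and> (\<forall>x\<in>X. restrict x J = u \<longrightarrow> x \<in> Y t)" for u t
  proof -
    have "V0 \<subseteq> pts J" using V0(1) by (simp add: opn_def)
    moreover have "(\<forall>j\<in>J. x j = u j) \<longleftrightarrow> restrict x J = u" if "u \<in> pts J" for x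
      using that by (metis pts_eqI restrict_apply restrict_in_pts)
    ultimately show ?thesis by (auto simp: A_def)
  qed
  have A: "dfam M J A" unfolding A_def
    by (rule dfamI[OF Jf]) (intro dpred_conj dpred_imp dpred_all_mem[OF Xd] dpred_mem[OF V0(4)]
        dpred_fam[OF closed_familyD(1)[OF Y(1)]] dpred_ball_fin[OF Jf] dI; (rule restrict_in_pts)?)
  have "mono A"
  proof (rule monoI, rule subsetI)
    fix s t u assume "s \<le> t" "u \<in> A s"
    with closed_familyD(6)[OF Y(1), of s t] show "u \<in> A t" unfolding A_iff by blast
  qed
  then have cA: "closed_family J (\<lambda>t. clo J (A t))" by (rule closed_family_clo[OF A])
  have "V0 \<subseteq> (\<Union>t. A t)"
  proof
    fix u assume u: "u \<in> V0"
    \<comment> \<open>Compactness of the fibre: being pseudo-finite, it lies in a single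
      level.\<close>
    have "\<exists>t. {x \<in> X. restrict x J = u} \<subseteq> Y t"
      by (rule pfin_cover[OF fin closed_familyD(1,2)[OF Y(1)]]) (use u V0 Y in auto)
    with u show "u \<in> (\<Union>t. A t)" by (auto simp: A_iff)
  qed
  moreover have "A t \<subseteq> clo J (A t)" for t by (rule clo_subset) (auto simp: A_def)
  ultimately have "V0 \<subseteq> (\<Union>t. clo J (A t))" by blast
  then have "solid J (\<Union>t. clo J (A t))" using opn_solid[OF V0(1,2)] solid_mono by blast
  from baireD[OF J(1) cA this] obtain t where t: "solid J (clo J (A t))" by blast
  then obtain V1 where V1: "opn J V1" "V1 \<noteq> {}" "V1 \<subseteq> clo J (A t)" using solid_opn[OF Jf] by blast
  \<comment> \<open>\<open>V1\<close> is only known to lie in the closure of \<open>V0\<close>, so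
    it is intersected with \<open>V0\<close> before it is made definable.\<close>
  then have "V1 \<inter> A t \<noteq> {}" using opn_meets_clo[OF V1(1)] by blast
  then have "V1 \<inter> V0 \<noteq> {}" by (auto simp: A_iff)
  from dset_subcube[OF Jf opn_Int[OF V1(1) V0(1)] this] obtain V2 where
    V2: "opn J V2" "V2 \<noteq> {}" "V2 \<subseteq> V1 \<inter> V0" "dset M J V2" by blast
  define E where "E = (\<lambda>x. restrict x J) ` (X \<inter> (pts I - Y t))"
  have "fsigma I (pts I - Y t)"
    using closed_familyD(3)[OF Y(1)] dfam_dset[OF closed_familyD(1)[OF Y(1)]]
    by (intro fsigma_opn dset_Diff dset_pts I opn_compl)
  then have "fsigma I (X \<inter> (pts I - Y t))" by (rule fsigma_Int[OF X])
  then have E: "fsigma J (E \<inter> V2)" unfolding E_def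
    using fsigma_projection J(3) fsigma_opn[OF V2(4,1)] by (intro fsigma_Int)
  have "\<not> solid J (E \<inter> V2)"
  proof
    assume "solid J (E \<inter> V2)"
    then obtain G where G: "opn J G" "G \<noteq> {}" "G \<subseteq> E \<inter> V2" using solid_opn[OF Jf] by blast
    then have "G \<inter> A t \<noteq> {}" using opn_meets_clo[OF G(1)] V2 V1 by blast
    then show False using G(3) by (auto simp: A_iff E_def)
  qed
  then have "\<not> solid J (clo J (E \<inter> V2))" using regularD[OF J(2) E] by blast
  then have "\<not> V2 \<subseteq> clo J (E \<inter> V2)" using opn_solid[OF V2(1,2)] solid_mono by blast
  from shrink_off_closed[OF V2(1,2) cls_clo[OF Jf] this] obtain W where
    W: "opn J W" "W \<noteq> {}" "W \<subseteq> V2" "W \<inter> clo J (E \<inter> V2) = {}" by blast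
  have "E \<inter> V2 \<subseteq> clo J (E \<inter> V2)" by (rule clo_subset) (auto simp: E_def)
  then have "W \<inter> E = {}" using W by blast
  moreover have "X \<subseteq> pts I" using Xd by (simp add: dset_def)
  ultimately have "{x \<in> X. restrict x J \<in> W} \<subseteq> Y t" by (auto simp: E_def)
  then show ?thesis using W V2 V0 by blast
qed

lemma closed_family_big_projection:
  assumes J: "finite J" "k \<notin> J" and Z: "closed_family (insert k J) Z"
  shows "closed_family J (\<lambda>t. (\<lambda>x. restrict x J) ` big k J (Z t) t)"
  by (rule closed_family_projection[OF closed_family_big[OF J Z]]) (auto intro: bdd_big)

lemma dpred_fibre:
  assumes Z: "dfam M (insert k J) Z" and u: "u \<in> pts J"
  shows "dpred M (\<lambda>e. e 1 \<in> {c. u(k := c) \<in> Z (e 0)})"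
  unfolding mem_Collect_eq by (intro dpred_fam[OF Z] dI pts_upd u)

end

context tame_structure
begin

text \<open>Outside the projections of \<open>big\<close>, the fibre of each level is thin; being
  closed as well, these fibres have a pseudo-finite union by \<open>union_thin_pfin\<close>.\<close>

lemma pfin_fibre_of_not_big:
  assumes J: "finite J" "k \<notin> J" and Z: "closed_family (insert k J) Z" and u: "u \<in> pts J"
    and nb: "u \<notin> (\<Union>t. (\<lambda>x. restrict x J) ` big k J (Z t) t)"
  shows "pfin {0} (line {c. u(k := c) \<in> (\<Union>t. Z t)})"
proof -
  have "thin {c. u(k := c) \<in> Z s}" for s
  proof (rule ccontr)
    assume "\<not> thin {c. u(k := c) \<in> Z s}"
    from not_thin_big[OF J u this] obtain t0 where
      t0: "\<And>t. t \<ge> t0 \<Longrightarrow> u \<in> (\<lambda>x. restrict x J) ` big k J (Z s) t" by blast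
    \<comment> \<open>The family uses \<open>t\<close> both as level and as size; passing to the
      maximum aligns the fixed level \<open>s\<close> with a large size.\<close>
    have "big k J (Z s) (max s t0) \<subseteq> big k J (Z (max s t0)) (max s t0)"
      using closed_familyD(6)[OF Z, of s "max s t0"] by (auto simp: big_def)
    with t0[of "max s t0"] nb show False by auto
  qed
  then have "pfin {0} (line (\<Union>t. {c. u(k := c) \<in> Z t}))"
    using closed_familyD(6)[OF Z]
    by (intro union_thin_pfin dpred_fibre[OF closed_familyD(1)[OF Z] u] cls_fibre[OF J(2) closed_familyD(3)[OF Z] u])
      (auto simp: mono_def)
  moreover have "(\<Union>t. {c. u(k := c) \<in> Z t}) = {c. u(k := c) \<in> (\<Union>t. Z t)}" by auto
  ultimately show ?thesis by simp
qed

text \<open>Over an open set \<open>V\<close> all fibres contain an interval, so the closed sets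
  \<open>B t\<close> cover \<open>V\<close>. The Baire property below gives some \<open>B t\<close>
  interior, and \<open>solid_of_solid_big\<close> lifts this to \<open>Z t\<close>.\<close>

lemma baire_insert:
  assumes J: "finite J" "k \<notin> J" "baire J" shows "baire (insert k J)"
  unfolding baire_def
proof (intro allI impI)
  fix Z assume Z: "closed_family (insert k J) Z" and s: "solid (insert k J) (\<Union>t. Z t)"
  define B where "B t = (\<lambda>x. restrict x J) ` big k J (Z t) t" for t
  have B: "closed_family J B" unfolding B_def by (rule closed_family_big_projection[OF J(1,2) Z])
  from solid_insertE[OF J(1,2) s] obtain V a b where
    V: "opn J V" "V \<noteq> {}" "a < b" "\<And>u c. u \<in> V \<Longrightarrow> a < c \<Longrightarrow> c < b \<Longrightarrow> u(k := c) \<in> (\<Union>t. Z t)" by blast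
  have "V \<subseteq> (\<Union>t. B t)"
  proof
    fix u assume u: "u \<in> V"
    then have up: "u \<in> pts J" using V(1) by (auto simp: opn_def)
    show "u \<in> (\<Union>t. B t)"
    proof (rule ccontr)
      assume "u \<notin> (\<Union>t. B t)"
      then have "pfin {0} (line {c. u(k := c) \<in> (\<Union>t. Z t)})"
        unfolding B_def by (rule pfin_fibre_of_not_big[OF J(1,2) Z up])
      then have "thin {c. u(k := c) \<in> (\<Union>t. Z t)}" using isolated_thin by (simp add: pfin_def)
      with V(3) V(4)[OF u] show False unfolding thin_def by blast
    qed
  qed
  then have "solid J (\<Union>t. B t)" using opn_solid[OF V(1,2)] solid_mono by blast
  from baireD[OF J(3) B this] obtain t where "solid J (B t)" by blast
  then have "solid (insert k J) (Z t)" unfolding B_def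
    by (rule solid_of_solid_big[OF J(1,2) dfam_dset[OF closed_familyD(1)[OF Z]] closed_familyD(3)[OF Z]])
  then show "\<exists>t. solid (insert k J) (Z t)" by blast
qed

lemma baire_finite: "finite J \<Longrightarrow> baire J"
proof (induction J rule: finite_induct)
  case empty
  show ?case unfolding baire_def
  proof (intro allI impI)
    fix Y :: "'a \<Rightarrow> (nat \<Rightarrow> 'a) set"
    assume Y: "closed_family {} Y" "solid {} (\<Union>t. Y t)"
    then have "(\<Union>t. Y t) \<noteq> {}" using solid_empty_index[of "\<Union>t. Y t"] closed_familyD(5)[OF Y(1)] by blast
    then show "\<exists>t. solid {} (Y t)" using solid_empty_index closed_familyD(5)[OF Y(1)] by blast
  qed
qed (rule baire_insert)

text \<open>No \<open>B t\<close> has interior, since otherwise \<open>X\<close> would. By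
  \<open>baire\<close> and then \<open>regular\<close> their union is nowhere dense, and base points
  avoiding its closure have pseudo-finite fibres.\<close>

lemma generic_fibre_pfin:
  assumes J: "finite J" "k \<notin> J" "regular J"
    and X: "fsigma (insert k J) X" "\<not> solid (insert k J) X" and V: "opn J V" "V \<noteq> {}"
  shows "\<exists>W. opn J W \<and> W \<noteq> {} \<and> W \<subseteq> V \<and> (\<forall>u\<in>W. pfin {0} (line {c. u(k := c) \<in> X}))"
proof -
  from X(1) obtain Z where Z: "closed_family (insert k J) Z" "X = (\<Union>t. Z t)" unfolding fsigma_def by blast
  define B where "B t = (\<lambda>x. restrict x J) ` big k J (Z t) t" for t
  have B: "closed_family J B" unfolding B_def by (rule closed_family_big_projection[OF J(1,2) Z(1)])
  have "\<not> solid J (B t)" for t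
    using solid_of_solid_big[OF J(1,2) dfam_dset[OF closed_familyD(1)[OF Z(1)]] closed_familyD(3)[OF Z(1)]]
      X(2) solid_mono[of "insert k J" "Z t" X] Z(2) unfolding B_def by blast
  then have "\<not> solid J (\<Union>t. B t)" using baireD[OF baire_finite[OF J(1)] B] by blast
  moreover have "fsigma J (\<Union>t. B t)" using B unfolding fsigma_def by blast
  ultimately have "\<not> solid J (clo J (\<Union>t. B t))" using regularD[OF J(3)] by blast
  then have "\<not> V \<subseteq> clo J (\<Union>t. B t)" using opn_solid[OF V] solid_mono by blast
  from shrink_off_closed[OF V cls_clo[OF J(1)] this] obtain W where
    W: "opn J W" "W \<noteq> {}" "W \<subseteq> V" "W \<inter> clo J (\<Union>t. B t) = {}" by blast
  have "(\<Union>t. B t) \<subseteq> clo J (\<Union>t. B t)" by (rule clo_subset) (use closed_familyD(5)[OF B] in blast)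
  then have WB: "W \<inter> (\<Union>t. B t) = {}" using W by blast
  have "pfin {0} (line {c. u(k := c) \<in> X})" if u: "u \<in> W" for u
    using pfin_fibre_of_not_big[OF J(1,2) Z(1), of u] WB u W(1) unfolding B_def Z(2) by (auto simp: opn_def)
  with W show ?thesis by blast
qed

text \<open>On the fibre over \<open>u\<close> the coordinates in \<open>J\<close> are constant, and
  each other coordinate \<open>k\<close> takes values in the fibre over \<open>u\<close> of the
  projection to \<open>insert k J\<close>.\<close>

lemma fibre_pfin_of_coordinates:
  assumes X: "dset M I X" and J: "J \<subseteq> I"
    and pr: "\<And>k. k \<in> I - J \<Longrightarrow> pfin {0} (line {c. u(k := c) \<in> (\<lambda>x. restrict x (insert k J)) ` X})"
    and u: "u \<in> pts J"
  shows "pfin I {x \<in> X. restrict x J = u}"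
proof -
  have I: "finite I" "X \<subseteq> pts I" using X by (auto simp: dset_def)
  have Jf: "finite J" using I(1) J by (metis finite_subset)
  let ?F = "{x \<in> X. restrict x J = u}"
  have Fd: "dset M I ?F"
  proof -
    have "?F = {x \<in> pts I. x \<in> X \<and> (\<forall>j\<in>J. x j = u j)}"
      using I(2) u by (auto intro!: pts_eqI[of _ J])
    also have "dset M I \<dots>"
      by (rule dsetI[OF I(1)]) (intro dpred_conj dpred_mem[OF X] dpred_ball_fin[OF Jf] dI restrict_in_pts)
    finally show ?thesis .
  qed
  show ?thesis
  proof (rule pfin_coordinates[OF Fd])
    fix i assume i: "i \<in> I"
    have d: "dset M {0} (line ((\<lambda>x. x i) ` ?F))"
    proof -
      have "dpred M (\<lambda>e. \<exists>x\<in>?F. e 0 = x i)" by (intro dpred_ex_mem[OF Fd] dI)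
      then show ?thesis by (simp add: dset_line image_iff)
    qed
    show "pfin {0} (line ((\<lambda>x. x i) ` ?F))"
    proof (cases "i \<in> J")
      case True
      have sub: "(\<lambda>x. x i) ` ?F \<subseteq> {u i}" using True by auto
      have "\<exists>\<epsilon>>0. \<forall>b\<in>{u i}. \<bar>b - a\<bar> < \<epsilon> \<longrightarrow> b = a" for a
        by (cases "u i = a") (auto intro: exI[of _ 1] exI[of _ "\<bar>u i - a\<bar>"])
      then have "isolated {0} (line {u i})" unfolding isolated_line by blast
      then have "isolated {0} (line ((\<lambda>x. x i) ` ?F))"
        by (rule isolated_subset) (use sub in \<open>auto simp: line_def\<close>)
      moreover have "bdd {0} (line ((\<lambda>x. x i) ` ?F))"
        unfolding bdd_line using sub by (intro exI[of _ "\<bar>u i\<bar>"]) auto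
      ultimately show ?thesis using d by (simp add: pfin_def)
    next
      case False
      have "(\<lambda>x. x i) ` ?F \<subseteq> {c. u(i := c) \<in> (\<lambda>x. restrict x (insert i J)) ` X}"
      proof
        fix c assume "c \<in> (\<lambda>x. x i) ` ?F"
        then obtain x where x: "x \<in> X" "restrict x J = u" "c = x i" by blast
        have "u(i := c) = restrict x (insert i J)"
          using x u by (intro pts_eqI[of _ "insert i J"]) auto
        with x(1) show "c \<in> {c. u(i := c) \<in> (\<lambda>x. restrict x (insert i J)) ` X}" by blast
      qed
      then show ?thesis
        by (intro pfin_subset[OF pr d]) (use i False in \<open>auto simp: line_def\<close>)
    qed
  qed
qed

text \<open>Suppose \<open>X\<close> is dense in \<open>V\<close> times an interval but has no
  interior. Generic fibres are pseudo-finite, so over a smaller open set \<open>U\<close> all of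
  \<open>X\<close> lies in one closed level \<open>Z t\<close>. By density \<open>Z t\<close>
  contains \<open>U\<close> times the interval, a contradiction.\<close>

lemma regular_insert:
  assumes J: "finite J" "k \<notin> J" "regular J" shows "regular (insert k J)"
  unfolding regular_def
proof (intro allI impI, rule ccontr)
  fix X assume X: "fsigma (insert k J) X" and s: "solid (insert k J) (clo (insert k J) X)"
    and ns: "\<not> solid (insert k J) X"
  from X obtain Z where Z: "closed_family (insert k J) Z" "X = (\<Union>t. Z t)" unfolding fsigma_def by blast
  from solid_insertE[OF J(1,2) s] obtain V a b where
    V: "opn J V" "V \<noteq> {}" "a < b" "\<And>u c. u \<in> V \<Longrightarrow> a < c \<Longrightarrow> c < b \<Longrightarrow> u(k := c) \<in> clo (insert k J) X" by blast
  from generic_fibre_pfin[OF J X ns V(1,2)] obtain W where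
    W: "opn J W" "W \<noteq> {}" "W \<subseteq> V" "\<And>u. u \<in> W \<Longrightarrow> pfin {0} (line {c. u(k := c) \<in> X})" by blast
  have Xd: "dset M (insert k J) X" "X \<subseteq> pts (insert k J)" using fsigma_dset[OF X] by (auto simp: dset_def)
  have "pfin (insert k J) {x \<in> X. restrict x J = u}" if "u \<in> W" for u
  proof (rule fibre_pfin_of_coordinates[OF Xd(1)])
    fix i assume "i \<in> insert k J - J"
    then have "i = k" by auto
    moreover have "(\<lambda>x. restrict x (insert k J)) ` X = id ` X"
      by (rule image_cong) (use Xd(2) in auto)
    ultimately show "pfin {0} (line {c. u(i := c) \<in> (\<lambda>x. restrict x (insert i J)) ` X})"
      using W(4)[OF that] by (simp only: image_id id_apply)
  qed (use that W(1) in \<open>auto simp: opn_def\<close>)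
  from stationary_over_open_set[OF baire_finite[OF J(1)] J(3) _ Z W(1,2) this] obtain t U where
    U: "opn J U" "U \<noteq> {}" "U \<subseteq> W" "{x \<in> X. restrict x J \<in> U} \<subseteq> Z t" by blast
  have "u(k := c) \<in> Z t" if u: "u \<in> U" and c: "a < c" "c < b" for u c
  proof (rule clsD[OF closed_familyD(3)[OF Z(1)]])
    have up: "u \<in> pts J" using u U(1) by (auto simp: opn_def)
    then show "u(k := c) \<in> pts (insert k J)" by simp
    fix \<epsilon> :: 'a assume e: "\<epsilon> > 0"
    obtain \<delta> where d: "\<delta> > 0" "cube J u \<delta> \<subseteq> U" using U(1) u unfolding opn_def by blast
    have "u(k := c) \<in> clo (insert k J) X" using V(4) u c U(3) W(3) by blast
    moreover have "min \<epsilon> \<delta> > 0" using e d(1) by simp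
    ultimately obtain y where y: "y \<in> X" "y \<in> cube (insert k J) (u(k := c)) (min \<epsilon> \<delta>)"
      unfolding clo_def by blast
    have "restrict y J \<in> cube J u \<delta>"
      using cube_restrict(1)[of J "insert k J" y "u(k := c)" \<delta>] y(2) up J(2) cube_mono[of "min \<epsilon> \<delta>" \<delta>] by auto
    then have "y \<in> Z t" using d(2) U(4) y(1) by blast
    moreover have "y \<in> cube (insert k J) (u(k := c)) \<epsilon>" using y(2) cube_mono[of "min \<epsilon> \<delta>" \<epsilon>] by auto
    ultimately show "\<exists>y\<in>Z t. y \<in> cube (insert k J) (u(k := c)) \<epsilon>" by blast
  qed
  then have "solid (insert k J) (Z t)" by (rule solid_cylinder[OF J(1,2) U(1,2) V(3)])
  with ns Z(2) show False using solid_mono[of "insert k J" "Z t" X] by blast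
qed

lemma regular_finite: "finite J \<Longrightarrow> regular J"
proof (induction J rule: finite_induct)
  case empty
  show ?case unfolding regular_def
  proof (intro allI impI)
    fix X :: "(nat \<Rightarrow> 'a) set"
    assume X: "fsigma {} X" "solid {} (clo {} X)"
    then have "clo {} X \<noteq> {}" using solid_empty_index[of "clo {} X"] by (auto simp: clo_def)
    then have "X \<noteq> {}" using zero_less_one unfolding clo_def by blast
    then show "solid {} X" using solid_empty_index fsigma_finite[OF X(1)] by blast
  qed
qed (rule regular_insert)

section \<open>Constructibility of \<open>F\<^sub>\<sigma>\<close> sets\<close>

text \<open>The points at which \<open>X\<close> is not locally closed form a set of smaller dimension, where the
  dimension is the largest size of a set \<open>J\<close> of coordinates such that the projection of \<open>X\<close> to them has
  interior.\<close>

lemma frontier_dimension: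
  assumes X: "fsigma I X" and J: "J \<subseteq> I"
    and small: "\<And>k. k \<in> I - J \<Longrightarrow> \<not> solid (insert k J) ((\<lambda>x. restrict x (insert k J)) ` X)"
  shows "\<not> solid J ((\<lambda>x. restrict x J) ` (X \<inter> clo I (clo I X - X)))"
proof
  assume "solid J ((\<lambda>x. restrict x J) ` (X \<inter> clo I (clo I X - X)))"
  have I: "finite I" "X \<subseteq> pts I" using fsigma_finite[OF X] by auto
  have Jf: "finite J" using I(1) J by (metis finite_subset)
  obtain V where V: "opn J V" "V \<noteq> {}" "V \<subseteq> (\<lambda>x. restrict x J) ` (X \<inter> clo I (clo I X - X))"
    using solid_opn[OF Jf \<open>solid J _\<close>] by blast
  \<comment> \<open>The coordinates outside \<open>J\<close> are treated one after another, each
    time shrinking the open set of base points.\<close>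
  have "\<exists>W. opn J W \<and> W \<noteq> {} \<and> W \<subseteq> V \<and>
      (\<forall>u\<in>W. \<forall>k\<in>K. pfin {0} (line {c. u(k := c) \<in> (\<lambda>x. restrict x (insert k J)) ` X}))"
    if "finite K" "K \<subseteq> I - J" for K
    using that
  proof (induction K)
    case empty
    then show ?case using V by blast
  next
    case (insert k K)
    then obtain W where W: "opn J W" "W \<noteq> {}" "W \<subseteq> V"
      "\<forall>u\<in>W. \<forall>k\<in>K. pfin {0} (line {c. u(k := c) \<in> (\<lambda>x. restrict x (insert k J)) ` X})" by blast
    have "insert k J \<subseteq> I" "k \<notin> J" using insert.prems J by auto
    from generic_fibre_pfin[OF Jf this(2) regular_finite[OF Jf] fsigma_projection[OF X this(1)] small W(1,2)]
    obtain W' where "opn J W'" "W' \<noteq> {}" "W' \<subseteq> W"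
      "\<forall>u\<in>W'. pfin {0} (line {c. u(k := c) \<in> (\<lambda>x. restrict x (insert k J)) ` X})"
      using insert.prems by blast
    with W show ?case by (intro exI[of _ W']) blast
  qed
  from this[of "I - J"] I(1) obtain W where W: "opn J W" "W \<noteq> {}" "W \<subseteq> V"
      "\<And>u k. u \<in> W \<Longrightarrow> k \<in> I - J \<Longrightarrow> pfin {0} (line {c. u(k := c) \<in> (\<lambda>x. restrict x (insert k J)) ` X})"
    by blast
  have "pfin I {x \<in> X. restrict x J = u}" if "u \<in> W" for u
    by (rule fibre_pfin_of_coordinates[OF fsigma_dset[OF X] J W(4)[OF that]]) (use that W(1) in \<open>auto simp: opn_def\<close>)
  moreover from X obtain Y where Y: "closed_family I Y" "X = (\<Union>t. Y t)" unfolding fsigma_def by blast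
  ultimately obtain t U where U: "opn J U" "U \<noteq> {}" "U \<subseteq> W" "{x \<in> X. restrict x J \<in> U} \<subseteq> Y t"
    using stationary_over_open_set[OF baire_finite[OF Jf] regular_finite[OF Jf] J Y W(1,2)] by blast
  obtain u where "u \<in> U" using U(2) by blast
  then obtain x where x: "x \<in> clo I (clo I X - X)" "restrict x J \<in> U" using U(3) W(3) V(3) by blast
  \<comment> \<open>Over \<open>U\<close> the set \<open>X\<close> lies in the closed level
    \<open>Y t\<close>, itself a subset of \<open>X\<close>. So the open cylinder \<open>G\<close>
    cannot contain a point of \<open>clo I X - X\<close>, although \<open>x\<close> is a limit of
    such points.\<close>
  define G where "G = {x \<in> pts I. restrict x J \<in> U}"
  have G: "opn I G" unfolding G_def by (rule opn_vimage_restrict[OF J U(1)])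
  have "x \<in> G" using x by (auto simp: G_def clo_def)
  from opn_meets_clo[OF G this x(1)] obtain y where y: "y \<in> G" "y \<in> clo I X" "y \<notin> X" by blast
  have "y \<in> Y t"
  proof (rule clsD[OF closed_familyD(3)[OF Y(1)]])
    show "y \<in> pts I" using y(1) by (simp add: G_def)
    fix \<epsilon> :: 'a assume e: "\<epsilon> > 0"
    have "y \<in> G \<inter> cube I y \<epsilon>" using y(1) cube_center[OF \<open>y \<in> pts I\<close> e] by blast
    from opn_meets_clo[OF opn_Int[OF G opn_cube[OF I(1)]] this y(2)]
    obtain z where z: "z \<in> G" "z \<in> cube I y \<epsilon>" "z \<in> X" by blast
    with U(4) have "z \<in> Y t" by (auto simp: G_def)
    with z show "\<exists>z\<in>Y t. z \<in> cube I y \<epsilon>" by blast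
  qed
  with Y(2) y(3) show False by blast
qed

text \<open>Induction on a strict upper bound \<open>d\<close> of the dimension: outside the closed
  set \<open>F\<close> the set \<open>X\<close> coincides with its closure, and
  \<open>X \<inter> F\<close> has smaller dimension by \<open>frontier_dimension\<close>.\<close>

lemma fsigma_bool_open_aux:
  assumes "fsigma I X" "\<And>J. J \<subseteq> I \<Longrightarrow> d \<le> card J \<Longrightarrow> \<not> solid J ((\<lambda>x. restrict x J) ` X)"
  shows "bool_open M I X"
  using assms
proof (induction d arbitrary: X)
  case 0
  \<comment> \<open>For \<open>d = 0\<close> even the projection to no coordinates lacks interior,
    which means that it is empty.\<close>
  have "\<not> solid {} ((\<lambda>x. restrict x {}) ` X)" by (rule 0(2)) auto
  moreover have "(\<lambda>x. restrict x {}) ` X \<subseteq> pts {}" by (auto simp: pts_empty restrict_def)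
  ultimately have "X = {}" using solid_empty_index[of "(\<lambda>x. restrict x {}) ` X"] by blast
  moreover have "bool_open M I {}"
    using fsigma_finite[OF 0(1)] by (intro open_set) (auto simp: dset_def opn_def dpred_const)
  ultimately show ?case by simp
next
  case (Suc d)
  note X = Suc.prems(1)
  have I: "finite I" "X \<subseteq> pts I" using fsigma_finite[OF X] by auto
  have Xd: "dset M I X" using fsigma_dset[OF X] .
  define F where "F = clo I (clo I X - X)"
  have F: "dset M I F" "cls I F" unfolding F_def by (intro dset_clo dset_Diff Xd cls_clo I)+
  have "bool_open M I (X \<inter> F)"
  proof (rule Suc.IH)
    show "fsigma I (X \<inter> F)" by (intro fsigma_Int X fsigma_cls F)
    fix J assume J: "J \<subseteq> I" "d \<le> card J"
    show "\<not> solid J ((\<lambda>x. restrict x J) ` (X \<inter> F))" unfolding F_def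
    proof (rule frontier_dimension[OF X J(1)])
      fix k assume k: "k \<in> I - J"
      have "card (insert k J) = Suc (card J)"
        using k finite_subset[OF J(1) I(1)] by (intro card_insert_disjoint) auto
      then show "\<not> solid (insert k J) ((\<lambda>x. restrict x (insert k J)) ` X)"
        using k J by (intro Suc.prems(2)) auto
    qed
  qed
  moreover have bc: "bool_open M I C" if "dset M I C" "cls I C" for C
  proof -
    have "bool_open M I (pts I - (pts I - C))"
      using that I by (intro compl open_set dset_Diff dset_pts opn_compl)
    moreover have "pts I - (pts I - C) = C" using that(2) by (auto simp: cls_def)
    ultimately show ?thesis by simp
  qed
  have "bool_open M I (clo I X \<inter> (pts I - F))"
    by (intro inter compl bc dset_clo Xd cls_clo I F)
  moreover have "X = (clo I X \<inter> (pts I - F)) \<union> (X \<inter> F)"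
  proof -
    have "clo I X - X \<subseteq> F" unfolding F_def by (rule clo_subset) (auto simp: clo_def)
    then show ?thesis using clo_subset[OF I(2)] I(2) by blast
  qed
  ultimately show ?case using union by metis
qed

lemma fsigma_bool_open: "fsigma I X \<Longrightarrow> bool_open M I X"
proof (rule fsigma_bool_open_aux[of I X "Suc (card I)"])
  fix J assume X: "fsigma I X" and J: "J \<subseteq> I" "Suc (card I) \<le> card J"
  have "card J \<le> card I" using fsigma_finite[OF X] J(1) by (intro card_mono) auto
  with J(2) show "\<not> solid J ((\<lambda>x. restrict x J) ` X)" by simp
qed

lemma bool_open_fsigma: "bool_open M I X \<Longrightarrow> fsigma I X \<and> fsigma I (pts I - X)"
proof (induction rule: bool_open.induct)
  case (open_set U)
  then have "finite I" by (simp add: dset_def)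
  with open_set show ?case by (auto intro: fsigma_opn fsigma_cls cls_compl dset_Diff dset_pts)
next
  case (compl A)
  then have "pts I - (pts I - A) = A" using fsigma_finite[of I A] by blast
  with compl show ?case by simp
next
  case (union A B)
  then show ?case by (simp add: fsigma_Un Diff_Un fsigma_Int)
next
  case (inter A B)
  then show ?case by (simp add: fsigma_Un Diff_Int fsigma_Int)
qed

text \<open>The closures of the levels form an \<open>fsigma\<close> set. If it were dense
  somewhere, \<open>regular\<close> would give it interior, and \<open>baire\<close> would give
  interior to one closure.\<close>

lemma meager_nowhere_dense:
  assumes Y: "dfam M I Y" "mono Y" "\<And>t. \<not> solid I (clo I (Y t))"
  shows "\<not> solid I (clo I (\<Union>t. Y t))"
proof
  have I: "finite I" using Y(1) by (simp add: dfam_def)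
  note cY = closed_family_clo[OF Y(1,2)]
  assume "solid I (clo I (\<Union>t. Y t))"
  moreover have "(\<Union>t. Y t) \<subseteq> (\<Union>t. clo I (Y t))"
    using Y(1) clo_subset unfolding dfam_def by blast
  ultimately have "solid I (clo I (\<Union>t. clo I (Y t)))" using clo_mono solid_mono by metis
  moreover have "fsigma I (\<Union>t. clo I (Y t))" using cY unfolding fsigma_def by blast
  ultimately have "solid I (\<Union>t. clo I (Y t))" using regularD[OF regular_finite[OF I]] by blast
  with baireD[OF baire_finite[OF I] cY] Y(3) show False by blast
qed

lemma fsigma_compl: "fsigma I X \<Longrightarrow> fsigma I (pts I - X)"
  using fsigma_bool_open bool_open_fsigma by blast

end

section \<open>The product topology\<close>

lemma open_iff_abs:
  "open (S :: 'a::{linordered_field, linorder_topology} set) \<longleftrightarrow> (\<forall>x\<in>S. \<exists>\<epsilon>>0. \<forall>y. \<bar>y - x\<bar> < \<epsilon> \<longrightarrow> y \<in> S)"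
proof
  assume S: "open S"
  show "\<forall>x\<in>S. \<exists>\<epsilon>>0. \<forall>y. \<bar>y - x\<bar> < \<epsilon> \<longrightarrow> y \<in> S"
  proof
    fix x assume x: "x \<in> S"
    obtain b where b: "x < b" "{x..<b} \<subseteq> S" using open_right[OF S x, of "x + 1"] by auto
    obtain a where a: "a < x" "{a<..x} \<subseteq> S" using open_left[OF S x, of "x - 1"] by auto
    have "y \<in> S" if "\<bar>y - x\<bar> < min (b - x) (x - a)" for y
    proof (cases "x \<le> y")
      case True
      with that b(2) show ?thesis by (auto simp: subset_iff)
    next
      case False
      with that a(2) show ?thesis by (auto simp: subset_iff abs_less_iff)
    qed
    moreover have "min (b - x) (x - a) > 0" using a b by simp
    ultimately show "\<exists>\<epsilon>>0. \<forall>y. \<bar>y - x\<bar> < \<epsilon> \<longrightarrow> y \<in> S" by blast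
  qed
next
  assume R: "\<forall>x\<in>S. \<exists>\<epsilon>>0. \<forall>y. \<bar>y - x\<bar> < \<epsilon> \<longrightarrow> y \<in> S"
  show "open S"
  proof (rule open_subopen[THEN iffD2], rule ballI)
    fix x assume "x \<in> S"
    with R obtain \<epsilon> where e: "\<epsilon> > 0" "\<And>y. \<bar>y - x\<bar> < \<epsilon> \<Longrightarrow> y \<in> S" by blast
    have "{x - \<epsilon><..<x + \<epsilon>} \<subseteq> S" by (auto intro!: e(2) simp: abs_less_iff algebra_simps)
    with e(1) show "\<exists>T. open T \<and> x \<in> T \<and> T \<subseteq> S"
      by (intro exI[of _ "{x - \<epsilon><..<x + \<epsilon>}"]) auto
  qed
qed

lemma openin_Ktop: "openin (Ktop n) (U :: (nat \<Rightarrow> 'a::{linordered_field, linorder_topology}) set) \<longleftrightarrow> opn {..<n} U"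
proof
  assume U: "openin (Ktop n) U"
  show "opn {..<n} U" unfolding opn_def
  proof (intro conjI ballI)
    show "U \<subseteq> pts {..<n}" using openin_subset[OF U] by (simp add: Kn_eq_pts)
    fix x assume x: "x \<in> U"
    with U have "\<exists>V. (\<forall>i\<in>{..<n}. open (V i)) \<and> x \<in> Pi\<^sub>E {..<n} V \<and> Pi\<^sub>E {..<n} V \<subseteq> U"
      unfolding Ktop_def openin_product_topology_alt by simp
    then obtain V where V: "\<And>i. i < n \<Longrightarrow> open (V i)" "x \<in> Pi\<^sub>E {..<n} V" "Pi\<^sub>E {..<n} V \<subseteq> U" by blast
    have "\<exists>\<epsilon>>0. \<forall>i\<in>{..<n}. \<forall>y. \<bar>y - x i\<bar> < \<epsilon> \<longrightarrow> y \<in> V i"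
    proof (rule finite_radius)
      fix i assume "i \<in> {..<n}"
      then show "\<exists>\<epsilon>>0. \<forall>y. \<bar>y - x i\<bar> < \<epsilon> \<longrightarrow> y \<in> V i"
        using V(1)[of i] V(2) unfolding open_iff_abs by auto
    qed auto
    then obtain \<epsilon> where e: "\<epsilon> > 0" "\<And>i y. i < n \<Longrightarrow> \<bar>y - x i\<bar> < \<epsilon> \<Longrightarrow> y \<in> V i" by auto
    have "cube {..<n} x \<epsilon> \<subseteq> Pi\<^sub>E {..<n} V" using e(2) by (auto simp: cube_def pts_def intro!: PiE_I elim: PiE_arb)
    with e(1) V(3) show "\<exists>\<epsilon>>0. cube {..<n} x \<epsilon> \<subseteq> U" by blast
  qed
next
  assume U: "opn {..<n} U"
  show "openin (Ktop n) U" unfolding Ktop_def openin_product_topology_alt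
  proof
    fix x assume x: "x \<in> U"
    with U obtain \<epsilon> where e: "\<epsilon> > 0" "cube {..<n} x \<epsilon> \<subseteq> U" unfolding opn_def by blast
    have xp: "x \<in> pts {..<n}" using U x by (auto simp: opn_def)
    define V where "V i = {x i - \<epsilon><..<x i + \<epsilon>}" for i
    have "Pi\<^sub>E {..<n} V \<subseteq> cube {..<n} x \<epsilon>"
    proof
      fix y assume y: "y \<in> Pi\<^sub>E {..<n} V"
      have "\<bar>y i - x i\<bar> < \<epsilon>" if "i < n" for i
        using PiE_mem[OF y, of i] that by (simp add: V_def abs_diff_less_iff)
      then show "y \<in> cube {..<n} x \<epsilon>" using y by (simp add: cube_def pts_def PiE_iff)
    qed
    moreover have "x \<in> Pi\<^sub>E {..<n} V" using xp e(1) unfolding V_def pts_def by (simp add: PiE_iff)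
    moreover have "openin euclidean (V i)" for i by (simp add: V_def)
    ultimately show "\<exists>V. finite {i \<in> {..<n}. V i \<noteq> topspace euclidean} \<and> (\<forall>i\<in>{..<n}. openin euclidean (V i)) \<and>
        x \<in> Pi\<^sub>E {..<n} V \<and> Pi\<^sub>E {..<n} V \<subseteq> U"
      using e(2) by (intro exI[of _ V] conjI) (simp, blast, blast, blast)
  qed
qed

lemma closedin_Ktop: "closedin (Ktop n) (C :: (nat \<Rightarrow> 'a::{linordered_field, linorder_topology}) set) \<longleftrightarrow> cls {..<n} C"
proof -
  have "cls {..<n} C \<longleftrightarrow> C \<subseteq> pts {..<n} \<and> opn {..<n} (pts {..<n} - C)"
    using opn_compl[of "{..<n}" C] cls_compl[of "{..<n}" "pts {..<n} - C"]
    by (auto simp: double_diff cls_def)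
  then show ?thesis by (simp add: closedin_def openin_Ktop Kn_eq_pts)
qed

lemma closure_of_Ktop:
  fixes X :: "(nat \<Rightarrow> 'a::{linordered_field, linorder_topology}) set"
  assumes "X \<subseteq> Kn n" shows "Ktop n closure_of X = clo {..<n} X"
proof (rule closure_of_unique)
  show "X \<subseteq> clo {..<n} X" using assms by (intro clo_subset) (simp add: Kn_eq_pts)
  show "closedin (Ktop n) (clo {..<n} X)" by (simp add: closedin_Ktop cls_clo)
  show "clo {..<n} X \<subseteq> T" if "X \<subseteq> T" "closedin (Ktop n) T" for T
    using that by (simp add: closedin_Ktop clo_least)
qed

lemma interior_of_Ktop:
  "Ktop n interior_of (X :: (nat \<Rightarrow> 'a::{linordered_field, linorder_topology}) set) = {} \<longleftrightarrow> \<not> solid {..<n} X"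
proof -
  have "Ktop n interior_of X \<noteq> {} \<longleftrightarrow> (\<exists>V. opn {..<n} V \<and> V \<noteq> {} \<and> V \<subseteq> X)"
    by (auto simp: interior_of_def openin_Ktop)
  then show ?thesis using solid_opn[of "{..<n}" X] opn_solid solid_mono by blast
qed

lemma nowhere_dense_Ktop:
  "nowhere_dense_in (Ktop n) (X :: (nat \<Rightarrow> 'a::{linordered_field, linorder_topology}) set) \<longleftrightarrow>
    X \<subseteq> pts {..<n} \<and> \<not> solid {..<n} (clo {..<n} X)"
  using closure_of_Ktop[of X n] interior_of_Ktop[of n "clo {..<n} X"]
  by (auto simp: nowhere_dense_in_def Kn_eq_pts)

lemma discrete_Ktop:
  fixes X :: "(nat \<Rightarrow> 'a::{linordered_field, linorder_topology}) set"
  assumes "X \<subseteq> Kn n" shows "discrete_in (Ktop n) X \<longleftrightarrow> discr {..<n} X"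
proof -
  have "discrete_in (Ktop n) X \<longleftrightarrow> (\<forall>x\<in>X. openin (subtopology (Ktop n) X) {x})"
    using assms discrete_topology_unique[of X "subtopology (Ktop n) X"]
    by (auto simp: discrete_in_def eq_commute)
  also have "\<dots> \<longleftrightarrow> discr {..<n} X" unfolding discr_def
  proof (rule ball_cong[OF refl])
    fix x assume x: "x \<in> X"
    then have xp: "x \<in> pts {..<n}" using assms by (auto simp: Kn_eq_pts)
    show "openin (subtopology (Ktop n) X) {x} \<longleftrightarrow> (\<exists>\<epsilon>>0. cube {..<n} x \<epsilon> \<inter> X \<subseteq> {x})"
    proof
      assume "openin (subtopology (Ktop n) X) {x}"
      then obtain T where T: "opn {..<n} T" "{x} = T \<inter> X" by (auto simp: openin_subtopology openin_Ktop)
      then obtain \<epsilon> where "\<epsilon> > 0" "cube {..<n} x \<epsilon> \<subseteq> T" unfolding opn_def by blast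
      with T(2) show "\<exists>\<epsilon>>0. cube {..<n} x \<epsilon> \<inter> X \<subseteq> {x}" by blast
    next
      assume "\<exists>\<epsilon>>0. cube {..<n} x \<epsilon> \<inter> X \<subseteq> {x}"
      then obtain \<epsilon> where e: "\<epsilon> > 0" "cube {..<n} x \<epsilon> \<inter> X \<subseteq> {x}" by blast
      then have "{x} = cube {..<n} x \<epsilon> \<inter> X" using x cube_center[OF xp e(1)] by blast
      then show "openin (subtopology (Ktop n) X) {x}"
        unfolding openin_subtopology openin_Ktop using opn_cube[of "{..<n}"] by blast
    qed
  qed
  finally show ?thesis .
qed

lemma bool_open_constructible:
  fixes M :: "('f, 'r, 'a::{linordered_field, linorder_topology}) fo_structure"
  shows "bool_open M {..<n} X \<Longrightarrow> constructible_in (Ktop n) X"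
proof (induction rule: bool_open.induct)
  case (compl A)
  then show ?case using constructible_in.intros(2)[of "Ktop n" A] by (simp add: Kn_eq_pts)
qed (auto intro: constructible_in.intros simp: openin_Ktop)

lemma lessThan_one: "{..<1} = {0 :: nat}"
  by auto

lemma bounded_Kn_iff: "bounded_Kn n X \<longleftrightarrow> bdd {..<n} X"
  by (simp add: bounded_Kn_def bdd_def Ball_def)

lemma inverse_continuous:
  fixes x :: "'a::linordered_field"
  assumes x: "x \<noteq> 0" and e: "\<epsilon> > 0"
  shows "\<exists>\<delta>>0. \<forall>y. \<bar>y - x\<bar> < \<delta> \<longrightarrow> y \<noteq> 0 \<and> \<bar>inverse y - inverse x\<bar> < \<epsilon>"
proof -
  \<comment> \<open>The first bound keeps \<open>\<bar>y\<bar>\<close> above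
    \<open>\<bar>x\<bar> / 2\<close>; the second then controls
    \<open>\<bar>y - x\<bar> / (\<bar>y\<bar> * \<bar>x\<bar>)\<close>, the difference of the
    inverses.\<close>
  define \<delta> where "\<delta> = min (\<bar>x\<bar> / 2) (\<epsilon> * (\<bar>x\<bar> / 2) * \<bar>x\<bar>)"
  have "y \<noteq> 0 \<and> \<bar>inverse y - inverse x\<bar> < \<epsilon>" if y: "\<bar>y - x\<bar> < \<delta>" for y
  proof -
    have "\<bar>x\<bar> \<le> \<bar>y\<bar> + \<bar>y - x\<bar>" by (simp add: abs_if)
    with y have y2: "\<bar>x\<bar> / 2 < \<bar>y\<bar>" by (simp add: \<delta>_def)
    then have y0: "y \<noteq> 0" by auto
    have "\<bar>inverse y - inverse x\<bar> = \<bar>y - x\<bar> / (\<bar>y\<bar> * \<bar>x\<bar>)"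
      using x y0 by (simp add: inverse_diff_inverse abs_mult divide_inverse abs_minus_commute mult.commute)
    also have "\<dots> < \<epsilon>"
    proof -
      have "\<bar>y - x\<bar> < \<epsilon> * (\<bar>x\<bar> / 2) * \<bar>x\<bar>" using y by (simp add: \<delta>_def)
      also have "\<dots> < \<epsilon> * \<bar>y\<bar> * \<bar>x\<bar>" using y2 x e by (intro mult_strict_right_mono mult_strict_left_mono) auto
      finally show ?thesis using x y0 by (simp add: divide_less_eq mult.assoc)
    qed
    finally show ?thesis using y0 by blast
  qed
  moreover have "\<delta> > 0" using x e by (simp add: \<delta>_def)
  ultimately show ?thesis by blast
qed

section \<open>The open core\<close>

context dc_structure
begin

lemma isolated_discr: "isolated I X \<Longrightarrow> X \<subseteq> pts I \<Longrightarrow> discr I X"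
  unfolding isolated_def discr_def by blast

lemma discr_isolated:
  assumes "cls I X" "discr I X" "X \<subseteq> pts I" shows "isolated I X"
  unfolding isolated_def
proof
  fix x :: "nat \<Rightarrow> 'a" assume x: "x \<in> pts I"
  show "\<exists>\<epsilon>>0. cube I x \<epsilon> \<inter> X \<subseteq> {x}"
  proof (cases "x \<in> X")
    case False
    with assms x cls_avoid[of I X x] show ?thesis by fastforce
  qed (use assms in \<open>auto simp: discr_def\<close>)
qed

lemma pseudo_finite_iff: "pseudo_finite M n X \<longleftrightarrow> pfin {..<n} X"
proof -
  have "cls {..<n} X \<and> discr {..<n} X \<longleftrightarrow> isolated {..<n} X" if "X \<subseteq> pts {..<n}"
    using that isolated_cls discr_isolated isolated_discr by blast
  then show ?thesis
    unfolding pseudo_finite_def pfin_def definable_iff_dset closedin_Ktop bounded_Kn_iff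
    using discrete_Ktop[of X n] by (auto simp: dset_def Kn_eq_pts)
qed

lemma dpred_open_core:
  assumes "definable M n V" "openin (Ktop n) V"
  shows "dpred (open_core M) (\<lambda>e. restrict e {..<n} \<in> V)"
proof -
  have "restrict ((!) (map (\<lambda>i. e i) [0..<n])) {..<n} = restrict e {..<n}" for e :: "nat \<Rightarrow> 'a"
    by (auto simp: fun_eq_iff)
  then show ?thesis unfolding dpred_def using assms
    by (intro exI[of _ "Rel (n, V) (map Var [0..<n])"] exI[of _ Inl])
      (auto simp: open_core_def comp_def)
qed

text \<open>Inversion moves the behaviour of \<open>D\<close> at infinity to 0. Away from 0 its
  continuity keeps the points separated, so 0 is the only possible accumulation point, and it has
  been added.\<close>

lemma inverse_set:
  assumes D: "isolated {0} (line D)"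
  shows "cls {0} (line {x. x = 0 \<or> inverse x \<in> D})" "thin {x. x = 0 \<or> inverse x \<in> D}"
proof -
  define E where "E = {x. x = 0 \<or> inverse x \<in> D}"
  have away: "\<exists>\<delta>>0. \<forall>y\<in>E. \<bar>y - m\<bar> < \<delta> \<longrightarrow> y = m" if m: "m \<noteq> 0" for m
  proof -
    obtain \<epsilon> where \<epsilon>: "\<epsilon> > 0" "\<And>b. b \<in> D \<Longrightarrow> \<bar>b - inverse m\<bar> < \<epsilon> \<Longrightarrow> b = inverse m"
      using D unfolding isolated_line by blast
    from inverse_continuous[OF m \<epsilon>(1)] obtain \<delta> where
      d: "\<delta> > 0" "\<And>y. \<bar>y - m\<bar> < \<delta> \<Longrightarrow> y \<noteq> 0 \<and> \<bar>inverse y - inverse m\<bar> < \<epsilon>" by blast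
    have "y = m" if "y \<in> E" "\<bar>y - m\<bar> < \<delta>" for y
      using d(2)[OF that(2)] \<epsilon>(2)[of "inverse y"] that(1) by (auto simp: E_def)
    with d(1) show ?thesis by blast
  qed
  have "cls {0} (line E)" unfolding cls_line_iff
  proof (intro allI impI, rule ccontr)
    fix a assume a: "\<forall>\<epsilon>>0. \<exists>b\<in>E. \<bar>b - a\<bar> < \<epsilon>" and "a \<notin> E"
    then have "a \<noteq> 0" by (auto simp: E_def)
    with away a \<open>a \<notin> E\<close> show False by metis
  qed
  moreover have "thin E" unfolding thin_def
  proof (intro allI impI)
    fix a b :: 'a assume ab: "a < b"
    obtain m where m: "a < m" "m < b" "m \<noteq> 0"
    proof -
      obtain p where p: "a < p" "p < b" using dense[OF ab] by blast
      obtain q where q: "p < q" "q < b" using dense[OF p(2)] by blast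
      show ?thesis
      proof (cases "p = 0")
        case True
        with p q show ?thesis by (intro that[of q]) auto
      qed (use p that[of p] in auto)
    qed
    obtain \<delta> where d: "\<delta> > 0" "\<And>y. y \<in> E \<Longrightarrow> \<bar>y - m\<bar> < \<delta> \<Longrightarrow> y = m" using away[OF m(3)] by blast
    obtain c where c: "m < c" "c < min b (m + \<delta>)" using dense[of m "min b (m + \<delta>)"] m d(1) by auto
    then have "c \<notin> E" using d(2)[of c] by (auto simp: abs_less_iff algebra_simps)
    with c m show "\<exists>c. a < c \<and> c < b \<and> c \<notin> E" by (intro exI[of _ c]) auto
  qed
  ultimately show "cls {0} (line {x. x = 0 \<or> inverse x \<in> D})" "thin {x. x = 0 \<or> inverse x \<in> D}"
    by (simp_all add: E_def)
qed

text \<open>The germ at \<open>0\<close> of the characteristic function \<open>f\<close> of \<open>{1/x | x \<in> D \<or> - x \<in> D}\<close> decides whether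
  \<open>D\<close> is bounded.\<close>

lemma bounded_of_locally_o_minimal:
  assumes lo: "locally_o_minimal (open_core M)"
    and D: "dpred M (\<lambda>e. e 0 \<in> D)" "isolated {0} (line D)"
  shows "\<exists>r. \<forall>a\<in>D. \<bar>a\<bar> \<le> r"
proof -
  \<comment> \<open>Made symmetric, because a germ to the right of 0 sees only positive
    points.\<close>
  define D' where "D' = {x. x \<in> D \<or> 0 - x \<in> D}"
  have "isolated {0} (line {x. 0 - x \<in> D})" unfolding isolated_line
  proof
    fix a
    obtain \<epsilon> where "\<epsilon> > 0" "\<And>b. b \<in> D \<Longrightarrow> \<bar>b - (0 - a)\<bar> < \<epsilon> \<Longrightarrow> b = 0 - a"
      using D(2) unfolding isolated_line by blast
    moreover have "\<bar>(0 - b) - (0 - a)\<bar> = \<bar>b - a\<bar>" for b by (simp add: abs_minus_commute)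
    ultimately show "\<exists>\<epsilon>>0. \<forall>b\<in>{x. 0 - x \<in> D}. \<bar>b - a\<bar> < \<epsilon> \<longrightarrow> b = a" by force
  qed
  from isolated_Un[OF D(2) this] have D': "isolated {0} (line D')"
    unfolding D'_def line_Un[symmetric] by (simp add: Un_def)
  define E where "E = {x. x = 0 \<or> inverse x \<in> D'}"
  have E: "cls {0} (line E)" "thin E" unfolding E_def by (rule inverse_set[OF D'])+
  have eq: "line (- E) = pts {0} - line E" by (auto simp: line_def)
  have "dpred M (\<lambda>e. e 0 \<in> E)" unfolding E_def D'_def mem_Collect_eq by (intro dI dpred_app1[OF D(1)])
  then have "dset M {..<1} (line (- E))"
    unfolding lessThan_one dset_line Compl_iff by (rule dpred_not)
  moreover have "openin (Ktop 1) (line (- E))"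
    unfolding openin_Ktop lessThan_one eq by (rule opn_compl[OF E(1)])
  ultimately have "dpred (open_core M) (\<lambda>e. restrict e {..<1} \<in> line (- E))"
    by (intro dpred_open_core) (simp_all only: definable_iff_dset)
  then have U: "dpred (open_core M) (\<lambda>e. e 0 \<notin> E)" by (simp add: line_def lessThan_Suc)
  define f :: "'a \<Rightarrow> 'a" where "f x = (if x \<in> E then 1 else 0)" for x
  have "dpred (open_core M) (\<lambda>e. (e 0 \<notin> E \<and> e 1 = 0) \<or> (\<not> e 0 \<notin> E \<and> e 1 = 1))"
    by (intro dpred_disj dpred_conj dpred_not[OF U] dpred_eq dterm_var dterm_const U)
  moreover have "(\<lambda>e. (e 0 \<notin> E \<and> e 1 = 0) \<or> (\<not> e 0 \<notin> E \<and> e 1 = 1)) = (\<lambda>e :: nat \<Rightarrow> 'a. e 1 = f (e 0))"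
    by (auto simp: f_def fun_eq_iff)
  ultimately have "definable_fun (open_core M) f"
    unfolding definable_fun_def by (intro dpred_definable) simp
  then obtain y where y: "y > 0" "(\<forall>z\<in>{0<..<y}. f z > 0) \<or> (\<forall>z\<in>{0<..<y}. f z = 0) \<or> (\<forall>z\<in>{0<..<y}. f z < 0)"
    using lo unfolding locally_o_minimal_def by blast
  \<comment> \<open>Since \<open>E\<close> is thin, \<open>f\<close> vanishes somewhere in the
    interval, which leaves only the middle case of the trichotomy.\<close>
  obtain z where z: "0 < z" "z < y" "z \<notin> E" using E(2) y(1) unfolding thin_def by blast
  then have "f z = 0" by (simp add: f_def)
  with z y(2) have f0: "f z = 0" if "0 < z" "z < y" for z using that by force
  have "\<bar>a\<bar> \<le> inverse y" if a: "a \<in> D" for a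
  proof (rule ccontr)
    assume "\<not> \<bar>a\<bar> \<le> inverse y"
    then have "0 < inverse y" "inverse y < \<bar>a\<bar>" using y(1) by auto
    then have "0 < inverse \<bar>a\<bar>" "inverse \<bar>a\<bar> < y"
      using less_imp_inverse_less[of "inverse y" "\<bar>a\<bar>"] by auto
    from f0[OF this] have "inverse \<bar>a\<bar> \<notin> E" by (auto simp: f_def split: if_splits)
    with a show False by (auto simp: E_def D'_def abs_if split: if_splits)
  qed
  then show ?thesis by blast
qed

end

context tame_structure
begin

text \<open>There are no function symbols, so atoms are diagonals or preimages of open sets.
  Negation is handled by \<open>fsigma_compl\<close>; a quantifier is a projection along coordinate
  \<open>v\<close>, followed by the cylinder back to \<open>I\<close>.\<close>

lemma open_core_fsigma:
  assumes "wf_formula (open_core M) \<phi>" "finite I" "fvars \<phi> \<subseteq> I"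
  shows "fsigma I {x \<in> pts I. sat (open_core M) x \<phi>}"
  using assms
proof (induction \<phi> arbitrary: I)
  case (Eq s t)
  from Eq.prems(1) obtain i j where "s = Var i" "t = Var j"
    by (cases s; cases t) (auto simp: open_core_def)
  with Eq.prems show ?case
    by (auto intro!: fsigma_cls dsetI dI cls_coord_eq)
next
  case (Rel r ts)
  obtain n V where r: "r = (n, V)" by (cases r)
  with Rel.prems have V: "definable M n V" "openin (Ktop n) V" "length ts = n"
    and ts: "\<And>t. t \<in> set ts \<Longrightarrow> wf_term (open_core M) t" by (auto simp: open_core_def)
  define v where "v j = (case ts ! j of Var i \<Rightarrow> i | _ \<Rightarrow> 0)" for j
  have v: "ts ! j = Var (v j)" if "j < n" for j
    using ts[OF nth_mem, of j] that V(3) unfolding v_def by (cases "ts ! j") (auto simp: open_core_def)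
  have vI: "v j \<in> I" if "j < n" for j
    using Rel.prems(3) v[OF that] that V(3) by (force simp: set_conv_nth)
  have "sat (open_core M) x (Rel r ts) \<longleftrightarrow> restrict (\<lambda>j. x (v j)) {..<n} \<in> V" for x
  proof -
    have "restrict ((!) (map (eval_term (open_core M) x) ts)) {..<n} = restrict (\<lambda>j. x (v j)) {..<n}"
      using v V(3) by (auto simp: fun_eq_iff)
    then show ?thesis by (simp add: r open_core_def)
  qed
  moreover have "fsigma I {x \<in> pts I. restrict (\<lambda>j. x (v j)) {..<n} \<in> V}"
  proof (rule fsigma_opn)
    show "dset M I {x \<in> pts I. restrict (\<lambda>j. x (v j)) {..<n} \<in> V}"
      using V(1) unfolding definable_iff_dset
      by (intro dsetI Rel.prems dpred_mem[of M "{..<n}" V] dI; simp)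
    show "opn I {x \<in> pts I. restrict (\<lambda>j. x (v j)) {..<n} \<in> V}" unfolding opn_def
    proof (intro conjI ballI)
      fix x assume "x \<in> {x \<in> pts I. restrict (\<lambda>j. x (v j)) {..<n} \<in> V}"
      then obtain \<epsilon> where e: "\<epsilon> > 0" "cube {..<n} (restrict (\<lambda>j. x (v j)) {..<n}) \<epsilon> \<subseteq> V"
        using V(2) unfolding openin_Ktop opn_def by blast
      have "restrict (\<lambda>j. y (v j)) {..<n} \<in> V" if "y \<in> cube I x \<epsilon>" for y
        by (rule subsetD[OF e(2)]) (use that vI in \<open>auto simp: cube_def\<close>)
      with e(1) show "\<exists>\<epsilon>>0. cube I x \<epsilon> \<subseteq> {x \<in> pts I. restrict (\<lambda>j. x (v j)) {..<n} \<in> V}"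
        by (intro exI[of _ \<epsilon>]) (auto simp: cube_def)
    qed auto
  qed
  ultimately show ?case by simp
next
  case (Neg \<phi>)
  have "{x \<in> pts I. sat (open_core M) x (Neg \<phi>)} = pts I - {x \<in> pts I. sat (open_core M) x \<phi>}" by auto
  then show ?case using Neg by (auto intro: fsigma_compl)
next
  case (Conj \<phi> \<psi>)
  have "{x \<in> pts I. sat (open_core M) x (Conj \<phi> \<psi>)} =
      {x \<in> pts I. sat (open_core M) x \<phi>} \<inter> {x \<in> pts I. sat (open_core M) x \<psi>}" by auto
  then show ?case using Conj by (auto intro: fsigma_Int)
next
  case (Exi v \<phi>)
  let ?J = "I - {v}" and ?S = "{x \<in> pts I. sat (open_core M) x \<phi>}"
  have vI: "v \<in> I" using Exi.prems(3) by auto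
  have S: "fsigma I ?S" using Exi by auto
  have "{x \<in> pts I. sat (open_core M) x (Exi v \<phi>)} =
      {x \<in> pts I. restrict x ?J \<in> (\<lambda>x. restrict x ?J) ` ?S}"
  proof (intro equalityI subsetI)
    fix x assume "x \<in> {x \<in> pts I. sat (open_core M) x (Exi v \<phi>)}"
    then obtain a where a: "x \<in> pts I" "sat (open_core M) (x(v := a)) \<phi>" by auto
    have "x(v := a) \<in> ?S" using a vI by simp
    moreover have "restrict x ?J = restrict (x(v := a)) ?J" by (auto simp: fun_eq_iff)
    ultimately show "x \<in> {x \<in> pts I. restrict x ?J \<in> (\<lambda>x. restrict x ?J) ` ?S}" using a(1) by blast
  next
    fix x assume "x \<in> {x \<in> pts I. restrict x ?J \<in> (\<lambda>x. restrict x ?J) ` ?S}"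
    then obtain y where y: "x \<in> pts I" "y \<in> pts I" "sat (open_core M) y \<phi>" "restrict x ?J = restrict y ?J" by auto
    have "x i = y i" if "i \<in> ?J" for i using y(4) that by (metis restrict_apply)
    then have "x(v := y v) = y" using y(1,2) vI by (intro pts_eqI[of _ I]) auto
    then show "x \<in> {x \<in> pts I. sat (open_core M) x (Exi v \<phi>)}"
      using y(1,3) by (auto intro: exI[of _ "y v"])
  qed
  then show ?case
    using fsigma_cylinder[OF fsigma_projection[OF S, of ?J], of I] Exi.prems(2) by auto
qed

text \<open>Parameters are coordinates fixed by a closed condition and then projected away.\<close>

lemma open_core_definable_fsigma:
  assumes "definable (open_core M) n X" shows "fsigma {..<n} X"
proof -
  from assms obtain \<phi> p where \<phi>: "wf_formula (open_core M) \<phi>"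
    "X = {x \<in> Kn n. sat (open_core M) (\<lambda>i. if i < n then x i else p i) \<phi>}" unfolding definable_def by blast
  define I where "I = fvars \<phi> \<union> {..<n}"
  have I: "finite I" "{..<n} \<subseteq> I" by (auto simp: I_def)
  let ?S = "{x \<in> pts I. sat (open_core M) x \<phi>}" and ?P = "{x \<in> pts I. \<forall>i\<in>I - {..<n}. x i = p i}"
  have "fsigma I ?S" using \<phi>(1) I by (intro open_core_fsigma) (auto simp: I_def)
  moreover have "fsigma I ?P"
    by (intro fsigma_cls dsetI dpred_ball_fin dI cls_params) (use I in auto)
  ultimately have "fsigma {..<n} ((\<lambda>x. restrict x {..<n}) ` (?S \<inter> ?P))"
    using I(2) by (intro fsigma_projection fsigma_Int)
  moreover have "(\<lambda>x. restrict x {..<n}) ` (?S \<inter> ?P) = X"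
  proof -
    have eq: "sat (open_core M) x \<phi> = sat (open_core M) (\<lambda>i. if i < n then x i else p i) \<phi>" if "x \<in> ?P" for x
      using that by (intro sat_cong) (auto simp: I_def)
    show ?thesis
    proof (intro equalityI subsetI)
      fix y assume "y \<in> (\<lambda>x. restrict x {..<n}) ` (?S \<inter> ?P)"
      then obtain x where x: "x \<in> ?S" "x \<in> ?P" "y = restrict x {..<n}" by blast
      have "(\<lambda>i. if i < n then x i else p i) = (\<lambda>i. if i < n then y i else p i)" using x(3) by auto
      with x(1) eq[OF x(2)] have "sat (open_core M) (\<lambda>i. if i < n then y i else p i) \<phi>" by simp
      moreover have "y \<in> pts {..<n}" using x(3) by simp
      ultimately show "y \<in> X" by (simp only: \<phi>(2) Kn_eq_pts mem_Collect_eq simp_thms)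
    next
      fix y assume y: "y \<in> X"
      then have yp: "y \<in> pts {..<n}" by (simp add: \<phi>(2) Kn_eq_pts)
      define x where "x = restrict (\<lambda>i. if i < n then y i else p i) I"
      have x: "x \<in> ?P" using I by (auto simp: x_def)
      have "x i = y i" if "i < n" for i using I(2) that by (auto simp: x_def)
      then have "(\<lambda>i. if i < n then x i else p i) = (\<lambda>i. if i < n then y i else p i)" by auto
      with eq[OF x] y have "x \<in> ?S" by (simp add: \<phi>(2) x_def)
      moreover have "restrict x {..<n} = y" by (rule pts_eqI[OF restrict_in_pts yp]) (use I(2) in \<open>auto simp: x_def\<close>)
      ultimately show "y \<in> (\<lambda>x. restrict x {..<n}) ` (?S \<inter> ?P)" using x by blast
    qed
  qed
  ultimately show ?thesis by simp
qed

text \<open>Definable intermediate value property: \<open>s\<close> is the supremum of the part of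
  \<open>A\<close> between \<open>c\<close> and \<open>d\<close>. Nothing of \<open>A\<close>
  follows it up to \<open>d\<close>, and if \<open>s = d\<close> then \<open>s\<close> itself is
  outside \<open>A\<close>.\<close>

lemma adherent_between:
  assumes A: "dpred M (\<lambda>e. e 0 \<in> A)" and cd: "c < d" "c \<in> A" "d \<notin> A"
  shows "\<exists>s. c \<le> s \<and> s \<le> d \<and> (\<forall>\<epsilon>>0. \<exists>a\<in>A. \<bar>a - s\<bar> < \<epsilon>) \<and> (\<forall>\<epsilon>>0. \<exists>a. a \<notin> A \<and> \<bar>a - s\<bar> < \<epsilon>)"
proof -
  define S where "S = {z. z \<in> A \<and> c \<le> z \<and> z \<le> d}"
  have "dpred M (\<lambda>e. e 0 \<in> S)" unfolding S_def mem_Collect_eq by (intro dI A)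
  moreover have "c \<in> S" using cd by (simp add: S_def)
  moreover have "z \<le> d" if "z \<in> S" for z using that by (simp add: S_def)
  ultimately obtain s where s: "\<forall>z\<in>S. z \<le> s" "\<And>b. (\<forall>z\<in>S. z \<le> b) \<Longrightarrow> s \<le> b"
    using definable_lub[of S d] by blast
  have sd: "c \<le> s" "s \<le> d" using s(1) \<open>c \<in> S\<close> s(2)[of d] by (auto simp: S_def)
  moreover have "\<exists>a\<in>A. \<bar>a - s\<bar> < \<epsilon>" if \<epsilon>: "\<epsilon> > 0" for \<epsilon>
  proof -
    obtain z where z: "z \<in> S" "s - \<epsilon> < z" using s(2)[of "s - \<epsilon>"] \<epsilon> by force
    have "z \<le> s" using z(1) s(1) by blast
    with z \<epsilon> show ?thesis by (intro bexI[of _ z]) (auto simp: S_def abs_less_iff algebra_simps)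
  qed
  moreover have "\<exists>a. a \<notin> A \<and> \<bar>a - s\<bar> < \<epsilon>" if "\<epsilon> > 0" for \<epsilon>
  proof (cases "s = d")
    case True
    then show ?thesis using cd(3) that by (intro exI[of _ s]) simp
  next
    case False
    then have "s < min d (s + \<epsilon>)" using sd(2) that by simp
    then obtain a where a: "s < a" "a < min d (s + \<epsilon>)" using dense by blast
    have "a \<notin> S" using a(1) s(1) by force
    then have "a \<notin> A" using a sd(1) by (auto simp: S_def)
    with a show ?thesis by (intro exI[of _ a]) (auto simp: abs_less_iff algebra_simps)
  qed
  ultimately show ?thesis by blast
qed

text \<open>The boundary \<open>B\<close> of \<open>P\<close> has no interior, hence is
  pseudo-finite. Some interval to the right of \<open>x\<close> is free of boundary points, and
  \<open>adherent_between\<close> makes \<open>P\<close> constant on it.\<close>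

lemma fsigma_germ:
  assumes P: "fsigma {0} (line P)"
  shows "\<exists>y>x. (\<forall>z\<in>{x<..<y}. z \<in> P) \<or> (\<forall>z\<in>{x<..<y}. z \<notin> P)"
proof -
  let ?N = "pts {0} - line P"
  have Pd: "dset M {0} (line P)" "dpred M (\<lambda>e. e 0 \<in> P)" using fsigma_dset[OF P] by (simp_all add: dset_line)
  have Nd: "dset M {0} ?N" by (intro dset_Diff dset_pts Pd) simp
  define B where "B = clo {0} (line P) \<inter> clo {0} ?N"
  have B: "dset M {0} B" "cls {0} B" unfolding B_def by (intro dset_Int cls_Int dset_clo cls_clo Pd Nd; simp)+
  have "\<not> solid {0} B"
  proof
    assume "solid {0} B"
    then obtain G where "opn {0} G" "G \<noteq> {}" "G \<subseteq> B" using solid_opn[of "{0}" B] by blast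
    then obtain V where V: "opn {0} V" "V \<noteq> {}" "V \<subseteq> B" "dset M {0} V"
      using dset_subcube[of "{0}" G] by auto
    \<comment> \<open>If \<open>B\<close> contained the open set \<open>V\<close>, then
      \<open>P\<close> would be dense in \<open>V\<close>, so by \<open>regular\<close> it would
      fill an open part of \<open>V\<close>. The complement of \<open>P\<close>, being dense in
      \<open>V\<close> too, would have to meet that part.\<close>
    have "V \<subseteq> clo {0} (V \<inter> line P)"
    proof
      fix v assume v: "v \<in> V"
      then have vp: "v \<in> pts {0}" using V(1) by (auto simp: opn_def)
      have "cube {0} v \<epsilon> \<inter> (V \<inter> line P) \<noteq> {}" if "\<epsilon> > 0" for \<epsilon>
        using opn_meets_clo[OF opn_Int[OF V(1) opn_cube[of "{0}" v \<epsilon>]], of v "line P"] v V(3) cube_center[OF vp that]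
        by (auto simp: B_def)
      with vp show "v \<in> clo {0} (V \<inter> line P)" by (simp add: clo_def)
    qed
    then have "solid {0} (clo {0} (V \<inter> line P))" using opn_solid[OF V(1,2)] solid_mono by blast
    moreover have "fsigma {0} (V \<inter> line P)" by (intro fsigma_Int fsigma_opn V P)
    ultimately have "solid {0} (V \<inter> line P)" using regularD[OF regular_finite] by blast
    then obtain W where W: "opn {0} W" "W \<noteq> {}" "W \<subseteq> V \<inter> line P" using solid_opn[of "{0}"] by blast
    then obtain w where w: "w \<in> W" by blast
    then have "w \<in> clo {0} ?N" using W(3) V(3) by (auto simp: B_def)
    from opn_meets_clo[OF W(1) w this] W(3) show False by blast
  qed
  moreover have "clo {0} B = B" using B(2) clo_subset[of B "{0}"] by (auto simp: cls_def)
  ultimately have "pfin {0} B" using nowhere_dense_pfin[OF B(1)] by simp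
  moreover define E where
    "E = {s. (\<forall>\<epsilon>>0. \<exists>a\<in>P. \<bar>a - s\<bar> < \<epsilon>) \<and> (\<forall>\<epsilon>>0. \<exists>a. a \<notin> P \<and> \<bar>a - s\<bar> < \<epsilon>)}"
  moreover have "B = line E"
  proof -
    have N: "?N = line (- P)" by (auto simp: line_def)
    show ?thesis unfolding B_def N clo_line by (auto simp: line_def E_def Bex_def)
  qed
  ultimately have "isolated {0} (line E)" by (simp add: pfin_def)
  then obtain \<epsilon> where e: "\<epsilon> > 0" "\<And>s. s \<in> E \<Longrightarrow> \<bar>s - x\<bar> < \<epsilon> \<Longrightarrow> s = x"
    unfolding isolated_line by blast
  have no: False if z: "x < c" "c < x + \<epsilon>" "x < d" "d < x + \<epsilon>" and P': "c \<in> P" "d \<notin> P" for c d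
  proof -
    have "c \<noteq> d" using P' by blast
    then consider "c < d" | "d < c" using linorder_neqE by blast
    then have "\<exists>s. x < s \<and> s < x + \<epsilon> \<and> s \<in> E"
    proof cases
      case 1
      from adherent_between[OF Pd(2) 1 P'] obtain s where
        "c \<le> s" "s \<le> d" "\<forall>\<epsilon>>0. \<exists>a\<in>P. \<bar>a - s\<bar> < \<epsilon>" "\<forall>\<epsilon>>0. \<exists>a. a \<notin> P \<and> \<bar>a - s\<bar> < \<epsilon>" by blast
      then show ?thesis using z by (intro exI[of _ s]) (simp add: E_def)
    next
      case 2
      have "dpred M (\<lambda>e. e 0 \<in> - P)" using dpred_not[OF Pd(2)] by simp
      from adherent_between[OF this 2] P' obtain s where
        "d \<le> s" "s \<le> c" "\<forall>\<epsilon>>0. \<exists>a\<in>- P. \<bar>a - s\<bar> < \<epsilon>" "\<forall>\<epsilon>>0. \<exists>a. a \<in> P \<and> \<bar>a - s\<bar> < \<epsilon>" by auto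
      then show ?thesis using z by (intro exI[of _ s]) (auto simp: E_def Bex_def)
    qed
    then obtain s where "x < s" "s < x + \<epsilon>" "s \<in> E" by blast
    with e(2)[of s] show False by (simp add: abs_less_iff algebra_simps)
  qed
  show ?thesis
  proof (intro exI[of _ "x + \<epsilon>"] conjI)
    show "(\<forall>z\<in>{x<..<x + \<epsilon>}. z \<in> P) \<or> (\<forall>z\<in>{x<..<x + \<epsilon>}. z \<notin> P)"
      using no by (auto simp: Ball_def)
  qed (use e(1) in simp)
qed

text \<open>The sets where \<open>f\<close> is positive or negative are projections of the graph cut
  with open half-planes, hence \<open>fsigma\<close>. Each has a constant germ to the right of
  \<open>x\<close>; where both germs are void, \<open>f\<close> is 0.\<close>

lemma open_core_locally_o_minimal: "locally_o_minimal (open_core M)"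
  unfolding locally_o_minimal_def
proof (intro conjI allI impI)
  show "definably_complete (open_core M)" unfolding definably_complete_def
  proof (intro allI impI)
    fix X :: "'a set" assume "definable (open_core M) 1 {x \<in> Kn 1. x 0 \<in> X}"
    then have "definable M 1 {x \<in> Kn 1. x 0 \<in> X}"
      using open_core_definable_fsigma fsigma_dset definable_iff_dset by blast
    then show "\<exists>s. (\<forall>x\<in>X. Fin x \<le> s) \<and> (\<forall>b. (\<forall>x\<in>X. Fin x \<le> b) \<longrightarrow> s \<le> b)"
      using complete unfolding definably_complete_def by blast
  qed
next
  fix f :: "'a \<Rightarrow> 'a" and x :: 'a assume "definable_fun (open_core M) f"
  then have G: "fsigma {..<2} {x \<in> Kn 2. x 1 = f (x 0)}"
    unfolding definable_fun_def by (rule open_core_definable_fsigma)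
  have sign: "fsigma {0} (line {z. f z \<in> A})" if A: "fsigma {..<2} {x \<in> pts {..<2}. x 1 \<in> A}" for A
  proof -
    have "fsigma {0} ((\<lambda>x. restrict x {0}) ` ({x \<in> Kn 2. x 1 = f (x 0)} \<inter> {x \<in> pts {..<2}. x 1 \<in> A}))"
      by (intro fsigma_projection[of "{..<2}"] fsigma_Int G A) auto
    also have "(\<lambda>x. restrict x {0}) ` ({x \<in> Kn 2. x 1 = f (x 0)} \<inter> {x \<in> pts {..<2}. x 1 \<in> A}) = line {z. f z \<in> A}"
    proof (intro equalityI subsetI)
      fix y assume "y \<in> line {z. f z \<in> A}"
      then have y: "y \<in> pts {0}" "f (y 0) \<in> A" by (auto simp: line_def)
      define x where "x = restrict (\<lambda>i. if i = 0 then y 0 else f (y 0)) {..<2 :: nat}"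
      have "x \<in> {x \<in> Kn 2. x 1 = f (x 0)} \<inter> {x \<in> pts {..<2}. x 1 \<in> A}"
        using y by (simp add: x_def Kn_eq_pts)
      moreover have "restrict x {0} = y" using y by (intro pts_eqI[of _ "{0}"]) (auto simp: x_def)
      ultimately show "y \<in> (\<lambda>x. restrict x {0}) ` ({x \<in> Kn 2. x 1 = f (x 0)} \<inter> {x \<in> pts {..<2}. x 1 \<in> A})" by blast
    qed (auto simp: line_def)
    finally show ?thesis .
  qed
  have half: "fsigma {..<2} (pts {..<2} - {x \<in> pts {..<2}. x 1 \<le> 0})"
    "fsigma {..<2} (pts {..<2} - {x \<in> pts {..<2}. 0 \<le> x 1})"
    by (intro fsigma_compl fsigma_cls dsetI dI cls_coord_le cls_coord_ge; simp)+
  have "pts {..<2} - {x \<in> pts {..<2}. x 1 \<le> 0} = {x \<in> pts {..<2}. x 1 \<in> {0 :: 'a<..}}"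
    "pts {..<2} - {x \<in> pts {..<2}. 0 \<le> x 1} = {x \<in> pts {..<2}. x 1 \<in> {..<0 :: 'a}}" by auto
  with half have "fsigma {0} (line {z. f z \<in> {0<..}})" "fsigma {0} (line {z. f z \<in> {..<0}})"
    using sign[of "{0<..}"] sign[of "{..<0}"] by (simp_all only:)
  from fsigma_germ[OF this(1), of x] fsigma_germ[OF this(2), of x] obtain y1 y2 where
    "y1 > x" "(\<forall>z\<in>{x<..<y1}. f z > 0) \<or> (\<forall>z\<in>{x<..<y1}. \<not> f z > 0)"
    "y2 > x" "(\<forall>z\<in>{x<..<y2}. f z < 0) \<or> (\<forall>z\<in>{x<..<y2}. \<not> f z < 0)" by auto
  then show "\<exists>y>x. (\<forall>z\<in>{x<..<y}. f z > 0) \<or> (\<forall>z\<in>{x<..<y}. f z = 0) \<or> (\<forall>z\<in>{x<..<y}. f z < 0)"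
    by (intro exI[of _ "min y1 y2"]) (auto simp: not_less intro: antisym)
qed

end

section \<open>The equivalences\<close>

context dc_structure
begin

lemma definable_line: "definable M 1 (line A) \<longleftrightarrow> dpred M (\<lambda>e. e 0 \<in> A)"
  unfolding definable_iff_dset lessThan_one dset_line ..

lemma dset_Kn_subset: "definable M n X \<Longrightarrow> X \<subseteq> Kn n"
  by (auto simp: definable_def)

lemma tame_of_closed_discrete:
  assumes "\<And>X. definable M 1 X \<Longrightarrow> discrete_in (Ktop 1) X \<Longrightarrow> closedin (Ktop 1) X \<Longrightarrow> pseudo_finite M 1 X"
  shows "tame_structure M"
proof (intro tame_structure.intro tame_structure_axioms.intro dc_structure_axioms)
  fix A assume A: "dpred M (\<lambda>e. e 0 \<in> A)" "isolated {0} (line A)"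
  have sub: "line A \<subseteq> pts {0}" by (auto simp: line_def)
  have "pseudo_finite M 1 (line A)"
  proof (rule assms)
    show "definable M 1 (line A)" using A(1) by (simp only: definable_line)
    show "discrete_in (Ktop 1) (line A)"
      using isolated_discr[OF A(2) sub] discrete_Ktop[of "line A" 1] sub by (simp only: Kn_eq_pts lessThan_one)
    show "closedin (Ktop 1) (line A)"
      using isolated_cls[OF A(2) sub] by (simp only: closedin_Ktop lessThan_one)
  qed
  then show "\<exists>r. \<forall>a\<in>A. \<bar>a\<bar> \<le> r"
    unfolding pseudo_finite_iff lessThan_one pfin_def bdd_line by blast
qed

text \<open>For closed discrete \<open>D\<close>, the set \<open>{0} \<union> {1/x | x \<in> D}\<close> is nowhere dense, and discrete only if \<open>D\<close> is
  bounded.\<close>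

lemma bounded_of_nowhere_dense_discrete:
  assumes nd: "\<And>X. definable M 1 X \<Longrightarrow> nowhere_dense_in (Ktop 1) X \<Longrightarrow> discrete_in (Ktop 1) X"
    and D: "dpred M (\<lambda>e. e 0 \<in> D)" "isolated {0} (line D)"
  shows "\<exists>r. \<forall>a\<in>D. \<bar>a\<bar> \<le> r"
proof -
  define E where "E = {x. x = 0 \<or> inverse x \<in> D}"
  have sub: "line E \<subseteq> pts {0}" by (auto simp: line_def)
  have E: "definable M 1 (line E)"
    unfolding definable_line E_def mem_Collect_eq by (intro dI dpred_app1[OF D(1)])
  have "cls {0} (line E)" "thin E" unfolding E_def by (rule inverse_set[OF D(2)])+
  then have "\<not> solid {0} (clo {0} (line E))"
    using solid_line[of E] solid_mono[of "{0}" "clo {0} (line E)" "line E"] by (auto simp: cls_def)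
  then have "nowhere_dense_in (Ktop 1) (line E)"
    using sub by (simp only: nowhere_dense_Ktop lessThan_one simp_thms)
  from nd[OF E this] have "discr {0} (line E)"
    using discrete_Ktop[of "line E" 1] sub by (simp only: Kn_eq_pts lessThan_one)
  moreover define p0 where "p0 = restrict (\<lambda>_. 0 :: 'a) {0 :: nat}"
  have "p0 \<in> line E" by (simp add: p0_def line_def E_def)
  ultimately obtain \<epsilon> where e: "\<epsilon> > 0" "cube {0} p0 \<epsilon> \<inter> line E \<subseteq> {p0}" unfolding discr_def by blast
  have "\<bar>a\<bar> \<le> inverse \<epsilon>" if a: "a \<in> D" for a
  proof (rule ccontr)
    assume "\<not> \<bar>a\<bar> \<le> inverse \<epsilon>"
    then have i: "0 < inverse \<epsilon>" "inverse \<epsilon> < \<bar>a\<bar>" using e(1) by auto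
    then have a0: "a \<noteq> 0" by auto
    have "\<bar>inverse a\<bar> < \<epsilon>" using less_imp_inverse_less[OF i(2,1)] by simp
    then have "restrict (\<lambda>_. inverse a) {0} \<in> cube {0} p0 \<epsilon> \<inter> line E"
      using a by (simp add: p0_def line_def E_def cube_def)
    with e(2) have "restrict (\<lambda>_. inverse a) {0} = p0" by blast
    then have "restrict (\<lambda>_. inverse a) {0 :: nat} 0 = p0 0" by simp
    then show False using a0 by (simp add: p0_def)
  qed
  then show ?thesis by blast
qed

lemma nowhere_dense_of_closed_discrete:
  assumes "definable M 1 X" "discrete_in (Ktop 1) X" "closedin (Ktop 1) X"
  shows "nowhere_dense_in (Ktop 1) X"
proof -
  have X: "X \<subseteq> pts {0}" using dset_Kn_subset[OF assms(1)] by (simp only: Kn_eq_pts lessThan_one)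
  have "discr {0} X" "cls {0} X"
    using assms(2,3) discrete_Ktop[of X 1] X by (simp_all only: Kn_eq_pts closedin_Ktop lessThan_one)
  moreover obtain A where "X = line A" using line_image[OF X] by blast
  ultimately have "isolated {0} (line A)" "clo {0} X \<subseteq> line A"
    using discr_isolated[OF _ _ X] by (auto simp: cls_def)
  then have "\<not> solid {0} (clo {0} X)" using isolated_thin solid_line solid_mono by blast
  with X show ?thesis by (simp only: nowhere_dense_Ktop lessThan_one simp_thms)
qed

lemma meager_of_nowhere_dense:
  assumes "definable M n X" "nowhere_dense_in (Ktop n) X" shows "meager M n X"
proof -
  have "definable_increasing_family M n (\<lambda>_. X)"
    using dset_fam assms(1) by (simp add: definable_increasing_family_def definable_family_iff definable_iff_dset)
  with assms show ?thesis unfolding meager_def by (intro conjI exI[of _ "\<lambda>_. X"]) auto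
qed

text \<open>A closed discrete set is the increasing union of its parts in the intervals from
  \<open>- t\<close> to \<open>t\<close>, and these are pseudo-finite.\<close>

lemma tame_of_pseudo_finite_unions:
  assumes U: "\<And>Y. definable_increasing_family M 1 Y \<Longrightarrow> (\<And>t. pseudo_finite M 1 (Y t)) \<Longrightarrow> pseudo_finite M 1 (\<Union>t. Y t)"
  shows "tame_structure M"
proof (intro tame_structure.intro tame_structure_axioms.intro dc_structure_axioms)
  fix A assume A: "dpred M (\<lambda>e. e 0 \<in> A)" "isolated {0} (line A)"
  define Y where "Y t = {x \<in> pts {0}. x 0 \<in> A \<and> \<bar>x 0\<bar> \<le> t}" for t
  have Y: "dfam M {0} Y" unfolding Y_def by (rule dfamI) (intro dI dpred_app1[OF A(1)] | simp)+
  have "pseudo_finite M 1 (\<Union>t. Y t)"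
  proof (rule U)
    have "Y s \<subseteq> Y t" if "s \<le> t" for s t using that by (auto simp: Y_def)
    then show "definable_increasing_family M 1 Y"
      using Y unfolding definable_increasing_family_def definable_family_iff lessThan_one by blast
    show "pseudo_finite M 1 (Y t)" for t unfolding pseudo_finite_iff lessThan_one pfin_def
    proof (intro conjI dfam_dset[OF Y])
      show "bdd {0} (Y t)" by (auto simp: bdd_def Y_def)
      show "isolated {0} (Y t)" by (rule isolated_subset[OF A(2)]) (auto simp: Y_def line_def)
    qed
  qed
  moreover have "(\<Union>t. Y t) = line A" by (auto simp: Y_def line_def)
  ultimately show "\<exists>r. \<forall>a\<in>A. \<bar>a\<bar> \<le> r"
    unfolding pseudo_finite_iff lessThan_one pfin_def by (simp add: bdd_line)
qed

end

lemma increasing_familyD: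
  assumes "definable_increasing_family M n Y"
  shows "dfam M {..<n} Y" "mono Y"
  using assms by (auto simp: definable_increasing_family_def definable_family_iff mono_def)

context tame_structure
begin

lemma discrete_pseudo_finite:
  assumes "definable M n X" "discrete_in (Ktop n) X" shows "pseudo_finite M n X"
  using assms discr_pfin[of "{..<n}" X] discrete_Ktop[OF dset_Kn_subset[OF assms(1)]]
  by (simp add: pseudo_finite_iff definable_iff_dset)

lemma nowhere_dense_pseudo_finite:
  assumes "definable M 1 X" "nowhere_dense_in (Ktop 1) X" shows "pseudo_finite M 1 X"
  using assms nowhere_dense_pfin[of X]
  by (simp only: pseudo_finite_iff definable_iff_dset nowhere_dense_Ktop lessThan_one simp_thms)

lemma meager_nowhere_dense_in:
  assumes "meager M n X" shows "nowhere_dense_in (Ktop n) X"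
proof -
  from assms obtain Y where Y: "definable_increasing_family M n Y"
    "\<And>t. nowhere_dense_in (Ktop n) (Y t)" "X = (\<Union>t. Y t)" unfolding meager_def by blast
  have "\<not> solid {..<n} (clo {..<n} (\<Union>t. Y t))"
    using meager_nowhere_dense[OF increasing_familyD[OF Y(1)]] Y(2) by (simp add: nowhere_dense_Ktop)
  with Y show ?thesis by (auto simp: nowhere_dense_Ktop)
qed

lemma Baire_structure: "Baire M"
  unfolding Baire_def
proof
  assume "\<exists>Y. definable_increasing_family M 1 Y \<and> (\<forall>t. nowhere_dense_in (Ktop 1) (Y t)) \<and> Kn 1 = (\<Union>t. Y t)"
  moreover have "definable M 1 (Kn 1)"
    unfolding definable_iff_dset Kn_eq_pts by (rule dset_pts) simp
  ultimately have "meager M 1 (Kn 1)" unfolding meager_def by blast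
  then have "nowhere_dense_in (Ktop 1) (Kn 1 :: (nat \<Rightarrow> 'a) set)" by (rule meager_nowhere_dense_in)
  then have "\<not> solid {..<1} (pts {..<1} :: (nat \<Rightarrow> 'a) set)"
    unfolding nowhere_dense_Ktop Kn_eq_pts using clo_subset[OF order_refl] solid_mono by blast
  moreover have "cube {..<1} (restrict (\<lambda>_. 0 :: 'a) {..<1}) 1 \<subseteq> pts {..<1}" by (rule cube_subset_pts)
  ultimately show False unfolding solid_def by (meson restrict_in_pts zero_less_one)
qed

lemma F_sigma_constructible:
  assumes "F_sigma M n X" shows "constructible_in (Ktop n) X"
proof -
  from assms obtain Y where Y: "definable_increasing_family M n Y"
    "\<And>t. closedin (Ktop n) (Y t)" "X = (\<Union>t. Y t)" unfolding F_sigma_def by blast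
  then have "fsigma {..<n} X"
    unfolding fsigma_def closed_family_def
    by (intro exI[of _ Y]) (simp add: increasing_familyD closedin_Ktop)
  then show ?thesis by (intro bool_open_constructible[of M] fsigma_bool_open)
qed

lemma union_pseudo_finite:
  assumes "definable_increasing_family M n Y" "\<And>t. pseudo_finite M n (Y t)"
  shows "pseudo_finite M n (\<Union>t. Y t)"
  using union_pfin[OF increasing_familyD[OF assms(1)]] assms(2) by (simp add: pseudo_finite_iff)

end

theorem theorem3p3:
  fixes M :: "('f, 'r, 'a::{linordered_field, linorder_topology}) fo_structure"
  assumes "expands_ordered_field M"
    and "definably_complete M"
  shows "let conditions =
      [\<forall>X. definable M 1 X \<and> discrete_in (Ktop 1) X \<and> closedin (Ktop 1) X \<longrightarrow> pseudo_finite M 1 X,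
       \<forall>n X. definable M n X \<and> discrete_in (Ktop n) X \<and> closedin (Ktop n) X \<longrightarrow> pseudo_finite M n X,
       \<forall>X. definable M 1 X \<and> discrete_in (Ktop 1) X \<longrightarrow> pseudo_finite M 1 X,
       \<forall>n X. definable M n X \<and> discrete_in (Ktop n) X \<longrightarrow> pseudo_finite M n X,
       \<forall>X. definable M 1 X \<and> nowhere_dense_in (Ktop 1) X \<longrightarrow> pseudo_finite M 1 X,
       \<forall>X. definable M 1 X \<and> meager M 1 X \<longrightarrow> pseudo_finite M 1 X,
       \<forall>X. definable M 1 X \<and> nowhere_dense_in (Ktop 1) X \<longrightarrow> discrete_in (Ktop 1) X,
       locally_o_minimal (open_core M),
       \<forall>Y. definable_increasing_family M 1 Y \<and> (\<forall>t. pseudo_finite M 1 (Y t))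
             \<longrightarrow> pseudo_finite M 1 (\<Union>t. Y t),
       \<forall>n Y. definable_increasing_family M n Y \<and> (\<forall>t. pseudo_finite M n (Y t))
             \<longrightarrow> pseudo_finite M n (\<Union>t. Y t)]
    in (\<forall>P\<in>set conditions. \<forall>Q\<in>set conditions. P \<longleftrightarrow> Q) \<and>
       ((\<exists>P\<in>set conditions. P) \<longrightarrow>
          (\<forall>n X. F_sigma M n X \<longrightarrow> constructible_in (Ktop n) X) \<and>
          Baire M \<and>
          (\<forall>n X. meager M n X \<longrightarrow> nowhere_dense_in (Ktop n) X))"
proof -
  interpret dc_structure M using assms by unfold_locales
  \<comment> \<open>Each of the ten conditions is compared with \<open>tame_structure M\<close>
    only, which gives all pairwise equivalences.\<close>
  let ?T = "tame_structure M"
  have c1: "(\<forall>X. definable M 1 X \<and> discrete_in (Ktop 1) X \<and> closedin (Ktop 1) X \<longrightarrow> pseudo_finite M 1 X) \<longleftrightarrow> ?T"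
    using tame_of_closed_discrete tame_structure.discrete_pseudo_finite[of M] by blast
  have c2: "(\<forall>n X. definable M n X \<and> discrete_in (Ktop n) X \<and> closedin (Ktop n) X \<longrightarrow> pseudo_finite M n X) \<longleftrightarrow> ?T"
    using tame_of_closed_discrete tame_structure.discrete_pseudo_finite[of M] by blast
  have c3: "(\<forall>X. definable M 1 X \<and> discrete_in (Ktop 1) X \<longrightarrow> pseudo_finite M 1 X) \<longleftrightarrow> ?T"
    using tame_of_closed_discrete tame_structure.discrete_pseudo_finite[of M] by blast
  have c4: "(\<forall>n X. definable M n X \<and> discrete_in (Ktop n) X \<longrightarrow> pseudo_finite M n X) \<longleftrightarrow> ?T"
    using tame_of_closed_discrete tame_structure.discrete_pseudo_finite[of M] by blast
  have c5: "(\<forall>X. definable M 1 X \<and> nowhere_dense_in (Ktop 1) X \<longrightarrow> pseudo_finite M 1 X) \<longleftrightarrow> ?T"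
    using tame_of_closed_discrete nowhere_dense_of_closed_discrete
      tame_structure.nowhere_dense_pseudo_finite[of M] by blast
  have c6: "(\<forall>X. definable M 1 X \<and> meager M 1 X \<longrightarrow> pseudo_finite M 1 X) \<longleftrightarrow> ?T"
    \<comment> \<open>Nowhere dense definable sets are meager through constant families; conversely,
      meager sets are nowhere dense once tameness is known.\<close>
    using c5 meager_of_nowhere_dense tame_structure.meager_nowhere_dense_in[of M]
      tame_structure.nowhere_dense_pseudo_finite[of M] by blast
  have c7: "(\<forall>X. definable M 1 X \<and> nowhere_dense_in (Ktop 1) X \<longrightarrow> discrete_in (Ktop 1) X) \<longleftrightarrow> ?T"
  proof
    assume L: "\<forall>X. definable M 1 X \<and> nowhere_dense_in (Ktop 1) X \<longrightarrow> discrete_in (Ktop 1) X"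
    show ?T
      by (intro tame_structure.intro tame_structure_axioms.intro dc_structure_axioms
          bounded_of_nowhere_dense_discrete) (use L in blast)+
  next
    assume ?T
    then show "\<forall>X. definable M 1 X \<and> nowhere_dense_in (Ktop 1) X \<longrightarrow> discrete_in (Ktop 1) X"
      using tame_structure.nowhere_dense_pseudo_finite[of M] unfolding pseudo_finite_def by blast
  qed
  have c8: "locally_o_minimal (open_core M) \<longleftrightarrow> ?T"
    using tame_structure.open_core_locally_o_minimal[of M] bounded_of_locally_o_minimal
    by (auto intro!: tame_structure.intro tame_structure_axioms.intro dc_structure_axioms)
  have c9: "(\<forall>Y. definable_increasing_family M 1 Y \<and> (\<forall>t. pseudo_finite M 1 (Y t))
      \<longrightarrow> pseudo_finite M 1 (\<Union>t. Y t)) \<longleftrightarrow> ?T"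
    using tame_of_pseudo_finite_unions tame_structure.union_pseudo_finite[of M] by blast
  have c10: "(\<forall>n Y. definable_increasing_family M n Y \<and> (\<forall>t. pseudo_finite M n (Y t))
      \<longrightarrow> pseudo_finite M n (\<Union>t. Y t)) \<longleftrightarrow> ?T"
    using tame_of_pseudo_finite_unions tame_structure.union_pseudo_finite[of M] by blast
  have "(\<forall>n X. F_sigma M n X \<longrightarrow> constructible_in (Ktop n) X) \<and> Baire M \<and>
      (\<forall>n X. meager M n X \<longrightarrow> nowhere_dense_in (Ktop n) X)" if ?T
    using that tame_structure.F_sigma_constructible[of M] tame_structure.Baire_structure[of M]
      tame_structure.meager_nowhere_dense_in[of M] by blast
  then show ?thesis
    unfolding Let_def c1 c2 c3 c4 c5 c6 c7 c8 c9 c10 by simp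
qed

end
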